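(* Suppose that for each $n$ the alternative $H_{1n}(\rho)$ holds, i.e. the innovations $\{\varepsilon_t\}$ are i.i.d. with distribution function $A_n(x)=(1-\rho_n)G_0(x)+\rho_nH(x)$, $\rho_n=\min(1,\rho n^{-1/2})$. Suppose that random variables with distribution functions $G_0$ and $H$ have zero means and finite variances, that $G_0$ and $H$ are twice differentiable with bounded second derivatives, and that $G_0$ and $H$ are symmetric about zero. Let $\hat\mu_n$ and $\hat{\boldsymbol{\beta}}_n$ be any estimators such that $n^{1/2}(\hat\mu_n-\mu)=O_P(1)$ and $n^{1/2}(\hat{\boldsymbol{\beta}}_n-\boldsymbol{\beta})=O_P(1)$ as $n\to\infty$ under $H_{1n}(\rho)$, uniformly in $\gamma\le\Gamma$, $\rho\le R$, for any finite $\Gamma,R\ge0$. Then for any finite $\Gamma\ge0$, $R\ge0$, $$ \sup_{x\in\mathbb{R},\;0\le\gamma\le\Gamma,\;0\le\rho\le R}\big|\mathsf{P}(\hat\chi_n^2\le x)-F_{m-1}(x,\hat\lambda^2(\rho,\gamma,\Pi))\big|\to0,\qquad n\to\infty, $$ where $F_{m-1}(\cdot,\lambda^2)$ is the distribution function of the noncentral chi-square distribution with $m-1$ degrees of freedom and noncentrality parameter $\lambda^2$, and $$ \hat\lambda^2(\rho,\gamma,\Pi)=\big|\boldsymbol{P}_0^{-1/2}[\rho(\boldsymbol{p}^H-\boldsymbol{p}^0)+\gamma\boldsymbol{\delta}(\Pi)]\big|^2 . $$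
   Context: Model. Fix $p\ge1$, $\boldsymbol{\beta}=(\beta_1,\dots,\beta_p)^T\in\mathbb{R}^p$ such that all roots of the characteristic equation $\lambda^p-\beta_1\lambda^{p-1}-\dots-\beta_p=0$ are less than one in modulus, and $\nu\in\mathbb{R}$. Let $\{v_t\}_{t\in\mathbb{Z}}$ be the stationary solution of $v_t=\beta_1v_{t-1}+\dots+\beta_pv_{t-p}+\nu+\varepsilon_t$, where the innovations $\{\varepsilon_t\}$ are i.i.d. with zero mean and finite positive variance. Let $\mu$ be defined by $\nu=(1-\beta_1-\dots-\beta_p)\mu$. Outliers. $\{z_t^{\gamma_n}\}$ are i.i.d. random variables taking value $1$ with probability $\gamma_n=\min(1,\gamma n^{-1/2})$ and $0$ with probability $1-\gamma_n$, where $\gamma\ge0$; $\{\xi_t\}$ are i.i.d. with an arbitrary distribution $\Pi$ on $\mathbb{R}$. The sequences $\{\varepsilon_t\}$, $\{z_t^{\gamma_n}\}$, $\{\xi_t\}$ are mutually independent. The observations are $y_t=v_t+z_t^{\gamma_n}\xi_t$, $t=1-p,\dots,n$. $G_0$ and $H$ are fixed distribution functions, $\rho\ge0$. Under $H_{1n}(\rho)$ the innovations (hence $v_t$) depend on $n$ through their distribution $A_n$; $\mathsf{P}$ is the probability in the model with parameters $n,\gamma,\rho$. A distribution function $F$ is symmetric about zero if a random variable $X$ with distribution function $F$ has the same distribution as $-X$. Estimators and residuals. $\hat\mu_n$ is a real-valued and $\hat{\boldsymbol{\beta}}_n=(\hat\beta_{1n},\dots,\hat\beta_{pn})^T$ an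 $\mathbb{R}^p$-valued sequence of estimators constructed from the observations. "$X_n=O_P(1)$ uniformly in $\gamma\le\Gamma,\rho\le R$" means $\lim_{C\to\infty}\limsup_{n\to\infty}\sup_{0\le\gamma\le\Gamma,0\le\rho\le R}\mathsf{P}(|X_n|>C)=0$. Put $\hat u_t=y_t-\hat\mu_n$ for $t=1-p,\dots,n$, and define the residuals $\hat\varepsilon_t=\hat u_t-\hat\beta_{1n}\hat u_{t-1}-\dots-\hat\beta_{pn}\hat u_{t-p}$, $t=1,\dots,n$. Test statistic. Fix $m>1$ and $0=x_0<x_1<\dots<x_m=\infty$. Let $B_j^+=(x_{j-1},x_j]$, $B_j^-=(-x_j,-x_{j-1}]$, $j=1,\dots,m$, and assume $G_0(x_j)-G_0(x_{j-1})>0$ for all $j$. Put $p_j^0=2(G_0(x_j)-G_0(x_{j-1}))$ (so $\sum_jp_j^0=1$), and let $\hat\nu_j$ be the number of $t\in\{1,\dots,n\}$ with $\hat\varepsilon_t\in B_j^+\cup B_j^-$. The symmetrized Pearson statistic is $$\hat\chi_n^2=\sum_{j=1}^m\frac{(\hat\nu_j-np_j^0)^2}{np_j^0}.$$ Parameters of the limit. $\boldsymbol{P}_0=\mathrm{diag}\{p_1^0,\dots,p_m^0\}$, $\boldsymbol{p}^0=(p_1^0,\dots,p_m^0)^T$, $\boldsymbol{p}^H=(p_1^H,\dots,p_m^H)^T$ with $p_j^H=2(H(x_j)-H(x_{j-1}))$; $\boldsymbol{\delta}(\Pi)=(\delta_1(\Pi),\dots,\delta_m(\Pi))^T$ with $\delta_j(\Pi)=2[\Delta_S(x_j,\Pi)-\Delta_S(x_{j-1},\Pi)]$,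 where $$\Delta_S(x,\Pi)=\frac{\Delta(x,\Pi)-\Delta(-x,\Pi)}{2},\qquad\Delta(x,\Pi)=\sum_{j=0}^p\big[\mathsf{E}\,G_0(x+\beta_j\xi_1)-G_0(x)\big],\quad\beta_0=-1,$$ and $\Delta_S(\infty,\Pi)=0$ (the limit as $x\to\infty$). $|\cdot|$ is the Euclidean norm. The noncentral chi-square distribution with $k$ degrees of freedom and noncentrality parameter $\lambda^2$ is the law of $\sum_{i=1}^k(Z_i+a_i)^2$ with $Z_i$ i.i.d. standard normal and $\sum_ia_i^2=\lambda^2$. *)

theory Defs
  imports "HOL-Probability.Probability"
begin

text \<open>Vectors in \<open>\<real>\<^sup>p\<close> and \<open>\<real>\<^sup>m\<close> are functions on \<open>nat\<close>, read at the indices \<open>1, \<dots>, p\<close>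
  (resp. \<open>1, \<dots>, m\<close>); their Euclidean norm is \<^const>\<open>L2_set\<close> over that index set.
  Distribution functions are represented by the laws they determine, through \<^const>\<open>cdf\<close>.\<close>

definition ar_stable :: "nat \<Rightarrow> (nat \<Rightarrow> real) \<Rightarrow> bool" where
  "ar_stable p \<beta> \<longleftrightarrow>
     (\<forall>w::complex. w ^ p - (\<Sum>j=1..p. of_real (\<beta> j) * w ^ (p - j)) = 0 \<longrightarrow> cmod w < 1)"

definition strictly_stationary :: "'a measure \<Rightarrow> (int \<Rightarrow> 'a \<Rightarrow> real) \<Rightarrow> bool" where
  "strictly_stationary M v \<longleftrightarrow> (\<forall>t. v t \<in> borel_measurable M) \<and>
     (\<forall>J h. finite J \<longrightarrow>
        distr M (PiM J (\<lambda>_. borel)) (\<lambda>\<omega>. \<lambda>t\<in>J. v (t + h) \<omega>) =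
        distr M (PiM J (\<lambda>_. borel)) (\<lambda>\<omega>. \<lambda>t\<in>J. v t \<omega>))"

text \<open>The autoregression \<open>v\<close> with innovation distribution function \<open>A\<close>, together with the
  contamination mechanism: outliers \<open>\<xi>\<close> with law \<open>Q\<close> (written \<open>\<Pi>\<close> in the literature)
  occurring with probability \<open>q\<close>. Under stability the stationary solution is unique up to
  null sets, so strict stationarity and the (almost sure) recursion determine \<open>v\<close>.\<close>

locale contaminated_ar = prob_space M for M :: "'a measure" +
  fixes p :: nat and \<beta> :: "nat \<Rightarrow> real" and \<nu> :: real
    and A :: "real \<Rightarrow> real" and q :: real and Q :: "real measure"
    and \<epsilon> z \<xi> v :: "int \<Rightarrow> 'a \<Rightarrow> real"
  assumes innov_indep: "indep_vars (\<lambda>_. borel) \<epsilon> UNIV"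
    and innov_cdf: "\<And>t. cdf (distr M borel (\<epsilon> t)) = A"
    and innov_square_integrable: "\<And>t. integrable M (\<lambda>\<omega>. (\<epsilon> t \<omega>)\<^sup>2)"
    and innov_mean: "\<And>t. expectation (\<epsilon> t) = 0"
    and innov_variance: "\<And>t. variance (\<epsilon> t) > 0"
    and switch_indep: "indep_vars (\<lambda>_. borel) z UNIV"
    and switch_1: "\<And>t. prob {\<omega> \<in> space M. z t \<omega> = 1} = q"
    and switch_0: "\<And>t. prob {\<omega> \<in> space M. z t \<omega> = 0} = 1 - q"
    and outlier_indep: "indep_vars (\<lambda>_. borel) \<xi> UNIV"
    and outlier_law: "\<And>t. distr M borel (\<xi> t) = Q"
    and sequences_indep:
      "indep_vars (\<lambda>_. PiM UNIV (\<lambda>_. borel)) (\<lambda>i \<omega> t. ([\<epsilon>, z, \<xi>] ! i) t \<omega>) {..<3::nat}"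
    and stationary: "strictly_stationary M v"
    and recursion: "\<And>t. AE \<omega> in M. v t \<omega> = (\<Sum>j=1..p. \<beta> j * v (t - int j) \<omega>) + \<nu> + \<epsilon> t \<omega>"

definition sample_window :: "nat \<Rightarrow> nat \<Rightarrow> int set" where
  "sample_window p n = {1 - int p..int n}"

definition observations ::
    "nat \<Rightarrow> nat \<Rightarrow> (int \<Rightarrow> 'a \<Rightarrow> real) \<Rightarrow> (int \<Rightarrow> 'a \<Rightarrow> real) \<Rightarrow> (int \<Rightarrow> 'a \<Rightarrow> real) \<Rightarrow> 'a \<Rightarrow> int \<Rightarrow> real" where
  "observations p n v z \<xi> \<omega> = (\<lambda>t\<in>sample_window p n. v t \<omega> + z t \<omega> * \<xi> t \<omega>)"

definition unif_bounded_in_prob ::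
    "(nat \<Rightarrow> real \<Rightarrow> real \<Rightarrow> 'a measure) \<Rightarrow> (nat \<Rightarrow> real \<Rightarrow> real \<Rightarrow> 'a \<Rightarrow> real) \<Rightarrow> real \<Rightarrow> real \<Rightarrow> bool" where
  "unif_bounded_in_prob M X \<Gamma> R \<longleftrightarrow>
     ((\<lambda>C::real. limsup (\<lambda>n. SUP (\<gamma>, \<rho>) \<in> {0..\<Gamma>} \<times> {0..R}.
         ereal (measure (M n \<gamma> \<rho>) {\<omega> \<in> space (M n \<gamma> \<rho>). \<bar>X n \<gamma> \<rho> \<omega>\<bar> > C}))) \<longlongrightarrow> 0) at_top"

definition residual :: "nat \<Rightarrow> real \<Rightarrow> (nat \<Rightarrow> real) \<Rightarrow> (int \<Rightarrow> real) \<Rightarrow> int \<Rightarrow> real" where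
  "residual p mu b y t = (y t - mu) - (\<Sum>j=1..p. b j * (y (t - int j) - mu))"

text \<open>The value at \<open>x\<close> of \<open>F\<close> extended to \<open>\<infinity>\<close> by \<open>c\<close> (its limit there).\<close>

definition extend_at_infty :: "real \<Rightarrow> (real \<Rightarrow> real) \<Rightarrow> ereal \<Rightarrow> real" where
  "extend_at_infty c F x = (if x = \<infinity> then c else F (real_of_ereal x))"

text \<open>The cell \<open>B\<^sub>j\<^sup>+ \<union> B\<^sub>j\<^sup>-\<close>, and its probability \<open>2 (F(x\<^sub>j) - F(x\<^sub>j\<^sub>-\<^sub>1))\<close> under a
  symmetric continuous distribution function \<open>F\<close>.\<close>

definition sym_cell :: "(nat \<Rightarrow> ereal) \<Rightarrow> nat \<Rightarrow> real set" where
  "sym_cell x j = {u. x (j - 1) < ereal u \<and> ereal u \<le> x j} \<union>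
                  {u. - x j < ereal u \<and> ereal u \<le> - x (j - 1)}"

definition sym_cell_prob :: "(real \<Rightarrow> real) \<Rightarrow> (nat \<Rightarrow> ereal) \<Rightarrow> nat \<Rightarrow> real" where
  "sym_cell_prob F x j = 2 * (extend_at_infty 1 F (x j) - extend_at_infty 1 F (x (j - 1)))"

definition sym_pearson ::
    "(real \<Rightarrow> real) \<Rightarrow> nat \<Rightarrow> (nat \<Rightarrow> ereal) \<Rightarrow> nat \<Rightarrow> (int \<Rightarrow> real) \<Rightarrow> real" where
  "sym_pearson G m x n e =
     (\<Sum>j=1..m. (real (card {t \<in> {1..int n}. e t \<in> sym_cell x j}) - real n * sym_cell_prob G x j)\<^sup>2
               / (real n * sym_cell_prob G x j))"

definition outlier_shift :: "(real \<Rightarrow> real) \<Rightarrow> nat \<Rightarrow> (nat \<Rightarrow> real) \<Rightarrow> real measure \<Rightarrow> real \<Rightarrow> real" where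
  "outlier_shift G p \<beta> Q x = (\<Sum>j=0..p. (\<integral>u. G (x + (\<beta>(0 := -1)) j * u) \<partial>Q) - G x)"

definition outlier_shift_sym :: "(real \<Rightarrow> real) \<Rightarrow> nat \<Rightarrow> (nat \<Rightarrow> real) \<Rightarrow> real measure \<Rightarrow> real \<Rightarrow> real" where
  "outlier_shift_sym G p \<beta> Q x = (outlier_shift G p \<beta> Q x - outlier_shift G p \<beta> Q (- x)) / 2"

definition outlier_delta ::
    "(real \<Rightarrow> real) \<Rightarrow> nat \<Rightarrow> (nat \<Rightarrow> real) \<Rightarrow> real measure \<Rightarrow> (nat \<Rightarrow> ereal) \<Rightarrow> nat \<Rightarrow> real" where
  "outlier_delta G p \<beta> Q x j =
     2 * (extend_at_infty 0 (outlier_shift_sym G p \<beta> Q) (x j)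
          - extend_at_infty 0 (outlier_shift_sym G p \<beta> Q) (x (j - 1)))"

definition noncentrality ::
    "(real \<Rightarrow> real) \<Rightarrow> (real \<Rightarrow> real) \<Rightarrow> nat \<Rightarrow> (nat \<Rightarrow> ereal) \<Rightarrow> nat \<Rightarrow> (nat \<Rightarrow> real) \<Rightarrow> real measure
      \<Rightarrow> real \<Rightarrow> real \<Rightarrow> real" where
  "noncentrality G H m x p \<beta> Q \<rho> \<gamma> =
     (L2_set (\<lambda>j. (\<rho> * (sym_cell_prob H x j - sym_cell_prob G x j) + \<gamma> * outlier_delta G p \<beta> Q x j)
                   / sqrt (sym_cell_prob G x j)) {1..m})\<^sup>2"

text \<open>By rotation invariance of the Gaussian law, the shift vector \<open>a\<close> enters only through the
  sum of its squares, so which one is chosen does not matter.\<close>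

definition noncentral_chi_square :: "nat \<Rightarrow> real \<Rightarrow> real measure" where
  "noncentral_chi_square k l =
     (let a = (SOME a :: nat \<Rightarrow> real. (\<Sum>i=1..k. (a i)\<^sup>2) = l)
      in distr (PiM {1..k} (\<lambda>_. density lborel (\<lambda>u. ennreal (std_normal_density u)))) borel
           (\<lambda>Z. \<Sum>i=1..k. (Z i + a i)\<^sup>2))"

definition twice_diff_bounded :: "(real \<Rightarrow> real) \<Rightarrow> bool" where
  "twice_diff_bounded F \<longleftrightarrow> (\<exists>F' F''. (\<forall>x. (F has_real_derivative F' x) (at x)) \<and>
     (\<forall>x. (F' has_real_derivative F'' x) (at x)) \<and> bounded (range F''))"

end

theory Submission
  imports Defs "HOL-Complex_Analysis.Complex_Analysis"
begin

text \<open>Suppose the convergence were not uniform; then it fails along a sequence of sample sizes with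
  convergent parameters \<open>\<gamma>\<^sub>n, \<rho>\<^sub>n\<close>, so it suffices to prove convergence in law along such sequences.

  The residuals are \<open>\<epsilon>\<^sub>t\<close> plus a combination of the outliers in the window \<open>t - p, \<dots>, t\<close> plus a drift of
  order \<open>n\<^sup>-\<^sup>1\<^sup>/\<^sup>2\<close> that is linear in the estimation errors. For deterministic coefficients the residual
  empirical process differs from that of the innovations by a sum of martingale differences that is
  negligible in \<open>L\<^sup>2\<close>, by the density times the mean drift, and by the mean effect \<open>\<gamma> \<Delta>\<close> of single
  outliers. Monotonicity and a finite grid extend this to the random coefficients, and symmetrization
  cancels the drift because the density is even. Hence the cell counts behave like multinomial
  counts shifted by \<open>\<gamma> \<delta>(\<Pi>)\<close>.

  For those, writing \<open>exp (- t |y|\<^sup>2 / 2)\<close> as a Gaussian average of characters turns convergence of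
  characteristic functions into convergence of the Laplace transform of the Pearson statistic, and
  Laplace transforms at the integers determine weak limits on the half line by the Weierstrass theorem.\<close>

section \<open>Impulse response of a stable autoregression\<close>

text \<open>Three obstacles shape the argument. The estimators depend on the whole sample, so the
  coefficients of the drift are not predictable and martingale differences are available for
  deterministic coefficients only; tightness confines the random ones to a box, and the cost of a
  grid of mesh \<open>\<eta>\<close> is linear in \<open>\<eta>\<close>, so the mesh can be fixed
  before the sample size grows. The outlier law is arbitrary, so no moment of an outlier can be
  used: outliers enter through bounded functionals, truncated by \<open>min 1\<close>, and two of
  them share a window with probability of order \<open>1 / n\<close>, which stays negligible after
  summation and division by \<open>sqrt n\<close>. Every model lives on its own probability space
  with its own innovation law, so the errors are estimated by explicit bounds for a single model,
  with constants that stay controlled along a sequence. The normalized counts have a singular limit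
  covariance, the identity minus a projection. Under the mixture alternative the innovation counts
  are exactly multinomial with drifting cell probabilities, so their limit is computed directly,
  without contiguity.\<close>

definition ar_poly :: "nat \<Rightarrow> (nat \<Rightarrow> real) \<Rightarrow> real poly" where
  "ar_poly p \<beta> = 1 - (\<Sum>j=1..p. monom (\<beta> j) j)"

text \<open>The weights of the causal moving average, as coefficients of the formal reciprocal of
  \<open>ar_poly\<close>. That polynomial is the characteristic one with reversed coefficients, so
  its zeros are the reciprocals of the nonzero characteristic roots.\<close>

definition impulse :: "nat \<Rightarrow> (nat \<Rightarrow> real) \<Rightarrow> nat \<Rightarrow> real" where
  "impulse p \<beta> k = fps_nth (inverse (fps_of_poly (ar_poly p \<beta>))) k"

lemma coeff_ar_poly: "coeff (ar_poly p \<beta>) j = (if j = 0 then 1 else if j \<le> p then - \<beta> j else 0)"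
  by (auto simp: ar_poly_def coeff_sum coeff_1)

lemma ar_poly_mult_impulse: "fps_of_poly (ar_poly p \<beta>) * Abs_fps (impulse p \<beta>) = 1"
proof -
  have "Abs_fps (impulse p \<beta>) = inverse (fps_of_poly (ar_poly p \<beta>))"
    by (simp add: impulse_def fps_eq_iff)
  then show ?thesis
    by (simp add: inverse_mult_eq_1' coeff_ar_poly)
qed

lemma impulse_0: "impulse p \<beta> 0 = 1"
  by (simp add: impulse_def coeff_ar_poly)

text \<open>Comparison of the coefficients of degree \<open>k\<close> in
  \<open>ar_poly_mult_impulse\<close>; the guard stands for impulse weights that vanish at negative
  indices.\<close>

lemma impulse_rec:
  assumes "k > 0"
  shows "impulse p \<beta> k = (\<Sum>j=1..p. if j \<le> k then \<beta> j * impulse p \<beta> (k - j) else 0)"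
proof -
  have "0 = fps_nth (fps_of_poly (ar_poly p \<beta>) * Abs_fps (impulse p \<beta>)) k"
    using assms by (simp add: ar_poly_mult_impulse)
  also have "\<dots> = (\<Sum>j=0..k. coeff (ar_poly p \<beta>) j * impulse p \<beta> (k - j))"
    by (simp add: fps_mult_nth)
  also have "\<dots> = impulse p \<beta> k + (\<Sum>j=1..k. coeff (ar_poly p \<beta>) j * impulse p \<beta> (k - j))"
    by (simp add: sum.atLeast_Suc_atMost coeff_ar_poly)
  also have "(\<Sum>j=1..k. coeff (ar_poly p \<beta>) j * impulse p \<beta> (k - j))
      = (\<Sum>j\<in>{1..k} \<inter> {1..p}. - (\<beta> j * impulse p \<beta> (k - j)))"
    by (intro sum.mono_neutral_cong_right) (auto simp: coeff_ar_poly)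
  also have "\<dots> = (\<Sum>j=1..p. if j \<le> k then - (\<beta> j * impulse p \<beta> (k - j)) else 0)"
    by (intro sum.mono_neutral_cong_left) auto
  also have "\<dots> = - (\<Sum>j=1..p. if j \<le> k then \<beta> j * impulse p \<beta> (k - j) else 0)"
    by (simp add: sum_negf[symmetric] if_distrib cong: if_cong)
  finally show ?thesis by linarith
qed

text \<open>Stability puts the zeros of the reversed polynomial outside the closed unit disc. There
  are finitely many, so a disc of some radius \<open>R > 1\<close> is free of them; the reciprocal
  series converges in it, hence absolutely at 1.\<close>

lemma summable_impulse:
  assumes "ar_stable p \<beta>"
  shows "summable (\<lambda>k. \<bar>impulse p \<beta> k\<bar>)"
proof -
  define P where "P = map_poly complex_of_real (ar_poly p \<beta>)"
  have cP: "coeff P j = of_real (coeff (ar_poly p \<beta>) j)" for j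
    by (simp add: P_def coeff_map_poly)
  have Pne: "P \<noteq> 0"
    using cP[of 0] by (auto simp: coeff_ar_poly)
  have Peq: "P = 1 - (\<Sum>j=1..p. monom (complex_of_real (\<beta> j)) j)"
    by (rule poly_eqI) (auto simp: cP coeff_ar_poly coeff_sum coeff_1)
  have zeros: "cmod w > 1" if w: "poly P w = 0" for w
  proof -
    have "w \<noteq> 0"
      using w cP[of 0] by (auto simp: poly_0_coeff_0 coeff_ar_poly)
    \<comment> \<open>The characteristic polynomial at \<open>1 / w\<close> is
      \<open>poly P w\<close> times a power of \<open>1 / w\<close>, so a zero of \<open>P\<close>
      is the reciprocal of a characteristic root.\<close>
    have "(1 / w) ^ p - (\<Sum>j=1..p. of_real (\<beta> j) * (1 / w) ^ (p - j)) = (1 / w) ^ p * poly P w"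
      using \<open>w \<noteq> 0\<close>
      by (auto simp: Peq poly_sum poly_monom right_diff_distrib sum_distrib_left power_diff power_divide field_simps
          intro!: sum.cong)
    with w have "cmod (1 / w) < 1"
      using assms unfolding ar_stable_def by (metis mult_zero_right)
    then show ?thesis
      using \<open>w \<noteq> 0\<close> by (simp add: norm_divide field_simps)
  qed
  obtain R where R: "R > 1" "\<And>w. poly P w = 0 \<Longrightarrow> cmod w \<ge> R"
  proof (cases "{w. poly P w = 0} = {}")
    case True
    \<comment> \<open>Without zeros \<open>P\<close> is constant and any radius above 1
      serves.\<close>
    then show ?thesis using that[of 2] by auto
  next
    case False
    have fin: "finite {w. poly P w = 0}" using Pne by (rule poly_roots_finite)
    let ?R = "Min (cmod ` {w. poly P w = 0})"
    have "?R \<in> cmod ` {w. poly P w = 0}" using fin False by (intro Min_in) auto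
    then have "?R > 1" using zeros by auto
    moreover have "cmod w \<ge> ?R" if "poly P w = 0" for w using fin that by (intro Min_le) auto
    ultimately show ?thesis using that by blast
  qed
  have "fps_conv_radius (inverse (fps_of_poly P)) \<ge> min (ereal R) (fps_conv_radius (fps_of_poly P))"
    using R by (intro fps_conv_radius_inverse) (force simp: eval_fps_of_poly)
  then have rad: "fps_conv_radius (inverse (fps_of_poly P)) \<ge> ereal R" by simp
  have "fps_of_poly P * Abs_fps (\<lambda>k. of_real (impulse p \<beta> k)) = 1"
  proof (rule fps_ext)
    fix k
    have "fps_nth (fps_of_poly P * Abs_fps (\<lambda>k. of_real (impulse p \<beta> k))) k
      = of_real (fps_nth (fps_of_poly (ar_poly p \<beta>) * Abs_fps (impulse p \<beta>)) k)"
      by (simp add: fps_mult_nth cP)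
    then show "fps_nth (fps_of_poly P * Abs_fps (\<lambda>k. of_real (impulse p \<beta> k))) k = fps_nth 1 k"
      by (simp add: ar_poly_mult_impulse)
  qed
  then have "inverse (fps_of_poly P) = Abs_fps (\<lambda>k. of_real (impulse p \<beta> k))"
    by (rule fps_inverse_unique)
  then have "conv_radius (\<lambda>k. complex_of_real (impulse p \<beta> k)) \<ge> ereal R"
    using rad by (simp add: fps_conv_radius_def)
  then have "ereal (norm (1::complex)) < conv_radius (\<lambda>k. complex_of_real (impulse p \<beta> k))"
    by (rule less_le_trans[rotated]) (use R(1) in simp)
  from abs_summable_in_conv_radius[OF this] show ?thesis
    by simp
qed

text \<open>The recursion substituted into itself until only innovations down to time
  \<open>t - N\<close> and the \<open>p\<close> values of \<open>v\<close> just before that time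
  remain. The latter carry weights \<open>impulse p \<beta> (N - i)\<close>, which vanish as
  \<open>N\<close> grows in a stable model.\<close>

lemma impulse_expand:
  fixes v e :: "int \<Rightarrow> real"
  assumes rec: "\<And>t. v t = (\<Sum>j=1..p. \<beta> j * v (t - int j)) + e t"
  shows "v t = (\<Sum>k\<le>N. impulse p \<beta> k * e (t - int k))
     + (\<Sum>j=1..p. \<beta> j * (\<Sum>i<j. (if i \<le> N then impulse p \<beta> (N - i) else 0) * v (t - int N + int i - int j)))"
proof (induction N)
  case 0
  have "(\<Sum>i<j. (if i \<le> 0 then impulse p \<beta> (0 - i) else 0) * v (t - int 0 + int i - int j)) = v (t - int j)"
    if "j \<in> {1..p}" for j
  proof -
    have "(\<Sum>i<j. (if i \<le> 0 then impulse p \<beta> (0 - i) else 0) * v (t - int 0 + int i - int j))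
       = (\<Sum>i\<in>{0}. (if i \<le> 0 then impulse p \<beta> (0 - i) else 0) * v (t - int 0 + int i - int j))"
      using that by (intro sum.mono_neutral_right) auto
    then show ?thesis by (simp add: impulse_0)
  qed
  then show ?case using rec[of t] by (simp add: impulse_0)
next
  case (Suc N)
  \<comment> \<open>Extension of the impulse response by zero to negative indices; the boundary sums
    at \<open>N\<close> and \<open>Suc N\<close> then differ by a telescoping sum in
    \<open>i\<close>.\<close>
  define \<psi> where "\<psi> = (\<lambda>k::int. if k \<ge> 0 then impulse p \<beta> (nat k) else 0)"
  define f where "f = (\<lambda>M::nat. \<lambda>j::nat. (\<Sum>i<j. \<psi> (int M - int i) * v (t - int M + int i - int j)))"
  have conv: "(\<Sum>i<j. (if i \<le> M then impulse p \<beta> (M - i) else 0) * v (t - int M + int i - int j)) = f M j"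
    for M j unfolding f_def \<psi>_def by (intro sum.cong) (auto simp: nat_diff_distrib)
  have nat_N: "nat (1 + int N) = Suc N" by arith
  have step: "f (Suc N) j - f N j = impulse p \<beta> (Suc N) * v (t - int (Suc N) - int j)
      - \<psi> (int (Suc N) - int j) * v (t - int (Suc N))" for j
  proof -
    have "f N j = (\<Sum>i<j. \<psi> (int (Suc N) - int (Suc i)) * v (t - int (Suc N) + int (Suc i) - int j))"
      unfolding f_def by (intro sum.cong) (auto simp: algebra_simps)
    then have "f (Suc N) j - f N j = - (\<Sum>i<j. \<psi> (int (Suc N) - int (Suc i)) * v (t - int (Suc N) + int (Suc i) - int j)
        - \<psi> (int (Suc N) - int i) * v (t - int (Suc N) + int i - int j))"
      unfolding f_def sum_subtractf by simp
    also have "\<dots> = - (\<psi> (int (Suc N) - int j) * v (t - int (Suc N) + int j - int j)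
       - \<psi> (int (Suc N) - int 0) * v (t - int (Suc N) + int 0 - int j))"
      by (subst sum_lessThan_telescope) auto
    finally show ?thesis by (simp add: \<psi>_def del: of_nat_Suc)
  qed
  have "(\<Sum>j=1..p. \<beta> j * f (Suc N) j) - (\<Sum>j=1..p. \<beta> j * f N j)
     = (\<Sum>j=1..p. \<beta> j * (f (Suc N) j - f N j))"
    by (simp add: sum_subtractf algebra_simps)
  also have "\<dots> = impulse p \<beta> (Suc N) * (\<Sum>j=1..p. \<beta> j * v (t - int (Suc N) - int j))
      - (\<Sum>j=1..p. \<beta> j * \<psi> (int (Suc N) - int j)) * v (t - int (Suc N))"
    by (simp only: step right_diff_distrib sum_subtractf sum_distrib_left sum_distrib_right mult.assoc mult.left_commute)
  also have "(\<Sum>j=1..p. \<beta> j * \<psi> (int (Suc N) - int j)) = impulse p \<beta> (Suc N)"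
    unfolding impulse_rec[of "Suc N", OF zero_less_Suc] \<psi>_def
    by (intro sum.cong) (auto simp: nat_diff_distrib nat_N)
  also have "(\<Sum>j=1..p. \<beta> j * v (t - int (Suc N) - int j)) = v (t - int (Suc N)) - e (t - int (Suc N))"
    using rec[of "t - int (Suc N)"] by simp
  finally have "(\<Sum>j=1..p. \<beta> j * f (Suc N) j) = (\<Sum>j=1..p. \<beta> j * f N j) - impulse p \<beta> (Suc N) * e (t - int (Suc N))"
    by (simp add: algebra_simps)
  then show ?case using Suc unfolding conv by simp
qed

section \<open>Noncentral chi-square laws and weak convergence through Laplace transforms\<close>

text \<open>Completion of the square: the exponential factor turns the standard normal density into
  a multiple of the normal density with mean \<open>- t * a / (1 + t)\<close> and variance
  \<open>1 / (1 + t)\<close>.\<close>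

lemma std_normal_laplace:
  fixes t a :: real
  assumes t: "t \<ge> 0"
  shows "(\<integral>z. exp (- (t / 2) * (z + a)\<^sup>2) \<partial>std_normal_distribution)
     = exp (- t * a\<^sup>2 / (2 * (1 + t))) / sqrt (1 + t)"
proof -
  define \<sigma> where "\<sigma> = 1 / sqrt (1 + t)"
  have \<sigma>: "\<sigma> > 0" "\<sigma>\<^sup>2 = 1 / (1 + t)"
    using t by (auto simp: \<sigma>_def power_divide)
  have eq: "std_normal_density z * exp (- (t / 2) * (z + a)\<^sup>2)
      = \<sigma> * exp (- t * a\<^sup>2 / (2 * (1 + t))) * normal_density (- t * a / (1 + t)) \<sigma> z" for z
  proof -
    \<comment> \<open>Writing \<open>a\<close> as a multiple of \<open>1 + t\<close> clears the
      denominators, so the completed square becomes a polynomial identity.\<close>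
    define b where "b = a / (1 + t)"
    have ab: "a = b * (1 + t)" using t by (simp add: b_def)
    have 1: "- t * a / (1 + t) = - t * b" "- t * a\<^sup>2 / (2 * (1 + t)) = - t * b\<^sup>2 * (1 + t) / 2"
      using t by (simp_all add: ab power2_eq_square) (simp add: field_simps)
    have 2: "(z - - t * b)\<^sup>2 / (2 * \<sigma>\<^sup>2) = (z + t * b)\<^sup>2 * (1 + t) / 2"
      using t by (simp add: \<sigma>)
    have "- z\<^sup>2 / 2 + - (t / 2) * (z + a)\<^sup>2
        = - t * a\<^sup>2 / (2 * (1 + t)) - (z - - t * a / (1 + t))\<^sup>2 / (2 * \<sigma>\<^sup>2)"
      unfolding 1 2 unfolding ab by (simp add: power2_eq_square algebra_simps add_divide_distrib diff_divide_distrib)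
    moreover have "1 / sqrt (2 * pi) = \<sigma> * (1 / sqrt (2 * pi * \<sigma>\<^sup>2))"
      using \<sigma>(1) by (simp add: real_sqrt_mult)
    ultimately have "1 / sqrt (2 * pi) * exp (- z\<^sup>2 / 2 + - (t / 2) * (z + a)\<^sup>2)
       = \<sigma> * (1 / sqrt (2 * pi * \<sigma>\<^sup>2)) * exp (- t * a\<^sup>2 / (2 * (1 + t)) + - ((z - - t * a / (1 + t))\<^sup>2 / (2 * \<sigma>\<^sup>2)))"
      by simp
    then show ?thesis
      unfolding exp_add by (simp add: std_normal_density_def normal_density_def mult_ac)
  qed
  have "(\<integral>z. exp (- (t / 2) * (z + a)\<^sup>2) \<partial>std_normal_distribution)
     = (\<integral>z. std_normal_density z * exp (- (t / 2) * (z + a)\<^sup>2) \<partial>lborel)"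
    by (subst integral_density) (auto simp: normal_density_nonneg)
  also have "\<dots> = \<sigma> * exp (- t * a\<^sup>2 / (2 * (1 + t)))"
    unfolding eq using \<sigma>(1) by simp
  finally show ?thesis by (simp add: \<sigma>_def)
qed

text \<open>The substitution \<open>g = \<sigma> * h\<close> with
  \<open>\<sigma> = 1 / sqrt (1 + t)\<close> absorbs the quadratic factor into the Gaussian density
  and leaves the normal characteristic function at \<open>a * \<sigma>\<close>.\<close>

lemma std_normal_char_laplace:
  fixes t a :: real
  assumes t: "t \<ge> 0"
  shows "(CLINT g|std_normal_distribution. iexp (a * g) * of_real (exp (- t * g\<^sup>2 / 2)))
     = of_real (exp (- a\<^sup>2 / (2 * (1 + t))) / sqrt (1 + t))"
proof -
  define \<sigma> where "\<sigma> = 1 / sqrt (1 + t)"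
  have \<sigma>: "\<sigma> > 0" "\<sigma>\<^sup>2 = 1 / (1 + t)"
    using t by (auto simp: \<sigma>_def power_divide)
  have dens: "std_normal_density (\<sigma> * h) * exp (- t * (\<sigma> * h)\<^sup>2 / 2) = std_normal_density h" for h
  proof -
    have "- (\<sigma> * h)\<^sup>2 / 2 + - t * (\<sigma> * h)\<^sup>2 / 2 = - h\<^sup>2 / 2"
    proof -
      have "- (\<sigma> * h)\<^sup>2 / 2 + - t * (\<sigma> * h)\<^sup>2 / 2 = - (((1 + t) * \<sigma>\<^sup>2) * h\<^sup>2) / 2"
        by (simp add: power_mult_distrib algebra_simps add_divide_distrib diff_divide_distrib)
      also have "(1 + t) * \<sigma>\<^sup>2 = 1" using t by (simp add: \<sigma>)
      finally show ?thesis by simp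
    qed
    then show ?thesis
      by (simp add: std_normal_density_def mult_exp_exp)
  qed
  have "(CLINT g|std_normal_distribution. iexp (a * g) * of_real (exp (- t * g\<^sup>2 / 2)))
     = (\<integral>g. std_normal_density g *\<^sub>R (iexp (a * g) * of_real (exp (- t * g\<^sup>2 / 2))) \<partial>lborel)"
    by (subst integral_density) (auto simp: normal_density_nonneg)
  also have "\<dots> = \<sigma> *\<^sub>R (\<integral>h. std_normal_density (\<sigma> * h) *\<^sub>R (iexp (a * (\<sigma> * h)) * of_real (exp (- t * (\<sigma> * h)\<^sup>2 / 2))) \<partial>lborel)"
    using \<sigma>(1) lborel_integral_real_affine[of \<sigma> "\<lambda>g. std_normal_density g *\<^sub>R (iexp (a * g) * of_real (exp (- t * g\<^sup>2 / 2)))" 0]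
    by (simp only: abs_of_pos add_0_left less_irrefl not_False_eq_True simp_thms)
  also have "\<dots> = \<sigma> *\<^sub>R (\<integral>h. std_normal_density h *\<^sub>R iexp ((a * \<sigma>) * h) \<partial>lborel)"
  proof -
    have "std_normal_density (\<sigma> * h) *\<^sub>R (iexp (a * (\<sigma> * h)) * of_real (exp (- t * (\<sigma> * h)\<^sup>2 / 2)))
      = (std_normal_density (\<sigma> * h) * exp (- t * (\<sigma> * h)\<^sup>2 / 2)) *\<^sub>R iexp (a * (\<sigma> * h))" for h
      by (simp add: scaleR_conv_of_real)
    then show ?thesis by (simp only: dens mult.assoc)
  qed
  also have "\<dots> = \<sigma> *\<^sub>R char std_normal_distribution (a * \<sigma>)"
    unfolding char_def by (subst integral_density) (auto simp: normal_density_nonneg)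
  also have "\<dots> = of_real (exp (- a\<^sup>2 / (2 * (1 + t))) / sqrt (1 + t))"
    using t unfolding char_std_normal_distribution
    by (simp add: power_divide scaleR_conv_of_real \<sigma>_def)
  finally show ?thesis .
qed

abbreviation normal_PiM :: "'i set \<Rightarrow> ('i \<Rightarrow> real) measure" where
  "normal_PiM I \<equiv> PiM I (\<lambda>_. std_normal_distribution)"

interpretation normal_PiM: product_sigma_finite "\<lambda>_. std_normal_distribution"
  by (intro product_sigma_finite.intro prob_space_imp_sigma_finite prob_space_normal_density) simp

lemma prob_space_normal_PiM: "prob_space (normal_PiM I)"
  by (intro prob_space_PiM prob_space_normal_density) simp

text \<open>Discharges the choice in the definition of the law: the vector with first entry
  \<open>sqrt l\<close> and zeros elsewhere has the prescribed sum of squares.\<close>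

lemma noncentral_chi_square_obtains:
  assumes "k \<ge> 1" "l \<ge> 0"
  obtains a where "(\<Sum>i=1..k. (a i)\<^sup>2) = l"
    "noncentral_chi_square k l = distr (normal_PiM {1..k}) borel (\<lambda>Z. \<Sum>i=1..k. (Z i + a i)\<^sup>2)"
proof -
  have "\<exists>a::nat \<Rightarrow> real. (\<Sum>i=1..k. (a i)\<^sup>2) = l"
  proof
    show "(\<Sum>i=1..k. ((\<lambda>i. if i = 1 then sqrt l else 0) i)\<^sup>2) = l"
      using assms by (subst sum.mono_neutral_right[of _ "{1}"]) auto
  qed
  then have "(\<Sum>i=1..k. ((SOME a :: nat \<Rightarrow> real. (\<Sum>i=1..k. (a i)\<^sup>2) = l) i)\<^sup>2) = l"
    by (rule someI_ex)
  then show ?thesis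
    by (rule that) (rule noncentral_chi_square_def[unfolded Let_def])
qed

lemma real_distribution_noncentral_chi_square:
  assumes "k \<ge> 1" "l \<ge> 0"
  shows "real_distribution (noncentral_chi_square k l)"
proof -
  obtain a where "(\<Sum>i=1..k. (a i)\<^sup>2) = l"
    and a: "noncentral_chi_square k l = distr (normal_PiM {1..k}) borel (\<lambda>Z. \<Sum>i=1..k. (Z i + a i)\<^sup>2)"
    by (rule noncentral_chi_square_obtains[OF assms])
  show ?thesis unfolding a
    by (intro prob_space.real_distribution_distr prob_space_normal_PiM) measurable
qed

lemma noncentral_chi_square_nonneg:
  assumes "k \<ge> 1" "l \<ge> 0"
  shows "AE x in noncentral_chi_square k l. x \<ge> 0"
proof -
  obtain a where "(\<Sum>i=1..k. (a i)\<^sup>2) = l"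
    and a: "noncentral_chi_square k l = distr (normal_PiM {1..k}) borel (\<lambda>Z. \<Sum>i=1..k. (Z i + a i)\<^sup>2)"
    by (rule noncentral_chi_square_obtains[OF assms])
  show ?thesis unfolding a
    by (subst AE_distr_iff) (auto intro!: sum_nonneg)
qed

text \<open>The coordinates are independent, so the transform is a product of
  \<open>std_normal_laplace\<close> factors. The shift enters only through \<open>l\<close>, which
  makes the chosen representative immaterial.\<close>

lemma noncentral_chi_square_laplace:
  assumes "k \<ge> 1" "l \<ge> 0" and t: "t \<ge> 0"
  shows "(\<integral>x. exp (- (t / 2) * x) \<partial>noncentral_chi_square k l)
    = exp (- t * l / (2 * (1 + t))) / sqrt (1 + t) ^ k"
proof -
  obtain a where l: "(\<Sum>i=1..k. (a i)\<^sup>2) = l"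
    and a: "noncentral_chi_square k l = distr (normal_PiM {1..k}) borel (\<lambda>Z. \<Sum>i=1..k. (Z i + a i)\<^sup>2)"
    by (rule noncentral_chi_square_obtains[OF assms(1,2)])
  have "(\<integral>x. exp (- (t / 2) * x) \<partial>noncentral_chi_square k l)
     = (\<integral>Z. (\<Prod>i\<in>{1..k}. exp (- (t / 2) * (Z i + a i)\<^sup>2)) \<partial>normal_PiM {1..k})"
    unfolding a by (subst integral_distr) (auto simp: exp_sum[symmetric] sum_distrib_left)
  also have "\<dots> = (\<Prod>i\<in>{1..k}. \<integral>z. exp (- (t / 2) * (z + a i)\<^sup>2) \<partial>std_normal_distribution)"
  proof (rule normal_PiM.product_integral_prod)
    interpret prob_space std_normal_distribution by (simp add: prob_space_normal_density)
    show "integrable std_normal_distribution (\<lambda>z. exp (- (t / 2) * (z + a i)\<^sup>2))" for i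
      using t by (intro integrable_const_bound[of _ 1]) auto
  qed simp
  also have "\<dots> = (\<Prod>i\<in>{1..k}. exp (- t * (a i)\<^sup>2 / (2 * (1 + t))) / sqrt (1 + t))"
    by (simp only: std_normal_laplace[OF t])
  also have "\<dots> = exp (\<Sum>i=1..k. - t * (a i)\<^sup>2 / (2 * (1 + t))) / sqrt (1 + t) ^ k"
    by (simp add: prod_dividef exp_sum)
  also have "(\<Sum>i=1..k. - t * (a i)\<^sup>2 / (2 * (1 + t))) = - t * l / (2 * (1 + t))"
    unfolding l[symmetric] by (simp only: sum_distrib_left sum_divide_distrib)
  finally show ?thesis .
qed

text \<open>With all coordinates but the last fixed, the sum of squares equals \<open>u\<close> for
  at most two values of the last one, a null set. Continuity of the limit is what upgrades weak
  convergence to uniform convergence.\<close>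

lemma noncentral_chi_square_no_atoms:
  assumes "k \<ge> 1" "l \<ge> 0"
  shows "isCont (cdf (noncentral_chi_square k l)) u"
proof -
  interpret R: real_distribution "noncentral_chi_square k l"
    using assms by (rule real_distribution_noncentral_chi_square)
  obtain a where "(\<Sum>i=1..k. (a i)\<^sup>2) = l"
    and a: "noncentral_chi_square k l = distr (normal_PiM {1..k}) borel (\<lambda>Z. \<Sum>i=1..k. (Z i + a i)\<^sup>2)"
    by (rule noncentral_chi_square_obtains[OF assms])
  have k: "{1..k} = insert k {1..<k}" using assms by auto
  have null: "emeasure std_normal_distribution {y. c + (y + b)\<^sup>2 = u} = 0" for b c
  proof -
    have "{y. c + (y + b)\<^sup>2 = u} \<subseteq> {sqrt (u - c) - b, - sqrt (u - c) - b}"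
    proof
      fix y assume "y \<in> {y. c + (y + b)\<^sup>2 = u}"
      then have "\<bar>y + b\<bar> = sqrt (u - c)" by (intro real_sqrt_unique[symmetric]) auto
      then have "y = sqrt (u - c) - b \<or> y = - sqrt (u - c) - b" by linarith
      then show "y \<in> {sqrt (u - c) - b, - sqrt (u - c) - b}" by simp
    qed
    then have "finite {y. c + (y + b)\<^sup>2 = u}" by (rule finite_subset) simp
    then have "{y. c + (y + b)\<^sup>2 = u} \<in> null_sets lborel"
      using finite_imp_null_set_lborel by blast
    then show ?thesis
      by (subst emeasure_density) (auto simp: null_sets_def intro!: nn_integral_null_set)
  qed
  have meas: "(\<lambda>Z. indicator {u} (\<Sum>i=1..k. (Z i + a i)\<^sup>2) :: ennreal) \<in> borel_measurable (normal_PiM {1..k})"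
    by measurable
  have "emeasure (noncentral_chi_square k l) {u} = (\<integral>\<^sup>+x. indicator {u} x \<partial>noncentral_chi_square k l)"
    by simp
  also have "\<dots> = (\<integral>\<^sup>+Z. indicator {u} (\<Sum>i=1..k. (Z i + a i)\<^sup>2) \<partial>normal_PiM {1..k})"
    unfolding a by (subst nn_integral_distr) auto
  also have "\<dots> = (\<integral>\<^sup>+Z. (\<integral>\<^sup>+y. indicator {u} (\<Sum>i=1..k. ((Z(k := y)) i + a i)\<^sup>2) \<partial>std_normal_distribution) \<partial>normal_PiM {1..<k})"
    using meas unfolding k by (intro normal_PiM.product_nn_integral_insert) auto
  also have "\<dots> = (\<integral>\<^sup>+Z. 0 \<partial>normal_PiM {1..<k})"
  proof (rule nn_integral_cong)
    fix Z :: "nat \<Rightarrow> real"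
    have "(\<Sum>i=1..k. ((Z(k := y)) i + a i)\<^sup>2) = (\<Sum>i=1..<k. (Z i + a i)\<^sup>2) + (y + a k)\<^sup>2" for y
      unfolding k by (subst sum.insert) auto
    then have "(\<integral>\<^sup>+y. indicator {u} (\<Sum>i=1..k. ((Z(k := y)) i + a i)\<^sup>2) \<partial>std_normal_distribution)
      = (\<integral>\<^sup>+y. indicator {y. (\<Sum>i=1..<k. (Z i + a i)\<^sup>2) + (y + a k)\<^sup>2 = u} y \<partial>std_normal_distribution)"
      by (intro nn_integral_cong) (auto simp: indicator_def)
    also have "\<dots> = 0"
      using null by (subst nn_integral_indicator) auto
    finally show "(\<integral>\<^sup>+y. indicator {u} (\<Sum>i=1..k. ((Z(k := y)) i + a i)\<^sup>2) \<partial>std_normal_distribution) = 0" .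
  qed
  finally have "emeasure (noncentral_chi_square k l) {u} = 0" by simp
  then show ?thesis
    by (simp add: R.isCont_cdf measure_def)
qed

text \<open>The substitution \<open>w = exp (- u / 2)\<close> carries a continuous step function,
  which vanishes for large \<open>u\<close>, to a continuous function on \<open>[0, 1]\<close>.
  Polynomials in \<open>w\<close> integrate to combinations of Laplace transforms at the points
  \<open>i / 2\<close>, and they approximate that function uniformly.\<close>

lemma laplace_conv_imp_weak_conv:
  fixes \<mu> :: "nat \<Rightarrow> real measure"
  assumes \<mu>n: "\<And>n. real_distribution (\<mu> n)" and L: "real_distribution L"
    and nn: "\<And>n. AE x in \<mu> n. x \<ge> 0" "AE x in L. x \<ge> 0"
    and lim: "\<And>j::nat. (\<lambda>n. \<integral>x. exp (- (real j / 2) * x) \<partial>\<mu> n) \<longlonglongrightarrow> (\<integral>x. exp (- (real j / 2) * x) \<partial>L)"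
  shows "weak_conv_m \<mu> L"
proof (rule integral_cts_step_conv_imp_weak_conv[OF \<mu>n L])
  fix x y :: real assume xy: "x < y"
  \<comment> \<open>The points \<open>w \<le> 0\<close> stand for \<open>u\<close> at infinity,
    where the step has already dropped to zero.\<close>
  define f where "f w = (if w \<le> 0 then 0 else cts_step x y (- 2 * ln w))" for w :: real
  have cts: "isCont (cts_step x y) w" for w
    using cts_step_uniformly_continuous[OF xy] by (rule isUCont_isCont)
  have fc: "isCont f w" for w
  proof (cases "w < exp (- y / 2)")
    case True
    have "f w' = 0" if "w' < exp (- y / 2)" for w'
    proof (cases "w' \<le> 0")
      case False
      then have "ln w' < - y / 2" using that by (metis exp_less_cancel_iff exp_ln not_le)
      then show ?thesis using xy by (auto simp: f_def cts_step_def)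
    qed (simp add: f_def)
    then have "eventually (\<lambda>w'. f w' = 0) (nhds w)"
      using eventually_nhds_in_open[of "{..<exp (- y / 2)}" w] True by (auto elim: eventually_mono)
    then show ?thesis by (subst isCont_cong) auto
  next
    case False
    then have w: "w > 0" by (meson exp_gt_zero less_le_trans not_le)
    then have "eventually (\<lambda>w'. f w' = cts_step x y (- 2 * ln w')) (nhds w)"
      using eventually_nhds_in_open[of "{0<..}" w] by (auto elim!: eventually_mono simp: f_def)
    moreover have "isCont (\<lambda>w'. cts_step x y (- 2 * ln w')) w"
      using w by (intro isCont_o2[OF _ cts] continuous_intros) auto
    ultimately show ?thesis by (subst isCont_cong) auto
  qed
  have f1: "\<bar>f w\<bar> \<le> 1" for w
    using xy by (auto simp: f_def cts_step_def)
  have [measurable]: "f \<in> borel_measurable borel"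
    using fc by (intro borel_measurable_continuous_onI) (auto simp: continuous_on_eq_continuous_at)
  have fexp: "f (exp (- u / 2)) = cts_step x y u" for u by (simp add: f_def)
  show "(\<lambda>n. integral\<^sup>L (\<mu> n) (cts_step x y)) \<longlonglongrightarrow> integral\<^sup>L L (cts_step x y)"
  proof (rule LIMSEQ_I)
    fix e :: real assume e: "e > 0"
    have cf: "continuous_on {0..1} f"
      using fc by (auto intro: continuous_at_imp_continuous_on)
    obtain g where g: "real_polynomial_function g" "\<And>w. w \<in> {0..1} \<Longrightarrow> \<bar>f w - g w\<bar> < e / 4"
      using Stone_Weierstrass_real_polynomial_function[OF compact_Icc cf, of "e / 4"] e by auto
    then obtain a N where gN: "g = (\<lambda>x. \<Sum>i\<le>N. a i * x ^ i)"
      by (auto simp: real_polynomial_function_iff_sum)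
    have pw: "exp (- u / 2) ^ i = exp (- (real i / 2) * u)" for i :: nat and u :: real
      by (simp add: exp_of_nat_mult[symmetric] field_simps)
    have key: "(\<integral>u. g (exp (- u / 2)) \<partial>D) = (\<Sum>i\<le>N. a i * (\<integral>u. exp (- (real i / 2) * u) \<partial>D))
       \<and> \<bar>integral\<^sup>L D (cts_step x y) - (\<integral>u. g (exp (- u / 2)) \<partial>D)\<bar> \<le> e / 4"
      if D: "real_distribution D" and nnD: "AE x in D. x \<ge> 0" for D
    proof -
      interpret D: real_distribution D by fact
      have int: "integrable D (\<lambda>u. exp (- (real i / 2) * u))" for i
        using nnD by (intro D.integrable_const_bound[of _ 1]) (auto simp: mult_nonneg_nonneg)
      have eq: "(\<integral>u. g (exp (- u / 2)) \<partial>D) = (\<Sum>i\<le>N. a i * (\<integral>u. exp (- (real i / 2) * u) \<partial>D))"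
        unfolding gN pw using int by (subst Bochner_Integration.integral_sum) auto
      have ig: "integrable D (\<lambda>u. g (exp (- u / 2)))"
        unfolding gN pw using int by auto
      have ic: "integrable D (cts_step x y)" using xy by (rule D.integrable_cts_step)
      have "\<bar>integral\<^sup>L D (cts_step x y) - (\<integral>u. g (exp (- u / 2)) \<partial>D)\<bar>
         = \<bar>\<integral>u. cts_step x y u - g (exp (- u / 2)) \<partial>D\<bar>"
        using ic ig by simp
      also have "\<dots> \<le> (\<integral>u. \<bar>cts_step x y u - g (exp (- u / 2))\<bar> \<partial>D)"
        by (rule integral_abs_bound)
      also have "\<dots> \<le> (\<integral>u. e / 4 \<partial>D)"
      proof (rule integral_mono_AE)
        show "AE u in D. \<bar>cts_step x y u - g (exp (- u / 2))\<bar> \<le> e / 4"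
          using nnD by eventually_elim (use g(2) in \<open>auto simp: fexp[symmetric] intro!: less_imp_le\<close>)
      qed (use ic ig in auto)
      also have "\<dots> = e / 4" using D.prob_space by simp
      finally show ?thesis using eq by simp
    qed
    have "(\<lambda>n. (\<Sum>i\<le>N. a i * (\<integral>u. exp (- (real i / 2) * u) \<partial>\<mu> n))) \<longlonglongrightarrow> (\<Sum>i\<le>N. a i * (\<integral>u. exp (- (real i / 2) * u) \<partial>L))"
      by (intro tendsto_intros lim)
    then have "(\<lambda>n. (\<integral>u. g (exp (- u / 2)) \<partial>\<mu> n)) \<longlonglongrightarrow> (\<integral>u. g (exp (- u / 2)) \<partial>L)"
      using key[OF \<mu>n nn(1)] key[OF L nn(2)] by simp
    from LIMSEQ_D[OF this, of "e / 4"] e obtain n0 where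
      n0: "\<And>n. n \<ge> n0 \<Longrightarrow> \<bar>(\<integral>u. g (exp (- u / 2)) \<partial>\<mu> n) - (\<integral>u. g (exp (- u / 2)) \<partial>L)\<bar> < e / 4"
      by auto
    show "\<exists>n0. \<forall>n\<ge>n0. norm (integral\<^sup>L (\<mu> n) (cts_step x y) - integral\<^sup>L L (cts_step x y)) < e"
    proof (intro exI[of _ n0] allI impI)
      fix n assume "n \<ge> n0"
      then show "norm (integral\<^sup>L (\<mu> n) (cts_step x y) - integral\<^sup>L L (cts_step x y)) < e"
        using n0[of n] key[OF \<mu>n nn(1), of n] key[OF L nn(2)] e unfolding real_norm_def by linarith
    qed
  qed
qed

text \<open>Polya's argument: a continuous limit distribution function has quantiles at the levels
  \<open>i / N\<close>; closeness at these finitely many points spreads to all \<open>u\<close> by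
  monotonicity.\<close>

lemma weak_conv_uniform:
  fixes \<mu> :: "nat \<Rightarrow> real measure"
  assumes \<mu>n: "\<And>n. real_distribution (\<mu> n)" and L: "real_distribution L"
    and cont: "\<And>u. isCont (cdf L) u" and wc: "weak_conv_m \<mu> L" and e: "e > 0"
  shows "eventually (\<lambda>n. \<forall>u. \<bar>cdf (\<mu> n) u - cdf L u\<bar> < e) sequentially"
proof -
  interpret L: real_distribution L by fact
  interpret \<mu>: real_distribution "\<mu> n" for n by (rule \<mu>n)
  have ptw: "(\<lambda>n. cdf (\<mu> n) u) \<longlonglongrightarrow> cdf L u" for u
    using wc cont by (auto simp: weak_conv_m_def weak_conv_def)
  \<comment> \<open>The total loss is at most \<open>3 / N\<close>: up to two levels of the quantile
    grid and \<open>1 / N\<close> at the quantile itself. The constant 4 keeps the final inequality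
    strict.\<close>
  obtain N :: nat where N: "N > 0" "4 / real N < e"
  proof -
    obtain N where "real N > 4 / e" using reals_Archimedean2 by blast
    moreover then have "N > 0" using e by (cases N) (auto simp: field_simps)
    ultimately show ?thesis using that[of N] e by (auto simp: field_simps)
  qed
  have "\<exists>y. cdf L y = real i / real N" if i: "i \<in> {1..<N}" for i
  proof -
    define c where "c = real i / real N"
    have c: "0 < c" "c < 1" using i by (auto simp: c_def)
    have "eventually (\<lambda>u. cdf L u < c) at_bot"
      using L.cdf_lim_at_bot c by (auto intro: order_tendstoD)
    then obtain a where a: "cdf L a < c" by (auto simp: eventually_at_bot_linorder)
    have "eventually (\<lambda>u. cdf L u > c) at_top"
      using L.cdf_lim_at_top_prob c by (auto intro: order_tendstoD)
    then obtain b where b: "cdf L b > c" by (auto simp: eventually_at_top_linorder)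
    have "a \<le> b" using a b L.cdf_nondecreasing[of b a] by linarith
    then show ?thesis using IVT[of "cdf L" a c b] a b cont unfolding c_def by auto
  qed
  then obtain y where y: "\<And>i. i \<in> {1..<N} \<Longrightarrow> cdf L (y i) = real i / real N" by metis
  have "eventually (\<lambda>n. \<forall>i\<in>{1..<N}. \<bar>cdf (\<mu> n) (y i) - cdf L (y i)\<bar> < 1 / real N) sequentially"
  proof (intro eventually_ball_finite ballI)
    fix i
    show "eventually (\<lambda>n. \<bar>cdf (\<mu> n) (y i) - cdf L (y i)\<bar> < 1 / real N) sequentially"
      using tendstoD[OF ptw, of "1 / real N" "y i"] N by (auto simp: dist_real_def)
  qed simp
  then show ?thesis
  proof eventually_elim
    case (elim n)
    show ?case
    proof
      fix u
      define i where "i = nat (\<lceil>real N * cdf L u\<rceil> - 1)"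
      have c0: "0 \<le> cdf L u" "cdf L u \<le> 1" by (auto intro: L.cdf_nonneg L.cdf_bounded_prob)
      have c0': "0 \<le> cdf (\<mu> n) u" "cdf (\<mu> n) u \<le> 1" by (auto intro: \<mu>.cdf_nonneg \<mu>.cdf_bounded_prob)
      have "0 \<le> real N * cdf L u" using c0 by simp
      then have i1: "real N * cdf L u \<le> real i + 1" unfolding i_def by linarith
      have i2: "i > 0 \<Longrightarrow> real i < real N * cdf L u" unfolding i_def by linarith
      have u1: "cdf L u \<le> (real i + 1) / real N" using i1 N by (simp add: field_simps)
      have low: "cdf (\<mu> n) u \<ge> cdf L u - 2 / real N"
      proof (cases "i = 0")
        case True
        then have "cdf L u \<le> 1 / real N" using u1 by simp
        moreover have "1 / real N \<le> 2 / real N" by (simp add: divide_right_mono)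
        ultimately show ?thesis using c0' by linarith
      next
        case False
        have u2: "real i / real N < cdf L u" using i2 False N by (simp add: field_simps)
        then have "i < N" using c0 N by (metis less_le_trans divide_less_eq_1_pos of_nat_0_less_iff of_nat_less_iff)
        then have iN: "i \<in> {1..<N}" using False by auto
        have "y i \<le> u" using u2 y[OF iN] L.cdf_nondecreasing[of u "y i"] by linarith
        then have "cdf (\<mu> n) (y i) \<le> cdf (\<mu> n) u" by (rule \<mu>.cdf_nondecreasing)
        then show ?thesis using elim iN y[OF iN] u1 by (force simp: add_divide_distrib)
      qed
      have up: "cdf (\<mu> n) u \<le> cdf L u + 3 / real N"
      proof (cases "i + 2 < N")
        case True
        then have iN: "i + 2 \<in> {1..<N}" by auto
        \<comment> \<open>Level \<open>i + 2\<close> and not \<open>i + 1\<close>: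
          \<open>cdf L u\<close> may equal \<open>(i + 1) / N\<close>, and only a strict inequality
          yields \<open>u \<le> y (i + 2)\<close>.\<close>
        have "cdf L u < cdf L (y (i + 2))"
          using y[OF iN] u1 N by (simp add: add_divide_distrib divide_strict_right_mono le_less_trans)
        then have "u \<le> y (i + 2)" using L.cdf_nondecreasing[of "y (i+2)" u] by linarith
        then have A: "cdf (\<mu> n) u \<le> cdf (\<mu> n) (y (i + 2))" by (rule \<mu>.cdf_nondecreasing)
        have B: "cdf (\<mu> n) (y (i + 2)) < real i / real N + 3 / real N"
          using elim iN y[OF iN] by (force simp: add_divide_distrib)
        have "real i / real N \<le> cdf L u"
          using i2 N c0 by (cases "i = 0") (auto simp: field_simps)
        then show ?thesis using A B by linarith
      next
        case False
        have "(real N - 2) / real N \<le> cdf L u"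
        proof (cases "i = 0")
          case True
          then have "(real N - 2) / real N \<le> 0" using False N by (simp add: divide_le_0_iff)
          then show ?thesis using c0 by linarith
        next
          case F: False
          then have "real N - 2 \<le> real N * cdf L u" using i2 False by linarith
          then show ?thesis using N by (simp add: field_simps)
        qed
        moreover have "(real N - 2) / real N = 1 - 2 / real N" using N by (simp add: field_simps)
        moreover have "2 / real N \<le> 3 / real N" using N by (simp add: divide_right_mono)
        ultimately show ?thesis using c0' by linarith
      qed
      have "2 / real N \<le> 3 / real N" "3 / real N < 4 / real N" using N by (simp_all add: divide_right_mono divide_strict_right_mono)
      then show "\<bar>cdf (\<mu> n) u - cdf L u\<bar> < e" using low up N by linarith
    qed
  qed
qed

section \<open>Pearson statistics of perturbed multinomial counts\<close>

text \<open>Complex form of the limit of \<open>(1 + c / N) ^ N\<close>. With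
  \<open>u = z - 1\<close>, both \<open>z\<close> and \<open>exp u\<close> lie in the closed unit
  disc, so their \<open>N\<close>-th powers differ by at most \<open>N\<close> times their distance;
  that distance is quadratic in \<open>u\<close>, which leaves an error of order
  \<open>1 / N\<close>.\<close>

lemma tendsto_power_exp:
  fixes z :: "nat \<Rightarrow> complex" and N :: "nat \<Rightarrow> nat"
  assumes N: "filterlim N at_top sequentially" and z: "\<And>k. norm (z k) \<le> 1"
    and lim: "(\<lambda>k. of_nat (N k) * (z k - 1)) \<longlonglongrightarrow> c"
  shows "(\<lambda>k. z k ^ N k) \<longlonglongrightarrow> exp c"
proof -
  define u where "u k = z k - 1" for k
  have real_N: "filterlim (\<lambda>k. real (N k)) at_top sequentially"
    using N by (rule filterlim_compose[OF filterlim_real_sequentially])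
  have "(\<lambda>k. exp (of_nat (N k) * u k)) \<longlonglongrightarrow> exp c"
    unfolding u_def by (intro tendsto_intros lim)
  moreover have "(\<lambda>k. z k ^ N k - exp (of_nat (N k) * u k)) \<longlonglongrightarrow> 0"
  proof (rule Lim_null_comparison)
    show "\<forall>\<^sub>F k in sequentially. norm (z k ^ N k - exp (of_nat (N k) * u k))
       \<le> exp (norm (u k)) * (norm (of_nat (N k) * u k))\<^sup>2 / real (N k)"
    proof (rule eventually_mono)
      show "\<forall>\<^sub>F k in sequentially. N k > 0"
        using N[unfolded filterlim_iff] eventually_gt_at_top by blast
      fix k assume Nk: "N k > 0"
      have "Re (u k) \<le> 0"
        using z[of k] complex_Re_le_cmod[of "z k"] by (simp add: u_def)
      then have e1: "norm (exp (u k)) \<le> 1" by simp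
      have "norm (z k ^ N k - exp (of_nat (N k) * u k)) = norm (z k ^ N k - exp (u k) ^ N k)"
        by (simp add: exp_of_nat_mult)
      also have "\<dots> \<le> real (N k) * norm (z k - exp (u k))"
        using z e1 by (rule norm_power_diff)
      also have "norm (z k - exp (u k)) = norm (exp (u k) - (\<Sum>i\<le>1. u k ^ i / fact i))"
        by (simp add: u_def norm_minus_commute)
      also have "\<dots> \<le> exp \<bar>Re (u k)\<bar> * norm (u k) ^ Suc 1 / fact 1"
        by (rule Taylor_exp)
      also have "\<dots> \<le> exp (norm (u k)) * (norm (u k))\<^sup>2"
        using abs_Re_le_cmod[of "u k"] by (simp add: power2_eq_square mult_right_mono)
      finally show "norm (z k ^ N k - exp (of_nat (N k) * u k))
        \<le> exp (norm (u k)) * (norm (of_nat (N k) * u k))\<^sup>2 / real (N k)"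
        using Nk by (simp add: norm_mult power2_eq_square mult_ac)
    qed
    have "(\<lambda>k. (of_nat (N k) * u k) * of_real (1 / real (N k))) \<longlonglongrightarrow> c * of_real 0"
      unfolding u_def by (intro tendsto_intros lim real_tendsto_divide_at_top[OF tendsto_const real_N])
    moreover have "\<forall>\<^sub>F k in sequentially. (of_nat (N k) * u k) * of_real (1 / real (N k)) = u k"
    proof (rule eventually_mono)
      show "\<forall>\<^sub>F k in sequentially. N k > 0"
        using N[unfolded filterlim_iff] eventually_gt_at_top by blast
    qed (simp add: field_simps)
    ultimately have u0: "u \<longlonglongrightarrow> 0"
      by (simp add: filterlim_cong[OF refl refl])
    have "(\<lambda>k. exp (norm (u k)) * (norm (of_nat (N k) * u k))\<^sup>2) \<longlonglongrightarrow> exp (norm (0::complex)) * (norm c)\<^sup>2"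
      by (intro tendsto_intros u0) (unfold u_def, rule lim)
    then show "(\<lambda>k. exp (norm (u k)) * (norm (of_nat (N k) * u k))\<^sup>2 / real (N k)) \<longlonglongrightarrow> 0"
      by (rule real_tendsto_divide_at_top[OF _ real_N])
  qed
  ultimately have "(\<lambda>k. exp (of_nat (N k) * u k) + (z k ^ N k - exp (of_nat (N k) * u k))) \<longlonglongrightarrow> exp c + 0"
    by (rule tendsto_add)
  then show ?thesis by simp
qed

section \<open>Quadratic forms as Gaussian averages of characters\<close>

lemma iexp_cis: "iexp x = cis x"
  by (simp add: cis_conv_exp)

lemma norm_iexp [simp]: "norm (iexp x) = 1"
  by (simp add: iexp_cis)

lemma integrable_iexp_mult:
  fixes f g :: "'a \<Rightarrow> real"
  assumes "prob_space M" "f \<in> borel_measurable M" "g \<in> borel_measurable M" "\<And>x. \<bar>g x\<bar> \<le> 1"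
  shows "integrable M (\<lambda>x. iexp (f x) * complex_of_real (g x))"
proof -
  interpret prob_space M by fact
  show ?thesis
    using assms(2-4) by (intro integrable_const_bound[of _ 1]) (auto simp: norm_mult)
qed

text \<open>The extra Gaussian along the unit vector \<open>w\<close> fills up the direction missing in \<open>y\<close>, so that
  the covariance becomes the identity and no orthonormal basis of the hyperplane is needed.\<close>

lemma gaussian_linearization:
  fixes w y :: "'i \<Rightarrow> real"
  assumes fin: "finite I" and w: "(\<Sum>i\<in>I. (w i)\<^sup>2) = 1" and orth: "(\<Sum>i\<in>I. w i * y i) = 0"
    and t: "t \<ge> 0"
  shows "(CLINT g|normal_PiM I. iexp (sqrt t * (\<Sum>i\<in>I. g i * y i)) * of_real (exp (- (t / 2) * (\<Sum>i\<in>I. w i * g i)\<^sup>2)))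
     = of_real (exp (- (t / 2) * (\<Sum>i\<in>I. (y i)\<^sup>2)) / sqrt (1 + t))"
proof -
  let ?N = std_normal_distribution
  interpret N: prob_space ?N by (simp add: prob_space_normal_density)
  interpret G: prob_space "normal_PiM I" by (rule prob_space_normal_PiM)
  interpret P: pair_prob_space "normal_PiM I" ?N ..
  have inner: "of_real (exp (- (t / 2) * s\<^sup>2)) = (CLINT z|?N. iexp (sqrt t * s * z))" for s
    using fun_cong[OF char_std_normal_distribution, of "sqrt t * s"] t
    by (simp add: char_def power_mult_distrib)
  have "(CLINT g|normal_PiM I. iexp (sqrt t * (\<Sum>i\<in>I. g i * y i)) * of_real (exp (- (t / 2) * (\<Sum>i\<in>I. w i * g i)\<^sup>2)))
    = (CLINT g|normal_PiM I. (CLINT z|?N. iexp (sqrt t * (\<Sum>i\<in>I. g i * (y i + z * w i)))))"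
  proof (rule Bochner_Integration.integral_cong[OF refl])
    fix g
    have "iexp (sqrt t * (\<Sum>i\<in>I. g i * y i)) * of_real (exp (- (t / 2) * (\<Sum>i\<in>I. w i * g i)\<^sup>2))
      = (CLINT z|?N. iexp (sqrt t * (\<Sum>i\<in>I. g i * y i)) * iexp (sqrt t * (\<Sum>i\<in>I. w i * g i) * z))"
      by (subst inner) (rule Bochner_Integration.integral_mult_right_zero[symmetric])
    also have "\<dots> = (CLINT z|?N. iexp (sqrt t * (\<Sum>i\<in>I. g i * (y i + z * w i))))"
      unfolding iexp_cis cis_mult
      by (simp add: algebra_simps sum.distrib sum_distrib_left)
    finally show "iexp (sqrt t * (\<Sum>i\<in>I. g i * y i)) * of_real (exp (- (t / 2) * (\<Sum>i\<in>I. w i * g i)\<^sup>2)) = \<dots>" .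
  qed
  also have "\<dots> = (CLINT z|?N. (CLINT g|normal_PiM I. iexp (sqrt t * (\<Sum>i\<in>I. g i * (y i + z * w i)))))"
  proof (rule P.Fubini_integral[symmetric])
    show "integrable (normal_PiM I \<Otimes>\<^sub>M ?N) (\<lambda>(g, z). iexp (sqrt t * (\<Sum>i\<in>I. g i * (y i + z * w i))))"
      by (intro P.P.integrable_const_bound[of _ 1]) (auto simp: split_beta)
  qed
  also have "\<dots> = (CLINT z|?N. of_real (exp (- (t / 2) * (\<Sum>i\<in>I. (y i)\<^sup>2)) * exp (- (t / 2) * (z + 0)\<^sup>2)))"
  proof (rule Bochner_Integration.integral_cong[OF refl])
    fix z
    have "(CLINT g|normal_PiM I. iexp (sqrt t * (\<Sum>i\<in>I. g i * (y i + z * w i))))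
      = (CLINT g|normal_PiM I. (\<Prod>i\<in>I. iexp (sqrt t * (y i + z * w i) * g i)))"
      using fin by (simp add: exp_sum[symmetric] sum_distrib_left mult_ac)
    also have "\<dots> = (\<Prod>i\<in>I. CLINT g|?N. iexp (sqrt t * (y i + z * w i) * g))"
      by (intro normal_PiM.product_integral_prod fin N.integrable_const_bound[of _ 1]) auto
    also have "\<dots> = (\<Prod>i\<in>I. of_real (exp (- (t / 2) * (y i + z * w i)\<^sup>2)))"
      by (simp only: inner)
    also have "\<dots> = of_real (exp (- (t / 2) * (\<Sum>i\<in>I. (y i + z * w i)\<^sup>2)))"
      using fin by (simp add: exp_sum[symmetric] sum_distrib_left flip: of_real_prod)
    also have "(\<Sum>i\<in>I. (y i + z * w i)\<^sup>2) = (\<Sum>i\<in>I. (y i)\<^sup>2) + z\<^sup>2 * (\<Sum>i\<in>I. (w i)\<^sup>2) + 2 * z * (\<Sum>i\<in>I. w i * y i)"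
      by (simp add: power2_eq_square algebra_simps sum.distrib sum_distrib_left)
    also have "\<dots> = (\<Sum>i\<in>I. (y i)\<^sup>2) + z\<^sup>2"
      by (simp add: w orth)
    also have "exp (- (t / 2) * ((\<Sum>i\<in>I. (y i)\<^sup>2) + z\<^sup>2)) = exp (- (t / 2) * (\<Sum>i\<in>I. (y i)\<^sup>2)) * exp (- (t / 2) * (z + 0)\<^sup>2)"
      by (simp add: exp_add[symmetric] algebra_simps)
    finally show "(CLINT g|normal_PiM I. iexp (sqrt t * (\<Sum>i\<in>I. g i * (y i + z * w i)))) = of_real \<dots>" .
  qed
  also have "\<dots> = of_real (exp (- (t / 2) * (\<Sum>i\<in>I. (y i)\<^sup>2)) * (\<integral>z. exp (- (t / 2) * (z + 0)\<^sup>2) \<partial>?N))"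
    by (simp only: integral_complex_of_real Bochner_Integration.integral_mult_right_zero)
  also have "(\<integral>z. exp (- (t / 2) * (z + 0)\<^sup>2) \<partial>?N) = 1 / sqrt (1 + t)"
    by (subst std_normal_laplace[OF t]) simp
  finally show ?thesis by simp
qed

text \<open>\<open>gaussian_linearization\<close> for each outcome, followed by an exchange of the
  Gaussian average with the expectation: only characteristic functions of \<open>Y\<close> remain
  under the Gaussian integral.\<close>

lemma laplace_eq_char_integral:
  fixes w :: "'i \<Rightarrow> real" and Y :: "'i \<Rightarrow> 'a \<Rightarrow> real"
  assumes M: "prob_space M" and fin: "finite I" and w: "(\<Sum>i\<in>I. (w i)\<^sup>2) = 1"
    and meas: "\<And>i. i \<in> I \<Longrightarrow> Y i \<in> borel_measurable M"
    and orth: "\<And>\<omega>. \<omega> \<in> space M \<Longrightarrow> (\<Sum>i\<in>I. w i * Y i \<omega>) = 0" and t: "t \<ge> 0"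
  shows "of_real ((\<integral>\<omega>. exp (- (t / 2) * (\<Sum>i\<in>I. (Y i \<omega>)\<^sup>2)) \<partial>M) / sqrt (1 + t))
     = (CLINT g|normal_PiM I. (CLINT \<omega>|M. iexp (\<Sum>i\<in>I. sqrt t * g i * Y i \<omega>)) * of_real (exp (- (t / 2) * (\<Sum>i\<in>I. w i * g i)\<^sup>2)))"
proof -
  interpret M: prob_space M by fact
  interpret G: prob_space "normal_PiM I" by (rule prob_space_normal_PiM)
  interpret P: pair_prob_space "normal_PiM I" M ..
  note [measurable] = meas
  have "of_real ((\<integral>\<omega>. exp (- (t / 2) * (\<Sum>i\<in>I. (Y i \<omega>)\<^sup>2)) \<partial>M) / sqrt (1 + t))
    = (CLINT \<omega>|M. of_real (exp (- (t / 2) * (\<Sum>i\<in>I. (Y i \<omega>)\<^sup>2)) / sqrt (1 + t)))"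
    by (simp only: integral_complex_of_real Bochner_Integration.integral_divide_zero)
  also have "\<dots> = (CLINT \<omega>|M. (CLINT g|normal_PiM I. iexp (sqrt t * (\<Sum>i\<in>I. g i * Y i \<omega>)) * of_real (exp (- (t / 2) * (\<Sum>i\<in>I. w i * g i)\<^sup>2))))"
    using gaussian_linearization[OF fin w orth t] by (intro Bochner_Integration.integral_cong[OF refl]) simp
  also have "\<dots> = (CLINT g|normal_PiM I. (CLINT \<omega>|M. iexp (sqrt t * (\<Sum>i\<in>I. g i * Y i \<omega>)) * of_real (exp (- (t / 2) * (\<Sum>i\<in>I. w i * g i)\<^sup>2))))"
  proof (rule P.Fubini_integral)
    show "integrable (normal_PiM I \<Otimes>\<^sub>M M) (\<lambda>(g, \<omega>). iexp (sqrt t * (\<Sum>i\<in>I. g i * Y i \<omega>)) * complex_of_real (exp (- (t / 2) * (\<Sum>i\<in>I. w i * g i)\<^sup>2)))"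
      unfolding split_beta using t
      by (intro integrable_iexp_mult P.P.prob_space_axioms) auto
  qed
  finally show ?thesis
    by (simp only: Bochner_Integration.integral_mult_left_zero sum_distrib_left mult.assoc)
qed

text \<open>The limit covariance is the identity minus the projection onto \<open>w\<close>. The
  weight in \<open>laplace_eq_char_integral\<close> supplies exactly the missing projection term, so
  the limit integrand factorizes over the coordinates, and each factor is
  \<open>std_normal_char_laplace\<close>. One of the \<open>card I\<close> factors
  \<open>sqrt (1 + t)\<close> cancels against the normalization, which leaves
  \<open>card I - 1\<close> degrees of freedom.\<close>

lemma laplace_tendsto:
  fixes w a :: "'i \<Rightarrow> real" and M :: "nat \<Rightarrow> 'a measure" and Y :: "nat \<Rightarrow> 'i \<Rightarrow> 'a \<Rightarrow> real"
  assumes M: "\<And>k. prob_space (M k)" and fin: "finite I" and w: "(\<Sum>i\<in>I. (w i)\<^sup>2) = 1"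
    and meas: "\<And>k i. i \<in> I \<Longrightarrow> Y k i \<in> borel_measurable (M k)"
    and orth: "\<And>k \<omega>. \<omega> \<in> space (M k) \<Longrightarrow> (\<Sum>i\<in>I. w i * Y k i \<omega>) = 0" and t: "t \<ge> 0"
    and char: "\<And>\<theta>. (\<lambda>k. CLINT \<omega>|M k. iexp (\<Sum>i\<in>I. \<theta> i * Y k i \<omega>))
        \<longlonglongrightarrow> iexp (\<Sum>i\<in>I. \<theta> i * a i) * of_real (exp (- ((\<Sum>i\<in>I. (\<theta> i)\<^sup>2) - (\<Sum>i\<in>I. w i * \<theta> i)\<^sup>2) / 2))"
  shows "(\<lambda>k. \<integral>\<omega>. exp (- (t / 2) * (\<Sum>i\<in>I. (Y k i \<omega>)\<^sup>2)) \<partial>M k)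
     \<longlonglongrightarrow> exp (- t * (\<Sum>i\<in>I. (a i)\<^sup>2) / (2 * (1 + t))) / sqrt (1 + t) ^ (card I - 1)"
proof -
  interpret G: prob_space "normal_PiM I" by (rule prob_space_normal_PiM)
  interpret N: prob_space std_normal_distribution by (simp add: prob_space_normal_density)
  define \<phi> where "\<phi> k g = (CLINT \<omega>|M k. iexp (\<Sum>i\<in>I. sqrt t * g i * Y k i \<omega>))" for k g
  define E where "E g = exp (- (t / 2) * (\<Sum>i\<in>I. w i * g i)\<^sup>2)" for g
  have ne: "I \<noteq> {}" using w by auto
  have \<phi>_meas: "\<phi> k \<in> borel_measurable (normal_PiM I)" for k
  proof -
    interpret Mk: prob_space "M k" by (rule M)
    note [measurable] = meas
    show ?thesis unfolding \<phi>_def by measurable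
  qed
  have E_meas[measurable]: "E \<in> borel_measurable (normal_PiM I)" unfolding E_def by measurable
  have E1: "0 \<le> E g" "E g \<le> 1" for g using t by (auto simp: E_def)
  have \<phi>1: "norm (\<phi> k g) \<le> 1" for k g
  proof -
    interpret Mk: prob_space "M k" by (rule M)
    have "norm (\<phi> k g) \<le> (\<integral>\<omega>. norm (iexp (\<Sum>i\<in>I. sqrt t * g i * Y k i \<omega>)) \<partial>M k)"
      unfolding \<phi>_def by (rule integral_norm_bound)
    then show ?thesis by (simp add: Mk.prob_space)
  qed
  have "(\<lambda>k. CLINT g|normal_PiM I. \<phi> k g * of_real (E g)) \<longlonglongrightarrow>
     (CLINT g|normal_PiM I. (\<Prod>i\<in>I. iexp (sqrt t * a i * g i) * of_real (exp (- t * (g i)\<^sup>2 / 2))))"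
  proof (rule integral_dominated_convergence[where w="\<lambda>_. 1"])
    show "(\<lambda>g. \<Prod>i\<in>I. iexp (sqrt t * a i * g i) * complex_of_real (exp (- t * (g i)\<^sup>2 / 2))) \<in> borel_measurable (normal_PiM I)"
      by measurable
    show "(\<lambda>g. \<phi> k g * complex_of_real (E g)) \<in> borel_measurable (normal_PiM I)" for k
      using \<phi>_meas by measurable
    show "AE g in normal_PiM I. norm (\<phi> k g * complex_of_real (E g)) \<le> 1" for k
      using \<phi>1 E1 by (intro AE_I2) (simp add: norm_mult mult_le_one)
    show "AE g in normal_PiM I. (\<lambda>k. \<phi> k g * complex_of_real (E g))
       \<longlonglongrightarrow> (\<Prod>i\<in>I. iexp (sqrt t * a i * g i) * complex_of_real (exp (- t * (g i)\<^sup>2 / 2)))"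
    proof (rule AE_I2)
      fix g
      have "(\<lambda>k. \<phi> k g * complex_of_real (E g)) \<longlonglongrightarrow> (iexp (\<Sum>i\<in>I. sqrt t * g i * a i)
         * of_real (exp (- ((\<Sum>i\<in>I. (sqrt t * g i)\<^sup>2) - (\<Sum>i\<in>I. w i * (sqrt t * g i))\<^sup>2) / 2))) * of_real (E g)"
        unfolding \<phi>_def by (intro tendsto_intros char)
      also have "(\<Sum>i\<in>I. w i * (sqrt t * g i)) = sqrt t * (\<Sum>i\<in>I. w i * g i)"
        by (simp add: sum_distrib_left mult_ac)
      also have "(\<Sum>i\<in>I. (sqrt t * g i)\<^sup>2) = t * (\<Sum>i\<in>I. (g i)\<^sup>2)"
        using t by (simp add: sum_distrib_left power_mult_distrib)
      also have "(iexp (\<Sum>i\<in>I. sqrt t * g i * a i)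
         * of_real (exp (- (t * (\<Sum>i\<in>I. (g i)\<^sup>2) - (sqrt t * (\<Sum>i\<in>I. w i * g i))\<^sup>2) / 2))) * of_real (E g)
         = iexp (\<Sum>i\<in>I. sqrt t * g i * a i) * of_real (exp (- (t * (\<Sum>i\<in>I. (g i)\<^sup>2)) / 2))"
      proof -
        have "exp (- (t * (\<Sum>i\<in>I. (g i)\<^sup>2) - (sqrt t * (\<Sum>i\<in>I. w i * g i))\<^sup>2) / 2) * E g
          = exp (- (t * (\<Sum>i\<in>I. (g i)\<^sup>2)) / 2)"
        proof -
          have "- (t * S - (sqrt t * W)\<^sup>2) / 2 + - (t / 2) * W\<^sup>2 = - (t * S) / 2" for S W :: real
            using t by (simp add: power_mult_distrib diff_divide_distrib)
          then show ?thesis unfolding E_def mult_exp_exp by simp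
        qed
        then show ?thesis by (simp only: mult.assoc of_real_mult[symmetric])
      qed
      also have "exp (- (t * (\<Sum>i\<in>I. (g i)\<^sup>2)) / 2) = (\<Prod>i\<in>I. exp (- t * (g i)\<^sup>2 / 2))"
        using fin by (simp add: exp_sum[symmetric] sum_distrib_left sum_negf sum_divide_distrib)
      also have "iexp (\<Sum>i\<in>I. sqrt t * g i * a i) = (\<Prod>i\<in>I. iexp (sqrt t * a i * g i))"
        using fin by (simp add: exp_sum[symmetric] sum_distrib_left mult_ac)
      finally show "(\<lambda>k. \<phi> k g * complex_of_real (E g))
         \<longlonglongrightarrow> (\<Prod>i\<in>I. iexp (sqrt t * a i * g i) * complex_of_real (exp (- t * (g i)\<^sup>2 / 2)))"
        by (simp only: prod.distrib of_real_prod)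
    qed
  qed simp
  also have "(CLINT g|normal_PiM I. (\<Prod>i\<in>I. iexp (sqrt t * a i * g i) * of_real (exp (- t * (g i)\<^sup>2 / 2))))
    = (\<Prod>i\<in>I. CLINT g|std_normal_distribution. iexp (sqrt t * a i * g) * of_real (exp (- t * g\<^sup>2 / 2)))"
    using t by (intro normal_PiM.product_integral_prod fin integrable_iexp_mult N.prob_space_axioms) auto
  also have "\<dots> = (\<Prod>i\<in>I. of_real (exp (- (sqrt t * a i)\<^sup>2 / (2 * (1 + t))) / sqrt (1 + t)))"
    by (simp only: std_normal_char_laplace[OF t])
  also have "\<dots> = of_real ((\<Prod>i\<in>I. exp (- t * (a i)\<^sup>2 / (2 * (1 + t)))) / sqrt (1 + t) ^ card I)"
    using t by (simp add: prod_dividef power_mult_distrib)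
  also have "(\<Prod>i\<in>I. exp (- t * (a i)\<^sup>2 / (2 * (1 + t)))) = exp (\<Sum>i\<in>I. - t * (a i)\<^sup>2 / (2 * (1 + t)))"
    using fin by (simp add: exp_sum)
  also have "(\<Sum>i\<in>I. - t * (a i)\<^sup>2 / (2 * (1 + t))) = - t * (\<Sum>i\<in>I. (a i)\<^sup>2) / (2 * (1 + t))"
    by (simp only: sum_distrib_left sum_divide_distrib)
  finally have "(\<lambda>k. complex_of_real ((\<integral>\<omega>. exp (- (t / 2) * (\<Sum>i\<in>I. (Y k i \<omega>)\<^sup>2)) \<partial>M k) / sqrt (1 + t)))
    \<longlonglongrightarrow> of_real (exp (- t * (\<Sum>i\<in>I. (a i)\<^sup>2) / (2 * (1 + t))) / sqrt (1 + t) ^ card I)"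
    unfolding \<phi>_def E_def using laplace_eq_char_integral[OF M fin w meas orth t] by simp
  then have "(\<lambda>k. (\<integral>\<omega>. exp (- (t / 2) * (\<Sum>i\<in>I. (Y k i \<omega>)\<^sup>2)) \<partial>M k) / sqrt (1 + t))
    \<longlonglongrightarrow> exp (- t * (\<Sum>i\<in>I. (a i)\<^sup>2) / (2 * (1 + t))) / sqrt (1 + t) ^ card I"
    by (simp only: tendsto_of_real_iff)
  then have "(\<lambda>k. (\<integral>\<omega>. exp (- (t / 2) * (\<Sum>i\<in>I. (Y k i \<omega>)\<^sup>2)) \<partial>M k) / sqrt (1 + t) * sqrt (1 + t))
    \<longlonglongrightarrow> exp (- t * (\<Sum>i\<in>I. (a i)\<^sup>2) / (2 * (1 + t))) / sqrt (1 + t) ^ card I * sqrt (1 + t)"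
    by (rule tendsto_mult_right)
  moreover have "sqrt (1 + t) ^ card I = sqrt (1 + t) ^ (card I - 1) * sqrt (1 + t)"
    using ne fin by (metis card_gt_0_iff power_minus_mult)
  ultimately show ?thesis using t by simp
qed

text \<open>The cells partition the line, so the character of one observation takes the value
  \<open>iexp (\<theta> i)\<close> on cell \<open>i\<close>; independence turns the sum over
  observations into a power.\<close>

lemma (in prob_space) char_counts:
  fixes X :: "'t \<Rightarrow> 'a \<Rightarrow> real" and B :: "'i \<Rightarrow> real set"
  assumes ind: "indep_vars (\<lambda>_. borel) X T" and fin: "finite T" "finite I"
    and B: "\<And>i. i \<in> I \<Longrightarrow> B i \<in> sets borel" "disjoint_family_on B I" "(\<Union>i\<in>I. B i) = UNIV"
    and \<pi>: "\<And>i t. i \<in> I \<Longrightarrow> t \<in> T \<Longrightarrow> prob {\<omega> \<in> space M. X t \<omega> \<in> B i} = \<pi> i"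
  shows "(CLINT \<omega>|M. iexp (\<Sum>i\<in>I. \<theta> i * (\<Sum>t\<in>T. indicator (B i) (X t \<omega>))))
    = (\<Sum>i\<in>I. of_real (\<pi> i) * iexp (\<theta> i)) ^ card T"
proof -
  define f where "f x = (\<Sum>i\<in>I. \<theta> i * indicator (B i) x)" for x
  have [measurable]: "B i \<in> sets borel" if "i \<in> I" for i using B(1) that .
  have f[measurable]: "f \<in> borel_measurable borel" unfolding f_def by measurable
  have X[measurable]: "X t \<in> borel_measurable M" if "t \<in> T" for t
    using ind that by (auto simp: indep_vars_def)
  have ind': "indep_vars (\<lambda>_. borel) (\<lambda>t \<omega>. f (X t \<omega>)) T"
    using ind by (rule indep_vars_compose2) simp
  have one: "char (distr M borel (\<lambda>\<omega>. f (X t \<omega>))) 1 = (\<Sum>i\<in>I. of_real (\<pi> i) * iexp (\<theta> i))" if t: "t \<in> T" for t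
  proof -
    have pt: "iexp (f x) = (\<Sum>i\<in>I. indicat_real (B i) x *\<^sub>R iexp (\<theta> i))" for x
    proof -
      obtain i where i: "i \<in> I" "x \<in> B i" using B(3) by auto
      have "indicat_real (B j) x = (if j = i then 1 else 0)" if "j \<in> I" for j
        using B(2) i that by (auto simp: disjoint_family_on_def indicator_def)
      then have *: "f x = (\<Sum>j\<in>I. if j = i then \<theta> j else 0)"
        "(\<Sum>j\<in>I. indicat_real (B j) x *\<^sub>R iexp (\<theta> j)) = (\<Sum>j\<in>I. if j = i then iexp (\<theta> j) else 0)"
        unfolding f_def by (auto intro!: sum.cong)
      show ?thesis unfolding * using i fin by simp
    qed
    have "char (distr M borel (\<lambda>\<omega>. f (X t \<omega>))) 1 = (CLINT \<omega>|M. iexp (f (X t \<omega>)))"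
      unfolding char_def using t by (subst integral_distr) auto
    also have "\<dots> = (CLINT \<omega>|M. (\<Sum>i\<in>I. indicat_real {\<omega>\<in>space M. X t \<omega> \<in> B i} \<omega> *\<^sub>R iexp (\<theta> i)))"
      unfolding pt by (intro Bochner_Integration.integral_cong[OF refl] sum.cong) (auto simp: indicator_def)
    also have "\<dots> = (\<Sum>i\<in>I. prob {\<omega>\<in>space M. X t \<omega> \<in> B i} *\<^sub>R iexp (\<theta> i))"
    proof (intro has_bochner_integral_integral_eq has_bochner_integral_sum has_bochner_integral_indicator)
      fix i assume "i \<in> I"
      then show "{\<omega> \<in> space M. X t \<omega> \<in> B i} \<in> sets M"
        using t by measurable
    qed (simp add: emeasure_eq_measure)
    also have "\<dots> = (\<Sum>i\<in>I. of_real (\<pi> i) * iexp (\<theta> i))"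
      using \<pi> t by (intro sum.cong) (auto simp: scaleR_conv_of_real)
    finally show ?thesis .
  qed
  have sum_eq: "(\<Sum>i\<in>I. \<theta> i * (\<Sum>t\<in>T. indicator (B i) (X t \<omega>))) = (\<Sum>t\<in>T. f (X t \<omega>))" for \<omega>
    unfolding f_def by (subst sum.swap) (simp add: sum_distrib_left)
  have "(CLINT \<omega>|M. iexp (\<Sum>i\<in>I. \<theta> i * (\<Sum>t\<in>T. indicator (B i) (X t \<omega>))))
     = char (distr M borel (\<lambda>\<omega>. \<Sum>t\<in>T. f (X t \<omega>))) 1"
    unfolding sum_eq char_def by (subst integral_distr) auto
  also have "\<dots> = (\<Prod>t\<in>T. char (distr M borel (\<lambda>\<omega>. f (X t \<omega>))) 1)"
    using ind' by (rule char_distr_sum)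
  also have "\<dots> = (\<Sum>i\<in>I. of_real (\<pi> i) * iexp (\<theta> i)) ^ card T"
    using one by simp
  finally show ?thesis .
qed

text \<open>Second-order expansion of the characteristic function of one observation. Centring of
  \<open>h\<close> removes the term of order \<open>sqrt (N k)\<close>; the perturbation
  \<open>d\<close> of the probabilities contributes the mean, the squares of \<open>h\<close> the
  variance, and the cubic remainder vanishes like \<open>1 / sqrt (N k)\<close>.\<close>

lemma multinomial_char_tendsto:
  fixes \<pi> h :: "'i \<Rightarrow> real" and d :: "nat \<Rightarrow> 'i \<Rightarrow> real"
  assumes fin: "finite I" and N: "filterlim N at_top sequentially" "\<And>k. N k > 0"
    and d: "\<And>i. i \<in> I \<Longrightarrow> (\<lambda>k. d k i) \<longlonglongrightarrow> D i"
    and prob: "\<And>k i. i \<in> I \<Longrightarrow> \<pi> i + d k i / sqrt (N k) \<ge> 0" "\<And>k. (\<Sum>i\<in>I. \<pi> i + d k i / sqrt (N k)) = 1"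
    and cent: "(\<Sum>i\<in>I. \<pi> i * h i) = 0"
  shows "(\<lambda>k. (\<Sum>i\<in>I. of_real (\<pi> i + d k i / sqrt (N k)) * iexp (h i / sqrt (N k))) ^ N k)
     \<longlonglongrightarrow> iexp (\<Sum>i\<in>I. D i * h i) * of_real (exp (- (\<Sum>i\<in>I. \<pi> i * (h i)\<^sup>2) / 2))"
proof -
  define q where "q k i = \<pi> i + d k i / sqrt (N k)" for k i
  define z where "z k = (\<Sum>i\<in>I. complex_of_real (q k i) * iexp (h i / sqrt (N k)))" for k
  have real_N: "filterlim (\<lambda>k. sqrt (real (N k))) at_top sequentially"
    using N(1) by (intro filterlim_compose[OF sqrt_at_top] filterlim_compose[OF filterlim_real_sequentially])
  have q0: "(\<lambda>k. q k i) \<longlonglongrightarrow> \<pi> i" if "i \<in> I" for i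
    using tendsto_add[OF tendsto_const real_tendsto_divide_at_top[OF d[OF that] real_N], of "\<pi> i"] by (simp add: q_def)
  have z1: "norm (z k) \<le> 1" for k
  proof -
    have "norm (z k) \<le> (\<Sum>i\<in>I. norm (complex_of_real (q k i) * iexp (h i / sqrt (N k))))"
      unfolding z_def by (rule norm_sum)
    also have "\<dots> = (\<Sum>i\<in>I. q k i)"
      using prob(1) unfolding q_def norm_mult norm_of_real norm_iexp by (intro sum.cong) auto
    finally show ?thesis using prob(2) by (simp add: q_def)
  qed
  define R where "R x = iexp x - (1 + \<i> * of_real x - of_real (x\<^sup>2 / 2))" for x
  have R: "norm (R x) \<le> \<bar>x\<bar> ^ 3" for x
  proof -
    have "norm (iexp x - (\<Sum>k \<le> 2. (\<i> * x)^k / fact k)) \<le> \<bar>x\<bar> ^ Suc 2 / fact (Suc 2)"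
      by (rule iexp_approx1)
    also have "\<bar>x\<bar> ^ Suc 2 / fact (Suc 2) = \<bar>x\<bar> ^ 3 / 6" by (simp add: eval_nat_numeral)
    also have "\<dots> \<le> \<bar>x\<bar> ^ 3" using zero_le_power[OF abs_ge_zero, of x 3] by linarith
    also have "(\<Sum>k \<le> 2. (\<i> * complex_of_real x)^k / fact k) = 1 + \<i> * of_real x - of_real (x\<^sup>2 / 2)"
      by (simp add: numeral_2_eq_2 power_mult_distrib)
    finally show ?thesis by (simp add: R_def)
  qed
  have expand: "of_nat (N k) * (z k - 1) = \<i> * of_real (\<Sum>i\<in>I. d k i * h i) - of_real ((\<Sum>i\<in>I. q k i * (h i)\<^sup>2) / 2)
      + (\<Sum>i\<in>I. of_real (q k i) * (of_nat (N k) * R (h i / sqrt (N k))))" for k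
  proof -
    define s where "s = sqrt (N k)"
    have s: "s > 0" "real (N k) = s * s" using N(2) by (auto simp: s_def)
    have sd: "(\<Sum>i\<in>I. q k i * h i) * s = (\<Sum>i\<in>I. d k i * h i)"
    proof -
      have "(\<Sum>i\<in>I. q k i * h i) = (\<Sum>i\<in>I. \<pi> i * h i) + (\<Sum>i\<in>I. d k i * h i) / s"
        by (simp add: q_def s_def algebra_simps sum.distrib sum_divide_distrib)
      then show ?thesis using cent s by simp
    qed
    have q1: "(\<Sum>i\<in>I. q k i) = 1" using prob(2) by (simp add: q_def)
    have "z k - 1 = (\<Sum>i\<in>I. of_real (q k i) * (iexp (h i / s) - 1))"
      using q1 by (simp add: z_def s_def right_diff_distrib sum_subtractf flip: of_real_sum)
    also have "of_nat (N k) * \<dots> = (\<Sum>i\<in>I. of_real (q k i) * (of_real (s * s) * (\<i> * of_real (h i / s) - of_real ((h i / s)\<^sup>2 / 2) + R (h i / s))))"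
      unfolding R_def s(2)[symmetric] by (simp add: sum_distrib_left algebra_simps)
    also have "\<dots> = (\<Sum>i\<in>I. \<i> * of_real (q k i * h i * s) - of_real (q k i * (h i)\<^sup>2 / 2) + of_real (q k i) * (of_real (s * s) * R (h i / s)))"
      using s(1) by (intro sum.cong[OF refl]) (simp add: field_simps power2_eq_square)
    also have "\<dots> = \<i> * of_real ((\<Sum>i\<in>I. q k i * h i) * s) - of_real ((\<Sum>i\<in>I. q k i * (h i)\<^sup>2) / 2)
      + (\<Sum>i\<in>I. of_real (q k i) * (of_real (s * s) * R (h i / s)))"
      by (simp only: sum.distrib sum_subtractf sum_distrib_left sum_distrib_right sum_divide_distrib of_real_sum)
    finally show ?thesis unfolding sd s_def[symmetric] s(2)[symmetric] by simp
  qed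
  have R0: "(\<lambda>k. of_nat (N k) * R (h i / sqrt (N k))) \<longlonglongrightarrow> 0" for i
  proof (rule Lim_null_comparison)
    show "\<forall>\<^sub>F k in sequentially. norm (of_nat (N k) * R (h i / sqrt (N k))) \<le> \<bar>h i\<bar> ^ 3 / sqrt (N k)"
    proof (intro always_eventually allI)
      fix k
      have "norm (of_nat (N k) * R (h i / sqrt (N k))) \<le> real (N k) * \<bar>h i / sqrt (N k)\<bar> ^ 3"
        unfolding norm_mult norm_of_nat by (rule mult_left_mono[OF R]) simp
      also have "\<dots> = \<bar>h i\<bar> ^ 3 / sqrt (N k)"
        using N(2)[of k] by (simp add: power_divide abs_divide field_simps eval_nat_numeral)
      finally show "norm (of_nat (N k) * R (h i / sqrt (N k))) \<le> \<bar>h i\<bar> ^ 3 / sqrt (N k)" .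
    qed
    show "(\<lambda>k. \<bar>h i\<bar> ^ 3 / sqrt (N k)) \<longlonglongrightarrow> 0"
      by (rule real_tendsto_divide_at_top[OF tendsto_const real_N])
  qed
  have "(\<lambda>k. of_nat (N k) * (z k - 1)) \<longlonglongrightarrow> \<i> * of_real (\<Sum>i\<in>I. D i * h i) - of_real ((\<Sum>i\<in>I. \<pi> i * (h i)\<^sup>2) / 2)
      + (\<Sum>i\<in>I. of_real (\<pi> i) * 0)"
    unfolding expand by (intro tendsto_intros d q0 R0) simp_all
  from tendsto_power_exp[OF N(1) z1 this]
  have "(\<lambda>k. z k ^ N k) \<longlonglongrightarrow> exp (\<i> * of_real (\<Sum>i\<in>I. D i * h i) + of_real (- (\<Sum>i\<in>I. \<pi> i * (h i)\<^sup>2) / 2))"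
    by simp
  then show ?thesis
    unfolding z_def q_def exp_add exp_of_real .
qed

text \<open>The normalized counts divided by \<open>sqrt (\<pi> i)\<close> are orthogonal to the
  unit vector with entries \<open>sqrt (\<pi> i)\<close>, because counts and probabilities have
  fixed totals; this is the geometry of \<open>laplace_tendsto\<close>. Two shifts add up:
  \<open>d\<close> moves the cell probabilities, \<open>c\<close> moves the counts
  themselves.\<close>

lemma multinomial_laplace_tendsto:
  fixes \<pi> :: "'i \<Rightarrow> real" and d c :: "nat \<Rightarrow> 'i \<Rightarrow> real" and M :: "nat \<Rightarrow> 'a measure"
    and X :: "nat \<Rightarrow> 't \<Rightarrow> 'a \<Rightarrow> real" and T :: "nat \<Rightarrow> 't set"
  assumes M: "\<And>k. prob_space (M k)" and fin: "finite I" "\<And>k. finite (T k)"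
    and N: "filterlim (\<lambda>k. card (T k)) at_top sequentially" "\<And>k. card (T k) > 0"
    and ind: "\<And>k. prob_space.indep_vars (M k) (\<lambda>_. borel) (X k) (T k)"
    and B: "\<And>i. i \<in> I \<Longrightarrow> B i \<in> sets borel" "disjoint_family_on B I" "(\<Union>i\<in>I. B i) = UNIV"
    and \<pi>: "\<And>i. i \<in> I \<Longrightarrow> \<pi> i > 0" "(\<Sum>i\<in>I. \<pi> i) = 1"
    and prob: "\<And>k i t. i \<in> I \<Longrightarrow> t \<in> T k \<Longrightarrow>
        measure (M k) {\<omega> \<in> space (M k). X k t \<omega> \<in> B i} = \<pi> i + d k i / sqrt (card (T k))"
    and d: "\<And>i. i \<in> I \<Longrightarrow> (\<lambda>k. d k i) \<longlonglongrightarrow> D i"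
    and c: "\<And>i. i \<in> I \<Longrightarrow> (\<lambda>k. c k i) \<longlonglongrightarrow> C i" and c0: "\<And>k. (\<Sum>i\<in>I. c k i) = 0" and t: "t \<ge> 0"
  shows "(\<lambda>k. \<integral>\<omega>. exp (- (t / 2) * (\<Sum>i\<in>I.
        (((\<Sum>s\<in>T k. indicator (B i) (X k s \<omega>)) - card (T k) * \<pi> i) / sqrt (card (T k)) + c k i)\<^sup>2 / \<pi> i)) \<partial>M k)
     \<longlonglongrightarrow> exp (- t * (\<Sum>i\<in>I. (D i + C i)\<^sup>2 / \<pi> i) / (2 * (1 + t))) / sqrt (1 + t) ^ (card I - 1)"
proof -
  define w where "w i = sqrt (\<pi> i)" for i
  have w: "w i > 0" "(w i)\<^sup>2 = \<pi> i" if "i \<in> I" for i using \<pi>(1)[OF that] by (auto simp: w_def)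
  define n where "n k = card (T k)" for k
  define S where "S k i \<omega> = (\<Sum>s\<in>T k. indicat_real (B i) (X k s \<omega>))" for k i \<omega>
  define Y where "Y k i \<omega> = ((S k i \<omega> - n k * \<pi> i) / sqrt (n k) + c k i) / w i" for k i \<omega>
  have X: "X k s \<in> borel_measurable (M k)" if "s \<in> T k" for k s
    using ind[of k] that by (auto simp: prob_space.indep_vars_def[OF M])
  have S_meas: "S k i \<in> borel_measurable (M k)" if "i \<in> I" for k i
  proof -
    note [measurable] = B(1)[OF that] X
    show ?thesis unfolding S_def by measurable
  qed
  have sum_ind: "(\<Sum>i\<in>I. indicat_real (B i) x) = 1" for x
  proof -
    obtain i where i: "i \<in> I" "x \<in> B i" using B(3) by auto
    have "indicat_real (B j) x = (if j = i then 1 else 0)" if "j \<in> I" for j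
      using B(2) i that by (auto simp: disjoint_family_on_def indicator_def)
    then have "(\<Sum>i\<in>I. indicat_real (B i) x) = (\<Sum>j\<in>I. if j = i then 1 else 0)"
      by (rule sum.cong[OF refl])
    then show ?thesis using i fin by simp
  qed
  have S1: "(\<Sum>i\<in>I. S k i \<omega>) = n k" for k \<omega>
    unfolding S_def n_def by (subst sum.swap) (simp add: sum_ind)
  have sum1: "(\<Sum>i\<in>I. \<pi> i + d k i / sqrt (n k)) = 1" and nonneg: "i \<in> I \<Longrightarrow> \<pi> i + d k i / sqrt (n k) \<ge> 0" for k i
  proof -
    interpret Mk: prob_space "M k" by (rule M)
    obtain s where s: "s \<in> T k" using N(2)[of k] by (auto simp: card_gt_0_iff)
    note [measurable] = B(1) X[OF s]
    have "(\<Sum>i\<in>I. \<pi> i + d k i / sqrt (n k)) = (\<Sum>i\<in>I. Mk.prob {\<omega>\<in>space (M k). X k s \<omega> \<in> B i})"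
      using prob s by (simp add: n_def)
    also have "\<dots> = (\<Sum>i\<in>I. Mk.expectation (\<lambda>\<omega>. indicat_real (B i) (X k s \<omega>)))"
    proof (rule sum.cong[OF refl])
      fix i assume "i \<in> I"
      have "Mk.prob {\<omega>\<in>space (M k). X k s \<omega> \<in> B i} = Mk.expectation (indicat_real {\<omega>\<in>space (M k). X k s \<omega> \<in> B i})"
        using \<open>i \<in> I\<close> by (simp add: Int_absorb2)
      also have "\<dots> = Mk.expectation (\<lambda>\<omega>. indicat_real (B i) (X k s \<omega>))"
        by (intro Bochner_Integration.integral_cong) (auto simp: indicator_def)
      finally show "Mk.prob {\<omega>\<in>space (M k). X k s \<omega> \<in> B i} = \<dots>" .
    qed
    also have "\<dots> = Mk.expectation (\<lambda>\<omega>. \<Sum>i\<in>I. indicat_real (B i) (X k s \<omega>))"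
      by (intro Bochner_Integration.integral_sum[symmetric] Mk.integrable_const_bound[of _ 1]) auto
    also have "\<dots> = 1" by (simp add: sum_ind Mk.prob_space)
    finally show "(\<Sum>i\<in>I. \<pi> i + d k i / sqrt (n k)) = 1" .
    show "i \<in> I \<Longrightarrow> \<pi> i + d k i / sqrt (n k) \<ge> 0"
      using prob[OF _ s, of i] by (metis measure_nonneg n_def)
  qed
  have "(\<lambda>k. \<integral>\<omega>. exp (- (t / 2) * (\<Sum>i\<in>I. (Y k i \<omega>)\<^sup>2)) \<partial>M k)
     \<longlonglongrightarrow> exp (- t * (\<Sum>i\<in>I. ((D i + C i) / w i)\<^sup>2) / (2 * (1 + t))) / sqrt (1 + t) ^ (card I - 1)"
  proof (rule laplace_tendsto[OF M fin(1) _ _ _ t])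
    show "(\<Sum>i\<in>I. (w i)\<^sup>2) = 1" using w \<pi>(2) by simp
    show "Y k i \<in> borel_measurable (M k)" if "i \<in> I" for k i
      unfolding Y_def using S_meas[OF that] by measurable
    show "(\<Sum>i\<in>I. w i * Y k i \<omega>) = 0" for k \<omega>
    proof -
      have "(\<Sum>i\<in>I. w i * Y k i \<omega>) = (\<Sum>i\<in>I. (S k i \<omega> - n k * \<pi> i) / sqrt (n k) + c k i)"
        using w by (intro sum.cong[OF refl]) (force simp: Y_def)
      also have "\<dots> = ((\<Sum>i\<in>I. S k i \<omega>) - n k * (\<Sum>i\<in>I. \<pi> i)) / sqrt (n k) + (\<Sum>i\<in>I. c k i)"
        by (simp add: sum.distrib sum_subtractf sum_divide_distrib[symmetric] sum_distrib_left[symmetric])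
      finally show ?thesis by (simp add: S1 \<pi>(2) c0)
    qed
    fix \<theta> :: "'i \<Rightarrow> real"
    define \<tau> where "\<tau> i = \<theta> i / w i" for i
    \<comment> \<open>Subtracting the weighted mean from \<open>\<tau>\<close> accounts for the
      centring \<open>n k * \<pi> i\<close> of the counts, as the counts add up to
      \<open>n k\<close>; it also provides the centred coefficients that
      \<open>multinomial_char_tendsto\<close> asks for.\<close>
    define h where "h i = \<tau> i - (\<Sum>i\<in>I. \<pi> i * \<tau> i)" for i
    have \<tau>bar: "(\<Sum>i\<in>I. \<pi> i * \<tau> i) = (\<Sum>i\<in>I. w i * \<theta> i)"
      using w by (intro sum.cong[OF refl]) (simp add: \<tau>_def power2_eq_square[symmetric] flip: w(2), simp add: power2_eq_square)
    have cent: "(\<Sum>i\<in>I. \<pi> i * h i) = 0"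
      using \<pi>(2) by (simp add: h_def right_diff_distrib sum_subtractf sum_distrib_right[symmetric])
    have lin: "(\<Sum>i\<in>I. \<theta> i * Y k i \<omega>) = (\<Sum>i\<in>I. h i / sqrt (n k) * S k i \<omega>) + (\<Sum>i\<in>I. \<tau> i * c k i)" for k \<omega>
    proof -
      have "(\<Sum>i\<in>I. \<theta> i * Y k i \<omega>) = (\<Sum>i\<in>I. \<tau> i * S k i \<omega> / sqrt (n k)  - n k * (\<pi> i * \<tau> i) / sqrt (n k) + \<tau> i * c k i)"
        by (intro sum.cong[OF refl]) (simp add: Y_def \<tau>_def add_divide_distrib diff_divide_distrib algebra_simps)
      also have "\<dots> = (\<Sum>i\<in>I. \<tau> i * S k i \<omega> / sqrt (n k)) - n k * (\<Sum>i\<in>I. \<pi> i * \<tau> i) / sqrt (n k) + (\<Sum>i\<in>I. \<tau> i * c k i)"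
        by (simp add: sum.distrib sum_subtractf sum_divide_distrib[symmetric] sum_distrib_left[symmetric])
      also have "n k * (\<Sum>i\<in>I. \<pi> i * \<tau> i) / sqrt (n k) = (\<Sum>i\<in>I. (\<Sum>i\<in>I. \<pi> i * \<tau> i) * S k i \<omega> / sqrt (n k))"
        unfolding S1[of k \<omega>, symmetric] by (simp add: sum_divide_distrib[symmetric] sum_distrib_left[symmetric])
      finally show ?thesis
        by (simp add: h_def left_diff_distrib diff_divide_distrib sum_subtractf)
    qed
    have chr: "(CLINT \<omega>|M k. iexp (\<Sum>i\<in>I. \<theta> i * Y k i \<omega>))
      = iexp (\<Sum>i\<in>I. \<tau> i * c k i) * (\<Sum>i\<in>I. of_real (\<pi> i + d k i / sqrt (n k)) * iexp (h i / sqrt (n k))) ^ n k" for k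
    proof -
      interpret Mk: prob_space "M k" by (rule M)
      have "(CLINT \<omega>|M k. iexp (\<Sum>i\<in>I. \<theta> i * Y k i \<omega>))
        = (CLINT \<omega>|M k. iexp (\<Sum>i\<in>I. \<tau> i * c k i) * iexp (\<Sum>i\<in>I. h i / sqrt (n k) * S k i \<omega>))"
        unfolding lin iexp_cis cis_mult by (simp add: add.commute)
      also have "\<dots> = iexp (\<Sum>i\<in>I. \<tau> i * c k i) * (CLINT \<omega>|M k. iexp (\<Sum>i\<in>I. h i / sqrt (n k) * S k i \<omega>))"
        by (rule Bochner_Integration.integral_mult_right_zero)
      also have "(CLINT \<omega>|M k. iexp (\<Sum>i\<in>I. h i / sqrt (n k) * S k i \<omega>))
        = (\<Sum>i\<in>I. of_real (\<pi> i + d k i / sqrt (n k)) * iexp (h i / sqrt (n k))) ^ n k"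
        unfolding S_def n_def by (rule Mk.char_counts[OF ind fin(2,1) B prob])
      finally show ?thesis .
    qed
    have "(\<lambda>k. CLINT \<omega>|M k. iexp (\<Sum>i\<in>I. \<theta> i * Y k i \<omega>)) \<longlonglongrightarrow> iexp (\<Sum>i\<in>I. \<tau> i * C i) *
       (iexp (\<Sum>i\<in>I. D i * h i) * of_real (exp (- (\<Sum>i\<in>I. \<pi> i * (h i)\<^sup>2) / 2)))"
      unfolding chr
      by (intro tendsto_intros c multinomial_char_tendsto fin(1) d nonneg sum1 cent)
        (use N in \<open>auto simp: n_def\<close>)
    moreover have "(\<Sum>i\<in>I. \<tau> i * C i) + (\<Sum>i\<in>I. D i * h i) = (\<Sum>i\<in>I. \<theta> i * ((D i + C i) / w i))"
    proof -
      \<comment> \<open>The perturbed probabilities sum to one, so \<open>d k\<close> has zero total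
        for every \<open>k\<close>, and so has its limit; the mean subtracted in \<open>h\<close>
        therefore drops out of the shift.\<close>
      have "(\<Sum>i\<in>I. D i) = 0"
      proof (rule LIMSEQ_unique)
        show "(\<lambda>k. \<Sum>i\<in>I. d k i) \<longlonglongrightarrow> (\<Sum>i\<in>I. D i)" by (intro tendsto_intros d)
        have "(\<Sum>i\<in>I. d k i) = 0" for k
        proof -
          have "(\<Sum>i\<in>I. d k i) / sqrt (n k) = 0"
            using sum1[of k] \<pi>(2) by (simp add: sum.distrib sum_divide_distrib)
          then show ?thesis using N(2)[of k] by (simp add: n_def)
        qed
        then show "(\<lambda>k. \<Sum>i\<in>I. d k i) \<longlonglongrightarrow> 0" by simp
      qed
      then have "(\<Sum>i\<in>I. D i * h i) = (\<Sum>i\<in>I. D i * \<tau> i)"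
        by (simp add: h_def right_diff_distrib sum_subtractf sum_distrib_right[symmetric])
      then show ?thesis
        by (simp add: sum.distrib[symmetric] \<tau>_def add_divide_distrib algebra_simps)
    qed
    moreover have "(\<Sum>i\<in>I. \<pi> i * (h i)\<^sup>2) = (\<Sum>i\<in>I. (\<theta> i)\<^sup>2) - (\<Sum>i\<in>I. w i * \<theta> i)\<^sup>2"
    proof -
      define m where "m = (\<Sum>i\<in>I. \<pi> i * \<tau> i)"
      have "(\<Sum>i\<in>I. \<pi> i * (h i)\<^sup>2) = (\<Sum>i\<in>I. \<pi> i * (\<tau> i)\<^sup>2 - 2 * m * (\<pi> i * \<tau> i) + m\<^sup>2 * \<pi> i)"
        unfolding h_def m_def[symmetric] by (intro sum.cong[OF refl]) (simp add: power2_eq_square algebra_simps)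
      also have "\<dots> = (\<Sum>i\<in>I. \<pi> i * (\<tau> i)\<^sup>2) - 2 * m * (\<Sum>i\<in>I. \<pi> i * \<tau> i) + m\<^sup>2 * (\<Sum>i\<in>I. \<pi> i)"
        by (simp add: sum.distrib sum_subtractf sum_distrib_left)
      also have "\<dots> = (\<Sum>i\<in>I. \<pi> i * (\<tau> i)\<^sup>2) - m\<^sup>2"
        unfolding m_def[symmetric] \<pi>(2) by (simp add: power2_eq_square)
      also have "(\<Sum>i\<in>I. \<pi> i * (\<tau> i)\<^sup>2) = (\<Sum>i\<in>I. (\<theta> i)\<^sup>2)"
      proof (rule sum.cong[OF refl])
        fix i assume "i \<in> I"
        from w[OF this] \<pi>(1)[OF this] show "\<pi> i * (\<tau> i)\<^sup>2 = (\<theta> i)\<^sup>2"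
          by (simp add: \<tau>_def power_divide)
      qed
      finally show ?thesis unfolding m_def \<tau>bar .
    qed
    ultimately show "(\<lambda>k. CLINT \<omega>|M k. iexp (\<Sum>i\<in>I. \<theta> i * Y k i \<omega>)) \<longlonglongrightarrow> iexp (\<Sum>i\<in>I. \<theta> i * ((D i + C i) / w i))
       * of_real (exp (- ((\<Sum>i\<in>I. (\<theta> i)\<^sup>2) - (\<Sum>i\<in>I. w i * \<theta> i)\<^sup>2) / 2))"
      by (simp only: mult.assoc[symmetric] iexp_cis cis_mult)
  qed
  also have "(\<Sum>i\<in>I. ((D i + C i) / w i)\<^sup>2) = (\<Sum>i\<in>I. (D i + C i)\<^sup>2 / \<pi> i)"
    using w by (intro sum.cong[OF refl]) (simp add: power_divide)
  also have "(\<lambda>k. \<integral>\<omega>. exp (- (t / 2) * (\<Sum>i\<in>I. (Y k i \<omega>)\<^sup>2)) \<partial>M k) = (\<lambda>k. \<integral>\<omega>. exp (- (t / 2) * (\<Sum>i\<in>I.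
        (((\<Sum>s\<in>T k. indicator (B i) (X k s \<omega>)) - card (T k) * \<pi> i) / sqrt (card (T k)) + c k i)\<^sup>2 / \<pi> i)) \<partial>M k)"
  proof (intro ext Bochner_Integration.integral_cong[OF refl] arg_cong[of _ _ exp] arg_cong2[of _ _ _ _ "(*)"] sum.cong[OF refl])
    fix k \<omega> i assume "i \<in> I"
    show "(Y k i \<omega>)\<^sup>2 = (((\<Sum>s\<in>T k. indicat_real (B i) (X k s \<omega>)) - card (T k) * \<pi> i) / sqrt (card (T k)) + c k i)\<^sup>2 / \<pi> i"
      unfolding Y_def S_def n_def power_divide w(2)[OF \<open>i \<in> I\<close>] ..
  qed simp
  finally show ?thesis .
qed

section \<open>The stationary solution as a moving average\<close>

text \<open>Fubini for the joint law of an independent pair: one variable is integrated out while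
  the other stays fixed. It plays the part of conditioning on \<open>Y\<close>.\<close>

lemma (in prob_space) expectation_indep_var:
  fixes h :: "'b \<times> 'b \<Rightarrow> real"
  assumes ind: "indep_var S X T Y" and h: "h \<in> borel_measurable (S \<Otimes>\<^sub>M T)"
    and bd: "\<And>x y. \<bar>h (x, y)\<bar> \<le> B"
  shows "expectation (\<lambda>\<omega>. h (X \<omega>, Y \<omega>)) = expectation (\<lambda>\<omega>. \<integral>x. h (x, Y \<omega>) \<partial>distr M S X)"
proof -
  have X: "X \<in> measurable M S" and Y: "Y \<in> measurable M T"
    and eq: "distr M S X \<Otimes>\<^sub>M distr M T Y = distr M (S \<Otimes>\<^sub>M T) (\<lambda>x. (X x, Y x))"
    using ind unfolding indep_var_distribution_eq by auto
  note [measurable] = X Y h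
  interpret X: prob_space "distr M S X" by (rule prob_space_distr) fact
  interpret Y: prob_space "distr M T Y" by (rule prob_space_distr) fact
  interpret XY: pair_prob_space "distr M S X" "distr M T Y" ..
  have int: "integrable (distr M S X \<Otimes>\<^sub>M distr M T Y) (case_prod (\<lambda>x y. h (x, y)))"
    using bd by (intro XY.P.integrable_const_bound[of _ B]) (auto simp: split_beta)
  have "expectation (\<lambda>\<omega>. h (X \<omega>, Y \<omega>)) = integral\<^sup>L (distr M (S \<Otimes>\<^sub>M T) (\<lambda>x. (X x, Y x))) h"
    by (subst integral_distr) auto
  also have "\<dots> = (\<integral>y. (\<integral>x. h (x, y) \<partial>distr M S X) \<partial>distr M T Y)"
    unfolding eq[symmetric] using XY.integral_snd[OF int] by simp
  also have "\<dots> = expectation (\<lambda>\<omega>. \<integral>x. h (x, Y \<omega>) \<partial>distr M S X)"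
    by (subst integral_distr) auto
  finally show ?thesis .
qed

lemma (in prob_space) expectation_sum_orthogonal:
  fixes X :: "'t \<Rightarrow> 'a \<Rightarrow> real"
  assumes fin: "finite T" and meas: "\<And>t. t \<in> T \<Longrightarrow> X t \<in> borel_measurable M"
    and bd: "\<And>t \<omega>. t \<in> T \<Longrightarrow> \<bar>X t \<omega>\<bar> \<le> B"
    and orth: "\<And>s t. s \<in> T \<Longrightarrow> t \<in> T \<Longrightarrow> s \<noteq> t \<Longrightarrow> expectation (\<lambda>\<omega>. X s \<omega> * X t \<omega>) = 0"
  shows "expectation (\<lambda>\<omega>. (\<Sum>t\<in>T. X t \<omega>)\<^sup>2) = (\<Sum>t\<in>T. expectation (\<lambda>\<omega>. (X t \<omega>)\<^sup>2))"
proof -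
  have int: "integrable M (\<lambda>\<omega>. X s \<omega> * X t \<omega>)" if "s \<in> T" "t \<in> T" for s t
  proof (rule integrable_const_bound[of _ "B * B"])
    have B: "0 \<le> B" using bd[OF that(1), of undefined] by linarith
    show "AE \<omega> in M. norm (X s \<omega> * X t \<omega>) \<le> B * B"
      using bd[OF that(1)] bd[OF that(2)] B by (intro AE_I2) (auto simp: abs_mult intro!: mult_mono)
    show "(\<lambda>\<omega>. X s \<omega> * X t \<omega>) \<in> borel_measurable M"
      using that meas by measurable
  qed
  have "expectation (\<lambda>\<omega>. (\<Sum>t\<in>T. X t \<omega>)\<^sup>2) = expectation (\<lambda>\<omega>. \<Sum>s\<in>T. \<Sum>t\<in>T. X s \<omega> * X t \<omega>)"
    by (simp add: power2_eq_square sum_product)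
  also have "\<dots> = (\<Sum>s\<in>T. \<Sum>t\<in>T. expectation (\<lambda>\<omega>. X s \<omega> * X t \<omega>))"
    using int by (subst Bochner_Integration.integral_sum) (auto intro!: sum.cong Bochner_Integration.integral_sum)
  also have "\<dots> = (\<Sum>s\<in>T. \<Sum>t\<in>T. if t = s then expectation (\<lambda>\<omega>. (X s \<omega>)\<^sup>2) else 0)"
    using orth by (intro sum.cong refl) (auto simp: power2_eq_square)
  also have "\<dots> = (\<Sum>t\<in>T. expectation (\<lambda>\<omega>. (X t \<omega>)\<^sup>2))"
    using fin by simp
  finally show ?thesis .
qed

lemma (in prob_space) expectation_abs_le_sqrt:
  fixes X :: "'a \<Rightarrow> real"
  assumes [measurable]: "X \<in> borel_measurable M" and X2: "integrable M (\<lambda>\<omega>. (X \<omega>)\<^sup>2)"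
  shows "integrable M X" "expectation (\<lambda>\<omega>. \<bar>X \<omega>\<bar>) \<le> sqrt (expectation (\<lambda>\<omega>. (X \<omega>)\<^sup>2))"
proof -
  show X: "integrable M X" by (rule square_integrable_imp_integrable) fact+
  have "0 \<le> variance (\<lambda>\<omega>. \<bar>X \<omega>\<bar>)" by (rule variance_positive)
  also have "\<dots> = expectation (\<lambda>\<omega>. (X \<omega>)\<^sup>2) - (expectation (\<lambda>\<omega>. \<bar>X \<omega>\<bar>))\<^sup>2"
    using X X2 by (subst variance_eq) auto
  finally show "expectation (\<lambda>\<omega>. \<bar>X \<omega>\<bar>) \<le> sqrt (expectation (\<lambda>\<omega>. (X \<omega>)\<^sup>2))"
    by (intro real_le_rsqrt) simp
qed

context contaminated_ar
begin

abbreviation noise_index :: "(nat \<times> int) set" where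
  "noise_index \<equiv> {..<3} \<times> UNIV"

text \<open>All driving variables as one family, indexed by \<open>(0, t)\<close> for \<open>\<epsilon>\<close>, \<open>(1, t)\<close> for \<open>z\<close> and
  \<open>(2, t)\<close> for \<open>\<xi>\<close>.\<close>

definition noise :: "nat \<times> int \<Rightarrow> 'a \<Rightarrow> real" where
  "noise j = ([\<epsilon>, z, \<xi>] ! fst j) (snd j)"

lemma noise_simps [simp]: "noise (0, t) = \<epsilon> t" "noise (Suc 0, t) = z t" "noise (1, t) = z t" "noise (2, t) = \<xi> t"
  by (simp_all add: noise_def eval_nat_numeral)

text \<open>The hypotheses give independence within each of the three sequences and between the
  sequences as whole processes. A finite index set is split into its rows \<open>J' i\<close>; an
  event on a row is a measurable set of paths, so the probability factorizes over the rows and then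
  inside each row. An empty row contributes the whole space.\<close>

lemma noise_indep: "indep_vars (\<lambda>_. borel) noise noise_index"
proof -
  have lt3: "i < 3 \<Longrightarrow> i = 0 \<or> i = 1 \<or> i = 2" for i :: nat by auto
  have row: "indep_vars (\<lambda>_. borel) (\<lambda>t. noise (i, t)) UNIV" if "i < 3" for i
    using lt3[OF that] innov_indep switch_indep outlier_indep by (auto simp: noise_def)
  have meas: "noise j \<in> borel_measurable M" if "j \<in> noise_index" for j
    using row[of "fst j"] that by (cases j) (auto simp: indep_vars_def)
  show ?thesis unfolding indep_vars_def2
  proof (intro conjI ballI indep_setsI)
    fix j assume "j \<in> noise_index" then show "noise j \<in> borel_measurable M" by (rule meas)
  next
    fix j assume "j \<in> noise_index"
    then show "{noise j -` C \<inter> space M |C. C \<in> sets borel} \<subseteq> events"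
      using meas by (auto intro: measurable_sets)
  next
    fix a J assume J: "J \<noteq> {}" "J \<subseteq> noise_index" "finite J"
      and a: "\<forall>j\<in>J. a j \<in> {noise j -` C \<inter> space M |C. C \<in> sets borel}"
    then have "\<forall>j\<in>J. \<exists>C. C \<in> sets borel \<and> a j = noise j -` C \<inter> space M"
      by blast
    from bchoice[OF this] obtain C where C: "\<And>j. j \<in> J \<Longrightarrow> C j \<in> sets borel" "\<And>j. j \<in> J \<Longrightarrow> a j = noise j -` C j \<inter> space M"
      by blast
    define J' where "J' i = {t. (i, t) \<in> J}" for i
    have J'_fin: "finite (J' i)" for i
    proof -
      have "J' i \<subseteq> snd ` J" by (force simp: J'_def)
      then show ?thesis using J(3) finite_subset by blast
    qed
    have J_eq: "J = Sigma {..<3} J'" using J(2) by (auto simp: J'_def)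
    define D where "D i = {f \<in> space (PiM UNIV (\<lambda>_. borel)). \<forall>t\<in>J' i. f t \<in> C (i, t)}" for i
    have D: "D i \<in> sets (PiM UNIV (\<lambda>_. borel))" for i
      unfolding D_def
    proof (rule sets.sets_Collect_finite_All[OF _ J'_fin])
      fix t assume "t \<in> J' i"
      then have "C (i, t) \<in> sets borel" using C by (auto simp: J'_def)
      then show "{f \<in> space (PiM UNIV (\<lambda>_. borel)). f t \<in> C (i, t)} \<in> sets (PiM UNIV (\<lambda>_. borel))"
        by measurable
    qed
    have pre: "(\<lambda>\<omega> t. ([\<epsilon>, z, \<xi>] ! i) t \<omega>) -` D i \<inter> space M = {\<omega>\<in>space M. \<forall>t\<in>J' i. noise (i, t) \<omega> \<in> C (i, t)}" for i
      by (auto simp: D_def space_PiM noise_def)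
    have "prob (\<Inter>j\<in>J. a j) = prob (\<Inter>i\<in>{..<3}. (\<lambda>\<omega> t. ([\<epsilon>, z, \<xi>] ! i) t \<omega>) -` D i \<inter> space M)"
    proof (rule arg_cong[where f=prob])
      have zero3: "(0::nat) \<in> {..<3}" by simp
      have "(\<Inter>j\<in>J. a j) = {\<omega>\<in>space M. \<forall>j\<in>J. noise j \<omega> \<in> C j}"
        using C(2) J(1) by auto
      also have "\<dots> = {\<omega>\<in>space M. \<forall>i\<in>{..<3}. \<forall>t\<in>J' i. noise (i, t) \<omega> \<in> C (i, t)}"
        unfolding J_eq by auto
      finally show "(\<Inter>j\<in>J. a j) = (\<Inter>i\<in>{..<3}. (\<lambda>\<omega> t. ([\<epsilon>, z, \<xi>] ! i) t \<omega>) -` D i \<inter> space M)"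
        unfolding pre using zero3 by blast
    qed
    also have "\<dots> = (\<Prod>i\<in>{..<3}. prob ((\<lambda>\<omega> t. ([\<epsilon>, z, \<xi>] ! i) t \<omega>) -` D i \<inter> space M))"
      using D by (intro indep_varsD[OF sequences_indep]) (auto simp: lessThan_empty_iff)
    also have "\<dots> = (\<Prod>i\<in>{..<3}. \<Prod>t\<in>J' i. prob (noise (i, t) -` C (i, t) \<inter> space M))"
    proof (rule prod.cong[OF refl])
      fix i :: nat assume i: "i \<in> {..<3}"
      show "prob ((\<lambda>\<omega> t. ([\<epsilon>, z, \<xi>] ! i) t \<omega>) -` D i \<inter> space M) = (\<Prod>t\<in>J' i. prob (noise (i, t) -` C (i, t) \<inter> space M))"
      proof (cases "J' i = {}")
        case True
        then show ?thesis unfolding pre by (simp add: prob_space)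
      next
        case False
        have "{\<omega>\<in>space M. \<forall>t\<in>J' i. noise (i, t) \<omega> \<in> C (i, t)} = (\<Inter>t\<in>J' i. noise (i, t) -` C (i, t) \<inter> space M)"
          using False by auto
        moreover have "C (i, t) \<in> sets borel" if "t \<in> J' i" for t
          using that C(1) by (simp add: J'_def)
        ultimately show ?thesis unfolding pre
          using indep_varsD[OF row False J'_fin, of i "\<lambda>t. C (i, t)"] i by simp
      qed
    qed
    also have "\<dots> = (\<Prod>j\<in>J. prob (noise j -` C j \<inter> space M))"
      unfolding J_eq using J'_fin by (subst prod.Sigma) (auto simp: split_beta)
    also have "\<dots> = (\<Prod>j\<in>J. prob (a j))"
      using C(2) by (intro prod.cong) auto
    finally show "prob (\<Inter>j\<in>J. a j) = (\<Prod>j\<in>J. prob (a j))" .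
  qed
qed

lemma noise_measurable: "j \<in> noise_index \<Longrightarrow> noise j \<in> borel_measurable M"
  using noise_indep by (auto simp: indep_vars_def)

lemma eps_measurable [measurable]: "\<epsilon> t \<in> borel_measurable M"
  and z_measurable [measurable]: "z t \<in> borel_measurable M"
  and xi_measurable [measurable]: "\<xi> t \<in> borel_measurable M"
  using noise_measurable[of "(0, t)"] noise_measurable[of "(1, t)"] noise_measurable[of "(2, t)"] by auto

lemma v_measurable [measurable]: "v t \<in> borel_measurable M"
  using stationary by (auto simp: strictly_stationary_def)

abbreviation "innov_law \<equiv> distr M borel (\<epsilon> 0)"

lemma real_distribution_innov: "real_distribution (distr M borel (\<epsilon> t))"
  by (rule real_distribution_distr) simp

lemma innov_law: "distr M borel (\<epsilon> t) = innov_law"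
  by (intro cdf_unique real_distribution_innov) (simp add: innov_cdf)

lemma innov_second_moment: "expectation (\<lambda>\<omega>. (\<epsilon> t \<omega>)\<^sup>2) = (\<integral>u. u\<^sup>2 \<partial>innov_law)"
  by (subst innov_law[of t, symmetric], subst integral_distr) auto

lemma stationary_expectation:
  fixes g :: "real \<Rightarrow> real"
  assumes [measurable]: "g \<in> borel_measurable borel"
  shows "expectation (\<lambda>\<omega>. g (v t \<omega>)) = expectation (\<lambda>\<omega>. g (v 0 \<omega>))"
proof -
  have "distr M (PiM {0} (\<lambda>_. borel)) (\<lambda>\<omega>. \<lambda>s\<in>{0}. v (s + t) \<omega>) = distr M (PiM {0} (\<lambda>_. borel)) (\<lambda>\<omega>. \<lambda>s\<in>{0}. v s \<omega>)"
    using stationary unfolding strictly_stationary_def by blast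
  then have "(\<integral>f. g (f 0) \<partial>distr M (PiM {0} (\<lambda>_. borel)) (\<lambda>\<omega>. \<lambda>s\<in>{0::int}. v (s + t) \<omega>))
     = (\<integral>f. g (f 0) \<partial>distr M (PiM {0} (\<lambda>_. borel)) (\<lambda>\<omega>. \<lambda>s\<in>{0}. v s \<omega>))"
    by simp
  then show ?thesis
    by (subst (asm) (1 2) integral_distr) auto
qed

section \<open>Convergence and second moments of the moving average\<close>

definition ma :: "int \<Rightarrow> 'a \<Rightarrow> real" where
  "ma t \<omega> = (\<Sum>k. impulse p \<beta> k * \<epsilon> (t - int k) \<omega>)"

lemma ma_measurable [measurable]: "ma t \<in> borel_measurable M"
  unfolding ma_def by measurable

context
  assumes stable: "ar_stable p \<beta>"
begin

abbreviation "gain \<equiv> (\<Sum>k. \<bar>impulse p \<beta> k\<bar>)"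

text \<open>The sum of absolute values has finite expectation: the first absolute moments of the
  innovations share a bound, and the impulse response is summable.\<close>

lemma AE_summable_ma: "AE \<omega> in M. summable (\<lambda>k. \<bar>impulse p \<beta> k * \<epsilon> (t - int k) \<omega>\<bar>)"
proof -
  define B where "B = sqrt (\<integral>u. u\<^sup>2 \<partial>innov_law)"
  have eB: "expectation (\<lambda>\<omega>. \<bar>\<epsilon> s \<omega>\<bar>) \<le> B" and int: "integrable M (\<epsilon> s)" for s
    using expectation_abs_le_sqrt[OF eps_measurable innov_square_integrable, of s]
    by (auto simp: innov_second_moment B_def)
  have "(\<integral>\<^sup>+\<omega>. (\<Sum>k. ennreal \<bar>impulse p \<beta> k * \<epsilon> (t - int k) \<omega>\<bar>) \<partial>M)
     = (\<Sum>k. \<integral>\<^sup>+\<omega>. ennreal \<bar>impulse p \<beta> k * \<epsilon> (t - int k) \<omega>\<bar> \<partial>M)"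
    by (rule nn_integral_suminf) measurable
  also have "\<dots> = (\<Sum>k. ennreal (\<bar>impulse p \<beta> k\<bar> * expectation (\<lambda>\<omega>. \<bar>\<epsilon> (t - int k) \<omega>\<bar>)))"
    using int by (intro suminf_cong, subst nn_integral_eq_integral) (auto simp: abs_mult)
  also have "\<dots> \<le> (\<Sum>k. ennreal (\<bar>impulse p \<beta> k\<bar> * B))"
    using eB by (intro suminf_le ennreal_leI mult_left_mono) auto
  also have "\<dots> = ennreal (\<Sum>k. \<bar>impulse p \<beta> k\<bar> * B)"
  proof (rule suminf_ennreal2)
    have "B \<ge> 0" using eB[of 0] by (meson Bochner_Integration.integral_nonneg abs_ge_zero order_trans)
    then show "0 \<le> \<bar>impulse p \<beta> k\<bar> * B" for k by simp
    show "summable (\<lambda>k. \<bar>impulse p \<beta> k\<bar> * B)"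
      by (intro summable_mult2 summable_impulse stable)
  qed
  also have "\<dots> < \<infinity>" by simp
  finally have "AE \<omega> in M. (\<Sum>k. ennreal \<bar>impulse p \<beta> k * \<epsilon> (t - int k) \<omega>\<bar>) \<noteq> \<infinity>"
    by (intro nn_integral_PInf_AE) auto
  then show ?thesis
    by eventually_elim (auto intro!: summable_suminf_not_top)
qed

text \<open>Cauchy-Schwarz with the weights \<open>\<bar>impulse p \<beta> k\<bar>\<close> bounds
  the squared partial sums by \<open>gain\<close> times a weighted sum of squared innovations;
  Fatou's lemma passes to the limit. The innovation law enters the bound through its second moment
  alone, which makes it uniform along a sequence of models.\<close>

lemma ma_second_moment:
  "integrable M (\<lambda>\<omega>. (ma t \<omega>)\<^sup>2)"
  "expectation (\<lambda>\<omega>. (ma t \<omega>)\<^sup>2) \<le> gain\<^sup>2 * (\<integral>u. u\<^sup>2 \<partial>innov_law)"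
proof -
  define S where "S N \<omega> = (\<Sum>k<N. impulse p \<beta> k * \<epsilon> (t - int k) \<omega>)" for N \<omega>
  define V where "V = (\<integral>u. u\<^sup>2 \<partial>innov_law)"
  have V0: "V \<ge> 0" by (simp add: V_def)
  have sm: "summable (\<lambda>k. \<bar>impulse p \<beta> k\<bar>)" using stable by (rule summable_impulse)
  have g0: "gain \<ge> 0" using sm by (intro suminf_nonneg) auto
  have le: "(\<Sum>k<N. \<bar>impulse p \<beta> k\<bar>) \<le> gain" for N
    using sm by (intro sum_le_suminf) auto
  have SN: "(\<integral>\<^sup>+\<omega>. ennreal ((S N \<omega>)\<^sup>2) \<partial>M) \<le> ennreal (gain\<^sup>2 * V)" for N
  proof -
    have pt: "(S N \<omega>)\<^sup>2 \<le> gain * (\<Sum>k<N. \<bar>impulse p \<beta> k\<bar> * (\<epsilon> (t - int k) \<omega>)\<^sup>2)" for \<omega>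
    proof -
      have "\<bar>S N \<omega>\<bar> \<le> (\<Sum>k<N. sqrt \<bar>impulse p \<beta> k\<bar> * (sqrt \<bar>impulse p \<beta> k\<bar> * \<bar>\<epsilon> (t - int k) \<omega>\<bar>))"
        unfolding S_def by (rule order_trans[OF sum_abs]) (simp add: abs_mult mult.assoc[symmetric])
      then have "(S N \<omega>)\<^sup>2 \<le> (\<Sum>k<N. sqrt \<bar>impulse p \<beta> k\<bar> * (sqrt \<bar>impulse p \<beta> k\<bar> * \<bar>\<epsilon> (t - int k) \<omega>\<bar>))\<^sup>2"
        unfolding abs_le_square_iff[symmetric] by (rule order_trans[OF _ abs_ge_self])
      also have "\<dots> \<le> (\<Sum>k<N. (sqrt \<bar>impulse p \<beta> k\<bar>)\<^sup>2) * (\<Sum>k<N. (sqrt \<bar>impulse p \<beta> k\<bar> * \<bar>\<epsilon> (t - int k) \<omega>\<bar>)\<^sup>2)"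
        by (rule Cauchy_Schwarz_ineq_sum)
      also have "\<dots> = (\<Sum>k<N. \<bar>impulse p \<beta> k\<bar>) * (\<Sum>k<N. \<bar>impulse p \<beta> k\<bar> * (\<epsilon> (t - int k) \<omega>)\<^sup>2)"
        by (simp add: power_mult_distrib)
      also have "\<dots> \<le> gain * (\<Sum>k<N. \<bar>impulse p \<beta> k\<bar> * (\<epsilon> (t - int k) \<omega>)\<^sup>2)"
        using le by (intro mult_right_mono sum_nonneg) auto
      finally show ?thesis .
    qed
    have int: "integrable M (\<lambda>\<omega>. gain * (\<Sum>k<N. \<bar>impulse p \<beta> k\<bar> * (\<epsilon> (t - int k) \<omega>)\<^sup>2))"
      using innov_square_integrable by simp
    have "(\<integral>\<^sup>+\<omega>. ennreal ((S N \<omega>)\<^sup>2) \<partial>M) \<le> (\<integral>\<^sup>+\<omega>. ennreal (gain * (\<Sum>k<N. \<bar>impulse p \<beta> k\<bar> * (\<epsilon> (t - int k) \<omega>)\<^sup>2)) \<partial>M)"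
      using pt by (intro nn_integral_mono ennreal_leI)
    also have "\<dots> = ennreal (expectation (\<lambda>\<omega>. gain * (\<Sum>k<N. \<bar>impulse p \<beta> k\<bar> * (\<epsilon> (t - int k) \<omega>)\<^sup>2)))"
      using int g0 by (intro nn_integral_eq_integral AE_I2 mult_nonneg_nonneg sum_nonneg) auto
    also have "expectation (\<lambda>\<omega>. gain * (\<Sum>k<N. \<bar>impulse p \<beta> k\<bar> * (\<epsilon> (t - int k) \<omega>)\<^sup>2)) = gain * ((\<Sum>k<N. \<bar>impulse p \<beta> k\<bar>) * V)"
      using innov_square_integrable by (simp add: innov_second_moment V_def sum_distrib_right)
    also have "ennreal \<dots> \<le> ennreal (gain\<^sup>2 * V)"
      using le g0 V0 by (intro ennreal_leI) (simp add: power2_eq_square mult.assoc mult_left_mono mult_right_mono)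
    finally show ?thesis .
  qed
  have "(\<integral>\<^sup>+\<omega>. ennreal ((ma t \<omega>)\<^sup>2) \<partial>M) = (\<integral>\<^sup>+\<omega>. liminf (\<lambda>N. ennreal ((S N \<omega>)\<^sup>2)) \<partial>M)"
  proof (rule nn_integral_cong_AE)
    show "AE \<omega> in M. ennreal ((ma t \<omega>)\<^sup>2) = liminf (\<lambda>N. ennreal ((S N \<omega>)\<^sup>2))"
      using AE_summable_ma[of t]
    proof eventually_elim
      case (elim \<omega>)
      then have "summable (\<lambda>k. impulse p \<beta> k * \<epsilon> (t - int k) \<omega>)" by (rule summable_rabs_cancel)
      then have "(\<lambda>N. S N \<omega>) \<longlonglongrightarrow> ma t \<omega>" unfolding S_def ma_def by (rule summable_LIMSEQ)
      then have "(\<lambda>N. ennreal ((S N \<omega>)\<^sup>2)) \<longlonglongrightarrow> ennreal ((ma t \<omega>)\<^sup>2)"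
        by (intro tendsto_ennrealI tendsto_intros)
      then show ?case by (rule lim_imp_Liminf[OF sequentially_bot, symmetric])
    qed
  qed
  also have "\<dots> \<le> liminf (\<lambda>N. \<integral>\<^sup>+\<omega>. ennreal ((S N \<omega>)\<^sup>2) \<partial>M)"
    unfolding S_def by (intro nn_integral_liminf) measurable
  also have "\<dots> \<le> ennreal (gain\<^sup>2 * V)"
    using SN by (intro Liminf_le always_eventually allI) auto
  finally have *: "(\<integral>\<^sup>+\<omega>. ennreal ((ma t \<omega>)\<^sup>2) \<partial>M) \<le> ennreal (gain\<^sup>2 * V)" .
  show int: "integrable M (\<lambda>\<omega>. (ma t \<omega>)\<^sup>2)"
    using * by (intro integrableI_nonneg) (auto simp: less_top[symmetric] top_unique)
  have "ennreal (expectation (\<lambda>\<omega>. (ma t \<omega>)\<^sup>2)) \<le> ennreal (gain\<^sup>2 * V)"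
    using * int by (subst (asm) nn_integral_eq_integral) auto
  then show "expectation (\<lambda>\<omega>. (ma t \<omega>)\<^sup>2) \<le> gain\<^sup>2 * (\<integral>u. u\<^sup>2 \<partial>innov_law)"
    using V0 by (simp add: V_def)
qed

text \<open>The remainder of the iterated recursion is a combination of \<open>p\<^sup>2\<close> terms that, by
  stationarity, all have the law of \<open>v\<^sub>0 - \<mu>\<close>, with weights tending to zero.\<close>

lemma AE_eq_ma:
  assumes mu: "\<nu> = (1 - (\<Sum>j=1..p. \<beta> j)) * \<mu>"
  shows "AE \<omega> in M. \<forall>t. v t \<omega> = \<mu> + ma t \<omega>"
proof (rule AE_all_countable[THEN iffD2], rule allI)
  fix t
  define w where "w s \<omega> = v s \<omega> - \<mu>" for s \<omega>
  have [measurable]: "w s \<in> borel_measurable M" for s unfolding w_def by measurable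
  define c where "c N i = (if i \<le> N then impulse p \<beta> (N - i) else 0)" for N i :: nat
  define rem where "rem N \<omega> = (\<Sum>j=1..p. \<beta> j * (\<Sum>i<j. c N i * w (t - int N + int i - int j) \<omega>))" for N \<omega>
  \<comment> \<open>\<open>v\<close> is given without a moment bound, so the remainder is measured
    by a bounded subadditive functional that metrizes convergence in probability.\<close>
  define m1 where "m1 u = min 1 \<bar>u\<bar>" for u :: real
  have m1_meas[measurable]: "m1 \<in> borel_measurable borel" unfolding m1_def by measurable
  have m1_add: "m1 (a + b) \<le> m1 a + m1 b" for a b by (auto simp: m1_def)
  have m1_sum: "m1 (\<Sum>i\<in>I. f i) \<le> (\<Sum>i\<in>I. m1 (f i))" if "finite I" for I :: "nat set" and f
    using that
  proof (induction I rule: finite_induct)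
    case empty then show ?case by (simp add: m1_def)
  next
    case (insert i I)
    then show ?case using m1_add[of "f i" "sum f I"] by simp
  qed
  have m1_bd: "norm (m1 u) \<le> 1" for u by (auto simp: m1_def)
  have rec: "AE \<omega> in M. \<forall>s. w s \<omega> = (\<Sum>j=1..p. \<beta> j * w (s - int j) \<omega>) + \<epsilon> s \<omega>"
  proof (rule AE_all_countable[THEN iffD2], rule allI)
    fix s
    show "AE \<omega> in M. w s \<omega> = (\<Sum>j=1..p. \<beta> j * w (s - int j) \<omega>) + \<epsilon> s \<omega>"
      using recursion[of s]
      by eventually_elim (simp add: w_def mu right_diff_distrib sum_subtractf sum_distrib_right left_diff_distrib)
  qed
  have c0: "(\<lambda>N. c N i) \<longlonglongrightarrow> 0" for i
  proof -
    have "impulse p \<beta> \<longlonglongrightarrow> 0"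
      using summable_LIMSEQ_zero[OF summable_impulse[OF stable]] by (simp add: tendsto_rabs_zero_iff)
    then have "(\<lambda>N. impulse p \<beta> (N + i - i)) \<longlonglongrightarrow> 0"
      by simp
    then have "(\<lambda>N. impulse p \<beta> (N - i)) \<longlonglongrightarrow> 0"
      by (rule LIMSEQ_offset[where k=i])
    moreover have "\<forall>\<^sub>F N in sequentially. impulse p \<beta> (N - i) = c N i"
      using eventually_ge_at_top[of i] by eventually_elim (simp add: c_def)
    ultimately show ?thesis by (rule Lim_transform_eventually)
  qed
  have stat: "expectation (\<lambda>\<omega>. m1 (a * w s \<omega>)) = expectation (\<lambda>\<omega>. m1 (a * w 0 \<omega>))" for a s
    using stationary_expectation[of "\<lambda>u. m1 (a * (u - \<mu>))" s] by (simp add: w_def)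
  have rem0: "(\<lambda>N. expectation (\<lambda>\<omega>. m1 (rem N \<omega>))) \<longlonglongrightarrow> 0"
  proof (rule tendsto_sandwich[OF _ _ tendsto_const])
    show "\<forall>\<^sub>F N in sequentially. 0 \<le> expectation (\<lambda>\<omega>. m1 (rem N \<omega>))"
      by (intro always_eventually allI Bochner_Integration.integral_nonneg) (simp add: m1_def)
    have int: "integrable M (\<lambda>\<omega>. m1 (f \<omega>))" if "f \<in> borel_measurable M" for f
      using that m1_bd by (intro integrable_const_bound[of _ 1]) auto
    show "\<forall>\<^sub>F N in sequentially. expectation (\<lambda>\<omega>. m1 (rem N \<omega>))
        \<le> (\<Sum>j=1..p. \<Sum>i<j. expectation (\<lambda>\<omega>. m1 ((\<beta> j * c N i) * w 0 \<omega>)))"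
    proof (intro always_eventually allI)
      fix N
      have "expectation (\<lambda>\<omega>. m1 (rem N \<omega>))
        \<le> expectation (\<lambda>\<omega>. \<Sum>j=1..p. \<Sum>i<j. m1 ((\<beta> j * c N i) * w (t - int N + int i - int j) \<omega>))"
      proof (intro integral_mono int Bochner_Integration.integrable_sum)
        fix \<omega>
        have "m1 (rem N \<omega>) \<le> (\<Sum>j=1..p. m1 (\<beta> j * (\<Sum>i<j. c N i * w (t - int N + int i - int j) \<omega>)))"
          unfolding rem_def by (rule m1_sum) simp
        also have "\<dots> \<le> (\<Sum>j=1..p. \<Sum>i<j. m1 ((\<beta> j * c N i) * w (t - int N + int i - int j) \<omega>))"
        proof (rule sum_mono)
          fix j
          show "m1 (\<beta> j * (\<Sum>i<j. c N i * w (t - int N + int i - int j) \<omega>))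
             \<le> (\<Sum>i<j. m1 ((\<beta> j * c N i) * w (t - int N + int i - int j) \<omega>))"
            unfolding sum_distrib_left mult.assoc by (rule m1_sum) simp
        qed
        finally show "m1 (rem N \<omega>) \<le> (\<Sum>j=1..p. \<Sum>i<j. m1 ((\<beta> j * c N i) * w (t - int N + int i - int j) \<omega>))" .
      qed (auto simp: rem_def)
      also have "\<dots> = (\<Sum>j=1..p. \<Sum>i<j. expectation (\<lambda>\<omega>. m1 ((\<beta> j * c N i) * w (t - int N + int i - int j) \<omega>)))"
      proof (subst Bochner_Integration.integral_sum)
        show "integrable M (\<lambda>\<omega>. \<Sum>i<j. m1 ((\<beta> j * c N i) * w (t - int N + int i - int j) \<omega>))" for j
          by (intro Bochner_Integration.integrable_sum int) measurable
        show "(\<Sum>j=1..p. expectation (\<lambda>\<omega>. \<Sum>i<j. m1 ((\<beta> j * c N i) * w (t - int N + int i - int j) \<omega>)))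
          = (\<Sum>j=1..p. \<Sum>i<j. expectation (\<lambda>\<omega>. m1 ((\<beta> j * c N i) * w (t - int N + int i - int j) \<omega>)))"
          by (intro sum.cong refl Bochner_Integration.integral_sum int) measurable
      qed
      finally show "expectation (\<lambda>\<omega>. m1 (rem N \<omega>)) \<le> (\<Sum>j=1..p. \<Sum>i<j. expectation (\<lambda>\<omega>. m1 ((\<beta> j * c N i) * w 0 \<omega>)))"
        unfolding stat[of _ "t - int N + int i - int j" for i j] .
    qed
    have "(\<lambda>N. expectation (\<lambda>\<omega>. m1 ((\<beta> j * c N i) * w 0 \<omega>))) \<longlonglongrightarrow> expectation (\<lambda>\<omega>. 0)" for i j
    proof (rule integral_dominated_convergence[where w="\<lambda>_. 1"])
      show "AE \<omega> in M. (\<lambda>N. m1 (\<beta> j * c N i * w 0 \<omega>)) \<longlonglongrightarrow> 0"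
      proof (rule AE_I2)
        fix \<omega>
        have "(\<lambda>N. m1 (\<beta> j * c N i * w 0 \<omega>)) \<longlonglongrightarrow> min 1 \<bar>\<beta> j * 0 * w 0 \<omega>\<bar>"
          unfolding m1_def by (intro tendsto_intros c0)
        then show "(\<lambda>N. m1 (\<beta> j * c N i * w 0 \<omega>)) \<longlonglongrightarrow> 0" by simp
      qed
    qed (use m1_bd in auto)
    then have "(\<lambda>N. \<Sum>j=1..p. \<Sum>i<j. expectation (\<lambda>\<omega>. m1 ((\<beta> j * c N i) * w 0 \<omega>))) \<longlonglongrightarrow> (\<Sum>j=1..p. \<Sum>i<j. expectation (\<lambda>\<omega>. 0))"
      by (intro tendsto_sum)
    then show "(\<lambda>N. \<Sum>j=1..p. \<Sum>i<j. expectation (\<lambda>\<omega>. m1 ((\<beta> j * c N i) * w 0 \<omega>))) \<longlonglongrightarrow> 0" by simp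
  qed
  have rem_meas: "(\<lambda>\<omega>. m1 (rem N \<omega>)) \<in> borel_measurable M" for N
    unfolding rem_def by measurable
  have lim_meas: "(\<lambda>\<omega>. m1 (w t \<omega> - ma t \<omega>)) \<in> borel_measurable M"
    by measurable
  have "(\<lambda>N. expectation (\<lambda>\<omega>. m1 (rem N \<omega>))) \<longlonglongrightarrow> expectation (\<lambda>\<omega>. m1 (w t \<omega> - ma t \<omega>))"
  proof (rule integral_dominated_convergence[OF lim_meas rem_meas, where w="\<lambda>_. 1"])
    show "AE \<omega> in M. (\<lambda>N. m1 (rem N \<omega>)) \<longlonglongrightarrow> m1 (w t \<omega> - ma t \<omega>)"
      using rec AE_summable_ma[of t]
    proof eventually_elim
      case (elim \<omega>)
      have "rem N \<omega> = w t \<omega> - (\<Sum>k\<le>N. impulse p \<beta> k * \<epsilon> (t - int k) \<omega>)" for N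
        using impulse_expand[of "\<lambda>s. w s \<omega>" \<beta> p "\<lambda>s. \<epsilon> s \<omega>" t N, OF elim(1)[rule_format]]
        unfolding rem_def c_def by linarith
      moreover have "(\<lambda>N. \<Sum>k\<le>N. impulse p \<beta> k * \<epsilon> (t - int k) \<omega>) \<longlonglongrightarrow> ma t \<omega>"
        unfolding ma_def by (rule summable_LIMSEQ'[OF summable_rabs_cancel[OF elim(2)]])
      ultimately have "(\<lambda>N. rem N \<omega>) \<longlonglongrightarrow> w t \<omega> - ma t \<omega>"
        by (simp add: tendsto_diff)
      then show ?case unfolding m1_def by (intro tendsto_intros)
    qed
  qed (use m1_bd in auto)
  then have "expectation (\<lambda>\<omega>. m1 (w t \<omega> - ma t \<omega>)) = 0"
    using rem0 LIMSEQ_unique by blast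
  moreover have "integrable M (\<lambda>\<omega>. m1 (w t \<omega> - ma t \<omega>))"
    using m1_bd by (intro integrable_const_bound[of _ 1]) auto
  ultimately have "AE \<omega> in M. m1 (w t \<omega> - ma t \<omega>) = 0"
    by (subst (asm) integral_nonneg_eq_0_iff_AE) (auto simp: m1_def)
  then show "AE \<omega> in M. v t \<omega> = \<mu> + ma t \<omega>"
    by eventually_elim (auto simp: m1_def w_def min_def split: if_splits)
qed

end

end

section \<open>Expansion of the residual empirical process\<close>

definition ar_coeff :: "(nat \<Rightarrow> real) \<Rightarrow> nat \<Rightarrow> real" where
  "ar_coeff \<beta> = \<beta>(0 := -1)"

text \<open>The ingredients of the residual process as functions of a configuration
  \<open>c :: nat \<times> int \<Rightarrow> real\<close> of the driving noise: \<open>c (0, t)\<close> is the innovation, \<open>c (1, t)\<close> the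
  switch and \<open>c (2, t)\<close> the outlier at time \<open>t\<close>.\<close>

definition cfg_ma :: "nat \<Rightarrow> (nat \<Rightarrow> real) \<Rightarrow> int \<Rightarrow> (nat \<times> int \<Rightarrow> real) \<Rightarrow> real" where
  "cfg_ma p \<beta> t c = (\<Sum>k. impulse p \<beta> k * c (0, t - int k))"

definition cfg_outlier :: "int \<Rightarrow> (nat \<times> int \<Rightarrow> real) \<Rightarrow> real" where
  "cfg_outlier t c = c (1, t) * c (2, t)"

definition cfg_shift :: "nat \<Rightarrow> (nat \<Rightarrow> real) \<Rightarrow> int \<Rightarrow> (nat \<times> int \<Rightarrow> real) \<Rightarrow> real" where
  "cfg_shift p \<beta> t c = (\<Sum>j\<le>p. ar_coeff \<beta> j * cfg_outlier (t - int j) c)"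

definition cfg_clean :: "nat \<Rightarrow> (nat \<Rightarrow> real) \<Rightarrow> int \<Rightarrow> nat \<Rightarrow> (nat \<times> int \<Rightarrow> real) \<Rightarrow> real" where
  "cfg_clean p \<beta> t j c = (if j = 0 then 1 else cfg_ma p \<beta> (t - int j) c)"

definition cfg_reg :: "nat \<Rightarrow> (nat \<Rightarrow> real) \<Rightarrow> int \<Rightarrow> nat \<Rightarrow> (nat \<times> int \<Rightarrow> real) \<Rightarrow> real" where
  "cfg_reg p \<beta> t j c = (if j = 0 then 1 else cfg_ma p \<beta> (t - int j) c + cfg_outlier (t - int j) c)"

definition cfg_drift :: "nat \<Rightarrow> (nat \<Rightarrow> real) \<Rightarrow> (nat \<Rightarrow> real) \<Rightarrow> real \<Rightarrow> int \<Rightarrow> (nat \<times> int \<Rightarrow> real) \<Rightarrow> real" where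
  "cfg_drift p \<beta> s \<kappa> t c = (\<Sum>j\<le>p. s j * cfg_clean p \<beta> t j c) + \<kappa> * (\<Sum>j\<le>p. \<bar>cfg_clean p \<beta> t j c\<bar>)"

text \<open>A residual is the innovation minus this quantity, with \<open>r\<close> the inverse root
  of the sample size and \<open>\<kappa> = 0\<close>. A nonzero \<open>\<kappa>\<close> adds a
  multiple of the total size of the regressors, the room needed to enclose random coefficients
  between deterministic ones.\<close>

definition cfg_perturb :: "nat \<Rightarrow> (nat \<Rightarrow> real) \<Rightarrow> real \<Rightarrow> (nat \<Rightarrow> real) \<Rightarrow> real \<Rightarrow> int \<Rightarrow> (nat \<times> int \<Rightarrow> real) \<Rightarrow> real" where
  "cfg_perturb p \<beta> r s \<kappa> t c = cfg_shift p \<beta> t c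
     + r * ((\<Sum>j\<le>p. s j * cfg_reg p \<beta> t j c) + \<kappa> * (\<Sum>j\<le>p. \<bar>cfg_reg p \<beta> t j c\<bar>))"

definition past_index :: "int \<Rightarrow> (nat \<times> int) set" where
  "past_index t = {0} \<times> {..<t} \<union> {1, 2} \<times> UNIV"

lemma cfg_ma_measurable:
  assumes "\<And>s. s \<le> t \<Longrightarrow> (\<lambda>x. f x (0, s)) \<in> borel_measurable N"
  shows "(\<lambda>x. cfg_ma p \<beta> t (f x)) \<in> borel_measurable N"
  unfolding cfg_ma_def using assms by (intro borel_measurable_suminf borel_measurable_times borel_measurable_const) auto

lemma cfg_perturb_measurable:
  assumes "\<And>j. j \<in> past_index t \<Longrightarrow> (\<lambda>x. f x j) \<in> borel_measurable N"
  shows "(\<lambda>x. cfg_perturb p \<beta> r s \<kappa> t (f x)) \<in> borel_measurable N"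
proof -
  have [measurable]: "(\<lambda>x. cfg_ma p \<beta> (t - int j) (f x)) \<in> borel_measurable N" if "j > 0" for j
    using that by (intro cfg_ma_measurable assms) (auto simp: past_index_def)
  have [measurable]: "(\<lambda>x. f x (1, t')) \<in> borel_measurable N" "(\<lambda>x. f x (2, t')) \<in> borel_measurable N" for t'
    using assms by (auto simp: past_index_def)
  have [measurable]: "(\<lambda>x. cfg_outlier t' (f x)) \<in> borel_measurable N" for t'
    unfolding cfg_outlier_def by measurable
  have [measurable]: "(\<lambda>x. cfg_reg p \<beta> t j (f x)) \<in> borel_measurable N" for j
    unfolding cfg_reg_def by (cases "j = 0") auto
  show ?thesis
    unfolding cfg_perturb_def cfg_shift_def by measurable
qed

lemma cfg_ma_restrict:
  "(\<And>s. s \<le> t \<Longrightarrow> (0, s) \<in> J) \<Longrightarrow> cfg_ma p \<beta> t (restrict c J) = cfg_ma p \<beta> t c"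
  by (simp add: cfg_ma_def)

lemma cfg_perturb_restrict:
  assumes "past_index t \<subseteq> J"
  shows "cfg_perturb p \<beta> r s \<kappa> t (restrict c J) = cfg_perturb p \<beta> r s \<kappa> t c"
proof -
  have "cfg_outlier t' (restrict c J) = cfg_outlier t' c" for t'
    using assms by (auto simp: cfg_outlier_def past_index_def)
  moreover have "cfg_ma p \<beta> (t - int j) (restrict c J) = cfg_ma p \<beta> (t - int j) c" if "j > 0" for j
    using assms that by (intro cfg_ma_restrict) (auto simp: past_index_def)
  ultimately show ?thesis
    by (simp add: cfg_perturb_def cfg_shift_def cfg_reg_def cong: if_cong)
qed

lemma past_index_mono: "s \<le> t \<Longrightarrow> past_index s \<subseteq> past_index t"
  by (auto simp: past_index_def)

lemma min_one_sum_le: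
  fixes f :: "'i \<Rightarrow> real"
  assumes "finite I" "\<And>i. i \<in> I \<Longrightarrow> 0 \<le> f i"
  shows "min 1 (\<Sum>i\<in>I. f i) \<le> (\<Sum>i\<in>I. min 1 (f i))"
  using assms
proof (induction I rule: finite_induct)
  case (insert i I)
  have "min 1 (u + w) \<le> min 1 u + min 1 w" if "0 \<le> u" "0 \<le> w" for u w :: real
    using that by (auto simp: min_def)
  moreover have "0 \<le> sum f I" using insert by (intro sum_nonneg) auto
  ultimately have "min 1 (f i + sum f I) \<le> min 1 (f i) + min 1 (sum f I)" using insert by simp
  then show ?case using insert by simp
qed simp

section \<open>Level functions and integration over a single innovation\<close>

definition level :: "real \<Rightarrow> real \<Rightarrow> real" where
  "level x e = of_bool (e \<le> x)"

lemma level_measurable [measurable]: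
  assumes [measurable]: "f \<in> borel_measurable N" "g \<in> borel_measurable N"
  shows "(\<lambda>x. level (f x) (g x)) \<in> borel_measurable N"
  unfolding level_def by measurable

lemma level_bd: "0 \<le> level x e" "level x e \<le> 1" "\<bar>level y e - level x e\<bar> \<le> 1"
  by (auto simp: level_def)

text \<open>\<open>a\<close> plays the density of \<open>A\<close>. Smoothness is kept in the form
  of two inequalities, since these survive mixtures with the same constants and thus hold uniformly
  along a sequence of models.\<close>

locale smooth_contaminated_ar = contaminated_ar +
  fixes a :: "real \<Rightarrow> real" and K1 K2 :: real
  assumes stable: "ar_stable p \<beta>"
    and lipschitz: "\<And>x y. \<bar>A y - A x\<bar> \<le> K1 * \<bar>y - x\<bar>"
    and taylor: "\<And>x h. \<bar>A (x + h) - A x - a x * h\<bar> \<le> K2 * h\<^sup>2"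
begin

abbreviation cfg :: "'a \<Rightarrow> nat \<times> int \<Rightarrow> real" where "cfg \<omega> \<equiv> (\<lambda>j. noise j \<omega>)"

sublocale innov: real_distribution innov_law
  by (rule real_distribution_innov)

lemma cdf_innov: "cdf innov_law = A"
  by (rule innov_cdf)

lemma A_range: "0 \<le> A u" "A u \<le> 1"
  using innov.cdf_nonneg[of u] innov.cdf_bounded_prob[of u] by (simp_all add: cdf_innov)

lemma A_diff_le_1: "\<bar>A y - A x\<bar> \<le> 1"
  using A_range[of x] A_range[of y] by linarith

lemma K_nonneg: "0 \<le> K1" "0 \<le> K2"
  using lipschitz[of 1 0] taylor[of 0 1] by (auto intro: order_trans[OF abs_ge_zero])

lemma A_measurable [measurable]: "A \<in> borel_measurable borel"
  using borel_measurable_mono[of A] innov.cdf_nondecreasing by (auto simp: cdf_innov monoI)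

lemma q_range: "0 \<le> q" "q \<le> 1"
  using switch_1[of 0] by (auto simp flip: switch_1[of 0])

lemma past_index_subset: "past_index t \<subseteq> noise_index"
  by (auto simp: past_index_def)

lemma cfg_ma: "cfg_ma p \<beta> t (cfg \<omega>) = ma t \<omega>"
  by (simp add: cfg_ma_def ma_def)

lemma perturb_measurable [measurable]: "(\<lambda>\<omega>. cfg_perturb p \<beta> r s \<kappa> t (cfg \<omega>)) \<in> borel_measurable M"
  by (rule cfg_perturb_measurable) (use noise_measurable past_index_subset in blast)

lemma perturb_measurable_PiM:
  "past_index s \<subseteq> J \<Longrightarrow> (\<lambda>c. cfg_perturb p \<beta> r u \<kappa> s c) \<in> borel_measurable (PiM J (\<lambda>_. borel))"
  by (rule cfg_perturb_measurable) (auto intro: measurable_component_singleton)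

text \<open>The innovation at time \<open>t\<close> is independent of the coordinates in
  \<open>past_index t\<close>, so it may be averaged with the configuration frozen. The restriction
  hypothesis says that \<open>h\<close> reads its configuration only at those coordinates.\<close>

lemma expectation_past:
  fixes h :: "real \<Rightarrow> (nat \<times> int \<Rightarrow> real) \<Rightarrow> real"
  assumes h: "(\<lambda>(e, c). h e c) \<in> borel_measurable (borel \<Otimes>\<^sub>M PiM (past_index t) (\<lambda>_. borel))"
    and bd: "\<And>e c. \<bar>h e c\<bar> \<le> B"
    and restr: "\<And>e c. h e (restrict c (past_index t)) = h e c"
  shows "expectation (\<lambda>\<omega>. h (\<epsilon> t \<omega>) (cfg \<omega>)) = expectation (\<lambda>\<omega>. \<integral>e. h e (cfg \<omega>) \<partial>innov_law)"
proof -
  let ?S = "PiM {(0::nat, t)} (\<lambda>_. borel)" and ?T = "PiM (past_index t) (\<lambda>_. borel)"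
  let ?X = "\<lambda>\<omega>. restrict (cfg \<omega>) {(0, t)}" and ?Y = "\<lambda>\<omega>. restrict (cfg \<omega>) (past_index t)"
  have ind: "indep_var ?S ?X ?T ?Y"
    using noise_indep by (rule indep_var_restrict) (auto simp: past_index_def)
  have [measurable]: "?X \<in> measurable M ?S"
    using ind by (rule indep_var_rv1)
  have m: "(\<lambda>(u, c). h (u (0, t)) c) \<in> borel_measurable (?S \<Otimes>\<^sub>M ?T)"
  proof -
    have "(\<lambda>x. (fst x (0, t), snd x)) \<in> measurable (?S \<Otimes>\<^sub>M ?T) (borel \<Otimes>\<^sub>M ?T)"
      by (intro measurable_Pair measurable_compose[OF measurable_fst] measurable_component_singleton measurable_snd) simp
    from measurable_compose[OF this h] show ?thesis by (simp add: split_beta)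
  qed
  have "expectation (\<lambda>\<omega>. h (\<epsilon> t \<omega>) (cfg \<omega>)) = expectation (\<lambda>\<omega>. (\<lambda>(u, c). h (u (0, t)) c) (?X \<omega>, ?Y \<omega>))"
    by (simp add: restr)
  also have "\<dots> = expectation (\<lambda>\<omega>. \<integral>u. (\<lambda>(u, c). h (u (0, t)) c) (u, ?Y \<omega>) \<partial>distr M ?S ?X)"
    using bd by (intro expectation_indep_var[OF ind m, of B]) auto
  also have "\<dots> = expectation (\<lambda>\<omega>. \<integral>u. h (u (0, t)) (cfg \<omega>) \<partial>distr M ?S ?X)"
    by (simp add: restr)
  also have "\<dots> = expectation (\<lambda>\<omega>. \<integral>e. h e (cfg \<omega>) \<partial>innov_law)"
  proof (intro Bochner_Integration.integral_cong[OF refl])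
    fix \<omega> assume \<omega>: "\<omega> \<in> space M"
    have hm: "(\<lambda>e. h e (cfg \<omega>)) \<in> borel_measurable borel"
    proof -
      have "?Y \<omega> \<in> space ?T" by (simp add: space_PiM)
      then have "(\<lambda>e. (e, ?Y \<omega>)) \<in> measurable borel (borel \<Otimes>\<^sub>M ?T)" by measurable
      from measurable_compose[OF this h] show ?thesis by (simp add: restr)
    qed
    have "(\<integral>u. h (u (0, t)) (cfg \<omega>) \<partial>distr M ?S ?X) = expectation (\<lambda>\<omega>'. h (\<epsilon> t \<omega>') (cfg \<omega>))"
    proof (subst integral_distr)
      have "(\<lambda>u. u (0, t)) \<in> measurable ?S borel"
        by (rule measurable_component_singleton) simp
      from measurable_compose[OF this hm] show "(\<lambda>u. h (u (0, t)) (cfg \<omega>)) \<in> borel_measurable ?S" .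
    qed auto
    also have "\<dots> = (\<integral>e. h e (cfg \<omega>) \<partial>innov_law)"
      unfolding innov_law[of t, symmetric] using hm by (subst integral_distr) auto
    finally show "(\<integral>u. h (u (0, t)) (cfg \<omega>) \<partial>distr M ?S ?X) = (\<integral>e. h e (cfg \<omega>) \<partial>innov_law)" .
  qed
  finally show ?thesis .
qed

lemma expectation_disjoint:
  fixes f g :: "(nat \<times> int \<Rightarrow> real) \<Rightarrow> real"
  assumes J: "J1 \<inter> J2 = {}" "J1 \<subseteq> noise_index" "J2 \<subseteq> noise_index"
    and f: "f \<in> borel_measurable (PiM J1 (\<lambda>_. borel))" "\<And>c. f (restrict c J1) = f c"
    and g: "g \<in> borel_measurable (PiM J2 (\<lambda>_. borel))" "\<And>c. g (restrict c J2) = g c"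
    and int: "integrable M (\<lambda>\<omega>. f (cfg \<omega>))" "integrable M (\<lambda>\<omega>. g (cfg \<omega>))"
  shows "expectation (\<lambda>\<omega>. f (cfg \<omega>) * g (cfg \<omega>)) = expectation (\<lambda>\<omega>. f (cfg \<omega>)) * expectation (\<lambda>\<omega>. g (cfg \<omega>))"
    and "integrable M (\<lambda>\<omega>. f (cfg \<omega>) * g (cfg \<omega>))"
proof -
  have "indep_var borel (f \<circ> (\<lambda>\<omega>. restrict (cfg \<omega>) J1)) borel (g \<circ> (\<lambda>\<omega>. restrict (cfg \<omega>) J2))"
    by (rule indep_var_compose[OF indep_var_restrict[OF noise_indep J] f(1) g(1)])
  then have "indep_var borel (\<lambda>\<omega>. f (cfg \<omega>)) borel (\<lambda>\<omega>. g (cfg \<omega>))"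
    by (simp add: comp_def f(2) g(2))
  from indep_var_lebesgue_integral[OF this int] indep_var_integrable[OF this int]
  show "expectation (\<lambda>\<omega>. f (cfg \<omega>) * g (cfg \<omega>)) = expectation (\<lambda>\<omega>. f (cfg \<omega>)) * expectation (\<lambda>\<omega>. g (cfg \<omega>))"
    and "integrable M (\<lambda>\<omega>. f (cfg \<omega>) * g (cfg \<omega>))" .
qed

lemma integral_level: "(\<integral>e. level x e \<partial>innov_law) = A x"
proof -
  have "(\<integral>e. level x e \<partial>innov_law) = (\<integral>e. indicator {..x} e \<partial>innov_law)"
    by (intro Bochner_Integration.integral_cong) (auto simp: level_def indicator_def)
  also have "\<dots> = cdf innov_law x" by (simp add: cdf_def)
  finally show ?thesis by (simp add: cdf_innov)
qed

lemma integrable_level: "integrable innov_law (level x)"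
  using level_bd by (intro innov.integrable_const_bound[of _ 1]) auto

lemma integral_level_diff: "(\<integral>e. \<bar>level y e - level x e\<bar> \<partial>innov_law) = \<bar>A y - A x\<bar>"
proof -
  have *: "(\<integral>e. \<bar>level y e - level x e\<bar> \<partial>innov_law) = \<bar>A y - A x\<bar>" if "x \<le> y" for x y
  proof -
    have le: "level x e \<le> level y e" for e using that by (auto simp: level_def)
    then have "(\<integral>e. \<bar>level y e - level x e\<bar> \<partial>innov_law) = (\<integral>e. level y e - level x e \<partial>innov_law)"
      by (intro Bochner_Integration.integral_cong) auto
    also have "\<dots> = A y - A x"
      using integrable_level by (simp add: integral_level)
    moreover have "A x \<le> A y"
      using innov.cdf_nondecreasing[OF that] by (simp add: cdf_innov)
    ultimately show ?thesis by simp
  qed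
  show ?thesis
  proof (cases "x \<le> y")
    case False
    then show ?thesis using *[of y x] by (simp add: abs_minus_commute)
  qed (rule *)
qed

section \<open>Moments of the regressors and frequencies of the switches\<close>

definition lead :: "int \<Rightarrow> (nat \<times> int \<Rightarrow> real) \<Rightarrow> real" where
  "lead t c = (\<Sum>j\<le>p. \<bar>cfg_clean p \<beta> t j c\<bar>)"

text \<open>Tests for a nonzero switch, not for the value one. A vanishing indicator then forces
  \<open>cfg_outlier t c\<close> to vanish for every configuration, and the bounds on increments of
  \<open>A\<close> hold without exceptional sets.\<close>

definition switched :: "int \<Rightarrow> (nat \<times> int \<Rightarrow> real) \<Rightarrow> real" where
  "switched t c = of_bool (c (1, t) \<noteq> 0)"

lemma lead_nonneg: "0 \<le> lead t c" and switched_nonneg: "0 \<le> switched t c"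
  by (auto simp: lead_def switched_def sum_nonneg)

lemma AE_z: "AE \<omega> in M. z t \<omega> = 0 \<or> z t \<omega> = 1"
proof -
  have "prob {\<omega>\<in>space M. z t \<omega> = 0 \<or> z t \<omega> = 1} = prob ({\<omega>\<in>space M. z t \<omega> = 0} \<union> {\<omega>\<in>space M. z t \<omega> = 1})"
    by (rule arg_cong[where f=prob]) auto
  also have "\<dots> = prob {\<omega>\<in>space M. z t \<omega> = 0} + prob {\<omega>\<in>space M. z t \<omega> = 1}"
    by (rule finite_measure_Union) auto
  also have "\<dots> = 1" by (simp add: switch_0 switch_1)
  finally show ?thesis by (subst (asm) prob_Collect_eq_1) auto
qed

lemma switched_cfg: "switched t (cfg \<omega>) = of_bool (z t \<omega> \<noteq> 0)"
  by (simp add: switched_def)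

lemma integrable_switched: "integrable M (\<lambda>\<omega>. switched t (cfg \<omega>))"
  by (intro integrable_const_bound[of _ 1]) (auto simp: switched_cfg)

lemma expectation_switched: "expectation (\<lambda>\<omega>. switched t (cfg \<omega>)) = q"
proof -
  have "expectation (\<lambda>\<omega>. switched t (cfg \<omega>)) = expectation (indicator {\<omega>\<in>space M. z t \<omega> \<noteq> 0})"
    by (intro Bochner_Integration.integral_cong) (auto simp: switched_cfg indicator_def)
  also have "\<dots> = prob (space M - {\<omega>\<in>space M. z t \<omega> = 0})"
    by (simp add: Int_absorb2) (auto intro!: arg_cong[where f=prob])
  also have "\<dots> = q" by (subst prob_compl) (auto simp: switch_0)
  finally show ?thesis .
qed

lemma switched_measurable_PiM:
  "(1, t) \<in> J \<Longrightarrow> switched t \<in> borel_measurable (PiM J (\<lambda>_. borel))"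
proof -
  assume "(1, t) \<in> J"
  note [measurable] = measurable_component_singleton[OF this, of "\<lambda>_. borel"]
  have "(\<lambda>c. switched t c) \<in> borel_measurable (PiM J (\<lambda>_. borel))"
    unfolding switched_def by measurable
  then show ?thesis by simp
qed

lemma expectation_switched_pair:
  assumes "t \<noteq> t'"
  shows "expectation (\<lambda>\<omega>. switched t (cfg \<omega>) * switched t' (cfg \<omega>)) = q\<^sup>2"
    and "integrable M (\<lambda>\<omega>. switched t (cfg \<omega>) * switched t' (cfg \<omega>))"
proof -
  note * = expectation_disjoint[of "{(1, t)}" "{(1, t')}" "switched t" "switched t'",
      OF _ _ _ switched_measurable_PiM _ switched_measurable_PiM _ integrable_switched integrable_switched]
  show "expectation (\<lambda>\<omega>. switched t (cfg \<omega>) * switched t' (cfg \<omega>)) = q\<^sup>2"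
    using assms by (subst *(1)) (auto simp: expectation_switched power2_eq_square, auto simp: switched_def)
  show "integrable M (\<lambda>\<omega>. switched t (cfg \<omega>) * switched t' (cfg \<omega>))"
    using assms by (intro *(2)) (auto simp: switched_def)
qed

lemma outlier_measurable [measurable]: "(\<lambda>\<omega>. cfg_outlier t (cfg \<omega>)) \<in> borel_measurable M"
  unfolding cfg_outlier_def by simp

text \<open>Since \<open>\<phi> 0 = 0\<close> and the switch is almost surely 0 or 1,
  \<open>\<phi>\<close> of the product equals the switch times \<open>\<phi>\<close> of the outlier.
  Boundedness of \<open>\<phi>\<close> makes this applicable to an outlier law without
  moments.\<close>

lemma expectation_outlier:
  fixes \<phi> :: "real \<Rightarrow> real"
  assumes [measurable]: "\<phi> \<in> borel_measurable borel" and bd: "\<And>u. \<bar>\<phi> u\<bar> \<le> 1" and \<phi>0: "\<phi> 0 = 0"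
  shows "expectation (\<lambda>\<omega>. \<phi> (cfg_outlier t (cfg \<omega>))) = q * (\<integral>u. \<phi> u \<partial>Q)"
proof -
  have "expectation (\<lambda>\<omega>. \<phi> (cfg_outlier t (cfg \<omega>))) = expectation (\<lambda>\<omega>. switched t (cfg \<omega>) * \<phi> (cfg \<omega> (2, t)))"
  proof (rule integral_cong_AE)
    show "AE \<omega> in M. \<phi> (cfg_outlier t (cfg \<omega>)) = switched t (cfg \<omega>) * \<phi> (cfg \<omega> (2, t))"
      using AE_z[of t] by eventually_elim (auto simp: cfg_outlier_def switched_cfg \<phi>0)
  qed (simp_all add: switched_cfg)
  also have "\<dots> = expectation (\<lambda>\<omega>. switched t (cfg \<omega>)) * expectation (\<lambda>\<omega>. \<phi> (cfg \<omega> (2, t)))"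
  proof (rule expectation_disjoint(1)[of "{(1, t)}" "{(2, t)}" "switched t" "\<lambda>c. \<phi> (c (2, t))"])
    show "switched t \<in> borel_measurable (PiM {(1, t)} (\<lambda>_. borel))"
      by (rule switched_measurable_PiM) simp
    have "(\<lambda>c. c (2, t)) \<in> measurable (PiM {(2, t)} (\<lambda>_. borel)) borel"
      by (rule measurable_component_singleton) simp
    from measurable_compose[OF this assms(1)]
    show "(\<lambda>c. \<phi> (c (2, t))) \<in> borel_measurable (PiM {(2, t)} (\<lambda>_. borel))" .
    show "integrable M (\<lambda>\<omega>. switched t (cfg \<omega>))" by (rule integrable_switched)
    show "integrable M (\<lambda>\<omega>. \<phi> (cfg \<omega> (2, t)))"
      using bd by (intro integrable_const_bound[of _ 1]) auto
  qed (auto simp: switched_def)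
  also have "expectation (\<lambda>\<omega>. \<phi> (cfg \<omega> (2, t))) = (\<integral>u. \<phi> u \<partial>Q)"
    unfolding outlier_law[of t, symmetric] by (subst integral_distr) auto
  finally show ?thesis by (simp add: expectation_switched)
qed

text \<open>Common bound for the second moments of all regressors, the summand 1 covering the
  constant one. Being at least 1, it also dominates its own square root and so serves for first
  moments.\<close>

definition moment :: real where
  "moment = 1 + gain\<^sup>2 * (\<integral>u. u\<^sup>2 \<partial>innov_law)"

lemma moment_ge_1: "1 \<le> moment"
  by (simp add: moment_def)

lemma clean_measurable [measurable]: "(\<lambda>\<omega>. cfg_clean p \<beta> t j (cfg \<omega>)) \<in> borel_measurable M"
  by (cases "j = 0") (simp_all add: cfg_clean_def cfg_ma)

lemma lead_measurable [measurable]: "(\<lambda>\<omega>. lead t (cfg \<omega>)) \<in> borel_measurable M"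
  unfolding lead_def by measurable

lemma clean_second_moment:
  "integrable M (\<lambda>\<omega>. (cfg_clean p \<beta> t j (cfg \<omega>))\<^sup>2)" "expectation (\<lambda>\<omega>. (cfg_clean p \<beta> t j (cfg \<omega>))\<^sup>2) \<le> moment"
  using ma_second_moment[OF stable, of "t - int j"] moment_ge_1
  by (cases "j = 0"; simp add: cfg_clean_def cfg_ma prob_space moment_def)+

lemma lead_second_moment:
  "integrable M (\<lambda>\<omega>. (lead t (cfg \<omega>))\<^sup>2)" "expectation (\<lambda>\<omega>. (lead t (cfg \<omega>))\<^sup>2) \<le> (real p + 1)\<^sup>2 * moment"
proof -
  have pt: "(lead t c)\<^sup>2 \<le> (real p + 1) * (\<Sum>j\<le>p. (cfg_clean p \<beta> t j c)\<^sup>2)" for c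
    using Cauchy_Schwarz_ineq_sum[of "\<lambda>_. 1" "\<lambda>j. \<bar>cfg_clean p \<beta> t j c\<bar>" "{..p}"] by (simp add: lead_def add.commute)
  have int: "integrable M (\<lambda>\<omega>. (real p + 1) * (\<Sum>j\<le>p. (cfg_clean p \<beta> t j (cfg \<omega>))\<^sup>2))"
    using clean_second_moment(1) by simp
  show sq: "integrable M (\<lambda>\<omega>. (lead t (cfg \<omega>))\<^sup>2)"
    using pt by (intro Bochner_Integration.integrable_bound[OF int]) (auto intro!: AE_I2 order_trans[OF _ abs_ge_self])
  have "expectation (\<lambda>\<omega>. (lead t (cfg \<omega>))\<^sup>2) \<le> expectation (\<lambda>\<omega>. (real p + 1) * (\<Sum>j\<le>p. (cfg_clean p \<beta> t j (cfg \<omega>))\<^sup>2))"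
    using pt sq int by (intro integral_mono)
  also have "\<dots> = (real p + 1) * (\<Sum>j\<le>p. expectation (\<lambda>\<omega>. (cfg_clean p \<beta> t j (cfg \<omega>))\<^sup>2))"
    using clean_second_moment(1) by simp
  also have "\<dots> \<le> (real p + 1) * (\<Sum>j\<le>p. moment)"
    using clean_second_moment(2) by (intro mult_left_mono sum_mono) auto
  finally show "expectation (\<lambda>\<omega>. (lead t (cfg \<omega>))\<^sup>2) \<le> (real p + 1)\<^sup>2 * moment"
    by (simp add: power2_eq_square algebra_simps)
qed

lemma lead_first_moment:
  "integrable M (\<lambda>\<omega>. lead t (cfg \<omega>))" "expectation (\<lambda>\<omega>. lead t (cfg \<omega>)) \<le> (real p + 1) * moment"
proof -
  show int: "integrable M (\<lambda>\<omega>. lead t (cfg \<omega>))"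
    using lead_measurable lead_second_moment(1) by (rule square_integrable_imp_integrable)
  have "expectation (\<lambda>\<omega>. \<bar>lead t (cfg \<omega>)\<bar>) \<le> sqrt (expectation (\<lambda>\<omega>. (lead t (cfg \<omega>))\<^sup>2))"
    using lead_measurable lead_second_moment(1) by (rule expectation_abs_le_sqrt)
  also have "\<dots> \<le> sqrt ((real p + 1)\<^sup>2 * moment)"
    by (intro real_sqrt_le_mono lead_second_moment)
  also have "\<dots> \<le> sqrt ((real p + 1)\<^sup>2 * moment\<^sup>2)"
    using moment_ge_1 by (intro real_sqrt_le_mono mult_left_mono) (auto simp: power2_eq_square)
  also have "\<dots> = (real p + 1) * moment"
    using moment_ge_1 by (simp add: real_sqrt_mult)
  finally show "expectation (\<lambda>\<omega>. lead t (cfg \<omega>)) \<le> (real p + 1) * moment"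
    by (simp add: lead_nonneg)
qed

text \<open>\<open>lead\<close> reads innovations only, so it is independent of every
  switch.\<close>

lemma expectation_switched_lead:
  "expectation (\<lambda>\<omega>. switched t' (cfg \<omega>) * lead t (cfg \<omega>)) \<le> q * ((real p + 1) * moment)"
  "integrable M (\<lambda>\<omega>. switched t' (cfg \<omega>) * lead t (cfg \<omega>))"
proof -
  have m: "lead t \<in> borel_measurable (PiM ({0} \<times> UNIV) (\<lambda>_. borel))"
  proof -
    have [measurable]: "(\<lambda>c. cfg_clean p \<beta> t j c) \<in> borel_measurable (PiM ({0} \<times> UNIV) (\<lambda>_. borel))" for j
      by (cases "j = 0") (auto simp: cfg_clean_def intro!: cfg_ma_measurable measurable_component_singleton)
    have "(\<lambda>c. lead t c) \<in> borel_measurable (PiM ({0} \<times> UNIV) (\<lambda>_. borel))"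
      unfolding lead_def by measurable
    then show ?thesis by simp
  qed
  have r': "lead t (restrict c ({0} \<times> UNIV)) = lead t c" for c
    by (simp add: lead_def cfg_clean_def cfg_ma_restrict cong: if_cong)
  have z': "switched t' (restrict c {(1, t')}) = switched t' c" for c
    by (simp add: switched_def)
  note * = expectation_disjoint[OF _ _ _ switched_measurable_PiM[OF singletonI] z' m r' integrable_switched lead_first_moment(1)]
  show "integrable M (\<lambda>\<omega>. switched t' (cfg \<omega>) * lead t (cfg \<omega>))"
    by (intro *(2)) auto
  have "expectation (\<lambda>\<omega>. switched t' (cfg \<omega>) * lead t (cfg \<omega>)) = q * expectation (\<lambda>\<omega>. lead t (cfg \<omega>))"
    by (subst *(1)) (auto simp: expectation_switched)
  also have "\<dots> \<le> q * ((real p + 1) * moment)"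
    using q_range lead_first_moment(2) by (intro mult_left_mono)
  finally show "expectation (\<lambda>\<omega>. switched t' (cfg \<omega>) * lead t (cfg \<omega>)) \<le> q * ((real p + 1) * moment)" .
qed

text \<open>Square root of a mean square: the factor 4 comes from \<open>fluct_square\<close>, the
  two summands from a switch in the window of \<open>p + 1\<close> times and from the clean
  drift.\<close>

definition fluct_bound :: "real \<Rightarrow> real \<Rightarrow> real" where
  "fluct_bound r C = sqrt (4 * ((real p + 1) * q + K1 * r * C * ((real p + 1) * moment)))"

definition taylor_bound :: "real \<Rightarrow> real \<Rightarrow> real" where
  "taylor_bound r C = K2 * r\<^sup>2 * (C\<^sup>2 * ((real p + 1)\<^sup>2 * moment))"

text \<open>One summand for each way in which the effects fail to superpose: the clean drift at a
  time with a switch in the window, the product of an estimation error with an outlier (truncated at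
  1), and two switches in one window.\<close>

definition outlier_bound :: "real \<Rightarrow> real \<Rightarrow> real" where
  "outlier_bound r C = (real p + 1) * (2 * K1 * r * C * (q * ((real p + 1) * moment)))
     + (real p + 1) * (q * (\<integral>u. min 1 (K1 * r * C * \<bar>u\<bar>) \<partial>Q)) + (real p + 2) * ((real p + 1) * (real p * q\<^sup>2))"

section \<open>Expansion for deterministic coefficients\<close>

context
  fixes r \<kappa> C x :: real and s :: "nat \<Rightarrow> real"
  assumes r: "0 \<le> r" and C: "\<And>j. j \<le> p \<Longrightarrow> \<bar>s j\<bar> + \<bar>\<kappa>\<bar> \<le> C"
begin

abbreviation "\<zeta> t c \<equiv> cfg_perturb p \<beta> r s \<kappa> t c"
abbreviation "drift t c \<equiv> cfg_drift p \<beta> s \<kappa> t c"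

definition fluct :: "int \<Rightarrow> real \<Rightarrow> (nat \<times> int \<Rightarrow> real) \<Rightarrow> real" where
  "fluct t e c = level (x + \<zeta> t c) e - level x e - (A (x + \<zeta> t c) - A x)"

text \<open>Change of the conditional distribution function caused by the outlier at lag
  \<open>j\<close> alone, as if the window were otherwise clean.\<close>

definition jump :: "int \<Rightarrow> nat \<Rightarrow> (nat \<times> int \<Rightarrow> real) \<Rightarrow> real" where
  "jump t j c = A (x + ar_coeff \<beta> j * cfg_outlier (t - int j) c) - A x"

lemma C_nonneg: "0 \<le> C"
  using C[of 0] by (auto intro: order_trans[rotated])

lemma fluct_bd: "\<bar>fluct t e c\<bar> \<le> 2"
  using level_bd(3)[of "x + \<zeta> t c" e x] A_diff_le_1[of "x + \<zeta> t c" x] unfolding fluct_def by linarith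

lemma fluct_measurable [measurable]: "(\<lambda>\<omega>. fluct t (\<epsilon> t \<omega>) (cfg \<omega>)) \<in> borel_measurable M"
  unfolding fluct_def by measurable

lemma fluct_restrict: "past_index t \<subseteq> J \<Longrightarrow> fluct t e (restrict c J) = fluct t e c"
  by (simp add: fluct_def cfg_perturb_restrict)

lemma fluct_integral: "(\<integral>e. fluct t e c \<partial>innov_law) = 0"
  unfolding fluct_def using integrable_level by (simp add: integral_level innov.prob_space[simplified])

text \<open>The factor at the earlier time, including its innovation, is a function of
  \<open>past_index t\<close>. Averaging over the innovation at \<open>t\<close> first kills the
  product, because \<open>fluct\<close> is compensated by its own conditional mean.\<close>

lemma fluct_orthogonal:
  assumes "t' < t"
  shows "expectation (\<lambda>\<omega>. fluct t' (\<epsilon> t' \<omega>) (cfg \<omega>) * fluct t (\<epsilon> t \<omega>) (cfg \<omega>)) = 0"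
proof -
  let ?h = "\<lambda>e c. fluct t' (c (0, t')) c * fluct t e c"
  have sub: "past_index t' \<subseteq> past_index t" "(0, t') \<in> past_index t"
    using assms past_index_mono[of t' t] by (auto simp: past_index_def)
  note [measurable] = perturb_measurable_PiM[OF subset_refl, where s=t and r=r and u=s and \<kappa>=\<kappa>] perturb_measurable_PiM[OF sub(1), where r=r and u=s and \<kappa>=\<kappa>]
    measurable_component_singleton[OF sub(2), of "\<lambda>_. borel"]
  have "expectation (\<lambda>\<omega>. ?h (\<epsilon> t \<omega>) (cfg \<omega>)) = expectation (\<lambda>\<omega>. \<integral>e. ?h e (cfg \<omega>) \<partial>innov_law)"
  proof (rule expectation_past)
    show "(\<lambda>(e, c). ?h e c) \<in> borel_measurable (borel \<Otimes>\<^sub>M PiM (past_index t) (\<lambda>_. borel))"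
      unfolding fluct_def split_beta by measurable
    show "\<bar>?h e c\<bar> \<le> 2 * 2" for e c
      unfolding abs_mult using fluct_bd by (intro mult_mono) auto
    show "?h e (restrict c (past_index t)) = ?h e c" for e c
      using sub by (simp add: fluct_restrict)
  qed
  then show ?thesis by (simp add: fluct_integral)
qed

text \<open>For two numbers in \<open>[-1, 1]\<close> the squared difference is at most twice the
  sum of the absolute values. The level increment and its compensator have equal mean absolute
  values by \<open>integral_level_diff\<close>, which gives the factor 4.\<close>

lemma fluct_square: "expectation (\<lambda>\<omega>. (fluct t (\<epsilon> t \<omega>) (cfg \<omega>))\<^sup>2) \<le> 4 * expectation (\<lambda>\<omega>. \<bar>A (x + \<zeta> t (cfg \<omega>)) - A x\<bar>)"
proof -
  let ?d = "\<lambda>e c. \<bar>level (x + \<zeta> t c) e - level x e\<bar>" and ?\<delta> = "\<lambda>c. \<bar>A (x + \<zeta> t c) - A x\<bar>"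
  note [measurable] = perturb_measurable_PiM[OF subset_refl, where s=t and r=r and u=s and \<kappa>=\<kappa>]
  have "expectation (\<lambda>\<omega>. ?d (\<epsilon> t \<omega>) (cfg \<omega>)) = expectation (\<lambda>\<omega>. \<integral>e. ?d e (cfg \<omega>) \<partial>innov_law)"
  proof (rule expectation_past)
    show "(\<lambda>(e, c). ?d e c) \<in> borel_measurable (borel \<Otimes>\<^sub>M PiM (past_index t) (\<lambda>_. borel))"
      unfolding split_beta by measurable
    show "\<bar>?d e c\<bar> \<le> 1" for e c using level_bd(3) by simp
    show "?d e (restrict c (past_index t)) = ?d e c" for e c
      by (simp add: cfg_perturb_restrict)
  qed
  then have d: "expectation (\<lambda>\<omega>. ?d (\<epsilon> t \<omega>) (cfg \<omega>)) = expectation (\<lambda>\<omega>. ?\<delta> (cfg \<omega>))"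
    by (simp only: integral_level_diff)
  have int: "integrable M (\<lambda>\<omega>. ?d (\<epsilon> t \<omega>) (cfg \<omega>))" "integrable M (\<lambda>\<omega>. ?\<delta> (cfg \<omega>))"
    using level_bd(3) A_diff_le_1 by (intro integrable_const_bound[of _ 1]; auto)+
  have "expectation (\<lambda>\<omega>. (fluct t (\<epsilon> t \<omega>) (cfg \<omega>))\<^sup>2) \<le> expectation (\<lambda>\<omega>. 2 * ?d (\<epsilon> t \<omega>) (cfg \<omega>) + 2 * ?\<delta> (cfg \<omega>))"
  proof (rule integral_mono)
    show "integrable M (\<lambda>\<omega>. (fluct t (\<epsilon> t \<omega>) (cfg \<omega>))\<^sup>2)"
    proof (rule integrable_const_bound[of _ "2\<^sup>2"])
      show "AE \<omega> in M. norm ((fluct t (\<epsilon> t \<omega>) (cfg \<omega>))\<^sup>2) \<le> 2\<^sup>2"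
        by (intro AE_I2) (use power_mono[OF fluct_bd abs_ge_zero, of _ _ _ 2] in simp)
    qed measurable
    show "integrable M (\<lambda>\<omega>. 2 * ?d (\<epsilon> t \<omega>) (cfg \<omega>) + 2 * ?\<delta> (cfg \<omega>))" using int by simp
    fix \<omega>
    have sq: "(u - v)\<^sup>2 \<le> 2 * \<bar>u\<bar> + 2 * \<bar>v\<bar>" if "\<bar>u\<bar> \<le> 1" "\<bar>v\<bar> \<le> 1" for u v :: real
    proof -
      have "(u - v)\<^sup>2 = \<bar>u - v\<bar> * \<bar>u - v\<bar>" by (simp add: power2_eq_square abs_mult_self_eq)
      also have "\<dots> \<le> 2 * (\<bar>u\<bar> + \<bar>v\<bar>)" using that by (intro mult_mono) auto
      finally show ?thesis by simp
    qed
    show "(fluct t (\<epsilon> t \<omega>) (cfg \<omega>))\<^sup>2 \<le> 2 * ?d (\<epsilon> t \<omega>) (cfg \<omega>) + 2 * ?\<delta> (cfg \<omega>)"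
      unfolding fluct_def using level_bd(3) A_diff_le_1 by (rule sq)
  qed
  also have "\<dots> = 4 * expectation (\<lambda>\<omega>. ?\<delta> (cfg \<omega>))"
    using int d by simp
  finally show ?thesis .
qed

lemma drift_bd: "\<bar>drift t c\<bar> \<le> C * lead t c"
proof -
  have "\<bar>drift t c\<bar> \<le> (\<Sum>j\<le>p. \<bar>s j\<bar> * \<bar>cfg_clean p \<beta> t j c\<bar>) + \<bar>\<kappa>\<bar> * lead t c"
    unfolding cfg_drift_def lead_def
    by (intro order_trans[OF abs_triangle_ineq] add_mono order_trans[OF sum_abs])
      (auto simp: abs_mult intro!: mult_left_mono sum_nonneg order_trans[OF abs_triangle_ineq])
  also have "\<dots> = (\<Sum>j\<le>p. (\<bar>s j\<bar> + \<bar>\<kappa>\<bar>) * \<bar>cfg_clean p \<beta> t j c\<bar>)"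
    unfolding lead_def by (simp add: sum_distrib_left sum.distrib algebra_simps)
  also have "\<dots> \<le> (\<Sum>j\<le>p. C * \<bar>cfg_clean p \<beta> t j c\<bar>)"
    using C by (intro sum_mono mult_right_mono) auto
  finally show ?thesis by (simp add: lead_def sum_distrib_left)
qed

lemma reg_bd: "\<bar>(\<Sum>j\<le>p. s j * cfg_reg p \<beta> t j c) + \<kappa> * (\<Sum>j\<le>p. \<bar>cfg_reg p \<beta> t j c\<bar>)\<bar>
    \<le> C * (lead t c + (\<Sum>j\<le>p. \<bar>cfg_outlier (t - int j) c\<bar>))"
proof -
  have "\<bar>(\<Sum>j\<le>p. s j * cfg_reg p \<beta> t j c) + \<kappa> * (\<Sum>j\<le>p. \<bar>cfg_reg p \<beta> t j c\<bar>)\<bar>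
    \<le> (\<Sum>j\<le>p. \<bar>s j\<bar> * \<bar>cfg_reg p \<beta> t j c\<bar>) + \<bar>\<kappa>\<bar> * (\<Sum>j\<le>p. \<bar>cfg_reg p \<beta> t j c\<bar>)"
    by (intro order_trans[OF abs_triangle_ineq] add_mono order_trans[OF sum_abs])
      (auto simp: abs_mult intro!: mult_left_mono sum_nonneg)
  also have "\<dots> = (\<Sum>j\<le>p. (\<bar>s j\<bar> + \<bar>\<kappa>\<bar>) * \<bar>cfg_reg p \<beta> t j c\<bar>)"
    by (simp add: sum_distrib_left sum.distrib algebra_simps)
  also have "\<dots> \<le> (\<Sum>j\<le>p. C * (\<bar>cfg_clean p \<beta> t j c\<bar> + \<bar>cfg_outlier (t - int j) c\<bar>))"
    using C C_nonneg by (intro sum_mono mult_mono) (auto simp: cfg_reg_def cfg_clean_def)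
  also have "\<dots> = C * (lead t c + (\<Sum>j\<le>p. \<bar>cfg_outlier (t - int j) c\<bar>))"
    by (simp add: lead_def sum_distrib_left sum.distrib distrib_left)
  finally show ?thesis .
qed

lemma perturb_unswitched:
  assumes "\<And>j. j \<le> p \<Longrightarrow> c (1, t - int j) = 0"
  shows "\<zeta> t c = r * drift t c"
proof -
  have "cfg_outlier (t - int j) c = 0" if "j \<le> p" for j
    using assms that by (simp add: cfg_outlier_def)
  then show ?thesis
    by (simp add: cfg_perturb_def cfg_shift_def cfg_drift_def cfg_reg_def cfg_clean_def cong: if_cong)
qed

lemma A_drift_bd: "\<bar>A (x + r * drift t c) - A x\<bar> \<le> K1 * r * C * lead t c"
proof -
  have "\<bar>A (x + r * drift t c) - A x\<bar> \<le> K1 * (r * \<bar>drift t c\<bar>)"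
    using lipschitz[of "x + r * drift t c" x] r by (simp add: abs_mult)
  also have "\<dots> \<le> K1 * (r * (C * lead t c))"
    using drift_bd K_nonneg r by (intro mult_left_mono) auto
  finally show ?thesis by (simp add: mult_ac)
qed

text \<open>If some switch in the window is on, the sum of indicators is at least 1 and dominates
  any increment of \<open>A\<close>; otherwise only the clean drift is left and the Lipschitz bound
  applies.\<close>

lemma A_perturb_bd:
  "\<bar>A (x + \<zeta> t c) - A x\<bar> \<le> (\<Sum>j\<le>p. switched (t - int j) c) + K1 * r * C * lead t c"
proof (cases "\<exists>j\<le>p. c (1, t - int j) \<noteq> 0")
  case True
  then obtain j where j: "j \<le> p" "c (1, t - int j) \<noteq> 0" by auto
  have "1 = switched (t - int j) c" using j by (simp add: switched_def)
  also have "\<dots> \<le> (\<Sum>j\<le>p. switched (t - int j) c)"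
    using j by (intro member_le_sum) (auto simp: switched_nonneg)
  finally show ?thesis
    using A_diff_le_1[of "x + \<zeta> t c" x] mult_nonneg_nonneg[OF mult_nonneg_nonneg[OF mult_nonneg_nonneg[OF K_nonneg(1) r] C_nonneg] lead_nonneg[of t c]]
    by linarith
next
  case False
  then have "\<zeta> t c = r * drift t c" by (intro perturb_unswitched) auto
  then show ?thesis
    using A_drift_bd[of t c] sum_nonneg[of "{..p}" "\<lambda>j. switched (t - int j) c"] by (auto simp: switched_nonneg)
qed

text \<open>Replacing the full perturbation by its clean part plus one jump per outlier costs little:
  with at most one switch in the window the sum of jumps is exact up to the estimation error.\<close>

lemma A_outlier_bd:
  "\<bar>A (x + \<zeta> t c) - A (x + r * drift t c) - (\<Sum>j\<le>p. jump t j c)\<bar>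
     \<le> (\<Sum>j\<le>p. switched (t - int j) c * (2 * K1 * r * C * lead t c))
       + (\<Sum>j\<le>p. min 1 (K1 * r * C * \<bar>cfg_outlier (t - int j) c\<bar>))
       + (real p + 2) * (\<Sum>i\<le>p. \<Sum>j\<in>{..p} - {i}. switched (t - int i) c * switched (t - int j) c)"
  (is "_ \<le> ?S1 + ?S2 + (real p + 2) * ?S3")
proof -
  let ?k = "K1 * r * C"
  have k: "0 \<le> ?k" using K_nonneg r C_nonneg by simp
  have S: "0 \<le> ?S1" "0 \<le> ?S2" "0 \<le> ?S3"
  proof -
    have "0 \<le> 2 * K1 * r * C * lead t c"
      using K_nonneg r C_nonneg lead_nonneg by simp
    then show "0 \<le> ?S1" by (intro sum_nonneg mult_nonneg_nonneg[OF switched_nonneg])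
    show "0 \<le> ?S2" using k by (intro sum_nonneg) (simp add: min_def)
    show "0 \<le> ?S3" by (intro sum_nonneg mult_nonneg_nonneg switched_nonneg)
  qed
  show ?thesis
  proof (cases "\<exists>j\<le>p. c (1, t - int j) \<noteq> 0")
    case False
    then have "\<zeta> t c = r * drift t c" by (intro perturb_unswitched) auto
    moreover have "(\<Sum>j\<le>p. jump t j c) = 0"
      using False by (intro sum.neutral) (auto simp: jump_def cfg_outlier_def)
    ultimately show ?thesis using S by simp
  next
    case True
    then obtain i where i: "i \<le> p" "c (1, t - int i) \<noteq> 0" by auto
    \<comment> \<open>A switch is on, so \<open>?S1\<close> contains the Lipschitz cost of the drift
      twice: once for removing it from the full perturbation, once for removing it from the clean
      one.\<close>
    have "2 * K1 * r * C * lead t c = switched (t - int i) c * (2 * K1 * r * C * lead t c)"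
      using i by (simp add: switched_def)
    also have "\<dots> \<le> ?S1"
      using i K_nonneg r C_nonneg lead_nonneg by (intro member_le_sum) (auto simp: switched_nonneg)
    finally have S1: "2 * (?k * lead t c) \<le> ?S1" by (simp add: mult_ac)
    have "\<bar>A (x + \<zeta> t c) - A (x + cfg_shift p \<beta> t c)\<bar> \<le> K1 * \<bar>\<zeta> t c - cfg_shift p \<beta> t c\<bar>"
      using lipschitz[of "x + \<zeta> t c" "x + cfg_shift p \<beta> t c"] by simp
    also have "\<zeta> t c - cfg_shift p \<beta> t c = r * ((\<Sum>j\<le>p. s j * cfg_reg p \<beta> t j c) + \<kappa> * (\<Sum>j\<le>p. \<bar>cfg_reg p \<beta> t j c\<bar>))"
      by (simp add: cfg_perturb_def)
    also have "K1 * \<bar>\<dots>\<bar> \<le> K1 * (r * (C * (lead t c + (\<Sum>j\<le>p. \<bar>cfg_outlier (t - int j) c\<bar>))))"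
      unfolding abs_mult abs_of_nonneg[OF r] by (intro mult_left_mono reg_bd K_nonneg r)
    also have "\<dots> = ?k * lead t c + (\<Sum>j\<le>p. ?k * \<bar>cfg_outlier (t - int j) c\<bar>)"
      by (simp add: algebra_simps sum_distrib_left)
    finally have "\<bar>A (x + \<zeta> t c) - A (x + cfg_shift p \<beta> t c)\<bar> \<le> ?k * lead t c + min 1 (\<Sum>j\<le>p. ?k * \<bar>cfg_outlier (t - int j) c\<bar>)"
      using A_diff_le_1[of "x + \<zeta> t c" "x + cfg_shift p \<beta> t c"] mult_nonneg_nonneg[OF k lead_nonneg[of t c]] by linarith
    also have "min 1 (\<Sum>j\<le>p. ?k * \<bar>cfg_outlier (t - int j) c\<bar>) \<le> ?S2"
      using k by (intro min_one_sum_le) auto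
    finally have 1: "\<bar>A (x + \<zeta> t c) - A (x + cfg_shift p \<beta> t c)\<bar> \<le> ?k * lead t c + ?S2" by simp
    have 2: "\<bar>A (x + r * drift t c) - A x\<bar> \<le> ?k * lead t c" by (rule A_drift_bd)
    \<comment> \<open>With a single switch the shift is one jump and the difference vanishes. With
      two, the crude bound \<open>p + 2\<close>, from one increment and \<open>p + 1\<close> jumps
      of size at most 1, is charged to the pair of switches.\<close>
    have 3: "\<bar>A (x + cfg_shift p \<beta> t c) - A x - (\<Sum>j\<le>p. jump t j c)\<bar> \<le> (real p + 2) * ?S3"
    proof (cases "\<exists>j\<le>p. j \<noteq> i \<and> c (1, t - int j) \<noteq> 0")
      case True
      then obtain j where j: "j \<le> p" "j \<noteq> i" "c (1, t - int j) \<noteq> 0" by auto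
      have "1 = switched (t - int i) c * switched (t - int j) c" using i j by (simp add: switched_def)
      also have "\<dots> \<le> (\<Sum>j\<in>{..p} - {i}. switched (t - int i) c * switched (t - int j) c)"
        using j by (intro member_le_sum[of j "{..p} - {i}" "\<lambda>j. switched (t - int i) c * switched (t - int j) c"]) (auto simp: switched_nonneg)
      also have "\<dots> \<le> ?S3"
        using i by (intro member_le_sum[of i "{..p}" "\<lambda>i. \<Sum>j\<in>{..p} - {i}. switched (t - int i) c * switched (t - int j) c"])
          (auto intro!: sum_nonneg mult_nonneg_nonneg simp: switched_nonneg)
      finally have "(real p + 2) * 1 \<le> (real p + 2) * ?S3" by (intro mult_left_mono) auto
      moreover have "\<bar>\<Sum>j\<le>p. jump t j c\<bar> \<le> (\<Sum>j\<le>p. 1)"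
        unfolding jump_def by (intro order_trans[OF sum_abs] sum_mono A_diff_le_1)
      then have "\<bar>\<Sum>j\<le>p. jump t j c\<bar> \<le> real p + 1" by simp
      moreover have "\<bar>u - w\<bar> \<le> B" if "(P + 2) * 1 \<le> B" "\<bar>w\<bar> \<le> P + 1" "\<bar>u\<bar> \<le> 1" for u w P B :: real
        using that abs_triangle_ineq4[of u w] by simp
      ultimately show ?thesis
        using A_diff_le_1[of "x + cfg_shift p \<beta> t c" x] by blast
    next
      case False
      then have z: "cfg_outlier (t - int j) c = 0" if "j \<in> {..p} - {i}" for j
        using that by (auto simp: cfg_outlier_def)
      have "cfg_shift p \<beta> t c = ar_coeff \<beta> i * cfg_outlier (t - int i) c"
        unfolding cfg_shift_def using i z by (subst sum.remove[of _ i]) auto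
      moreover have "(\<Sum>j\<le>p. jump t j c) = jump t i c"
        using i z by (subst sum.remove[of _ i]) (auto simp: jump_def)
      ultimately have "A (x + cfg_shift p \<beta> t c) - A x - (\<Sum>j\<le>p. jump t j c) = 0"
        by (simp add: jump_def)
      then show ?thesis using S by simp
    qed
    show ?thesis using 1 2 3 S1 by linarith
  qed
qed

lemma drift_measurable [measurable]: "(\<lambda>\<omega>. drift t (cfg \<omega>)) \<in> borel_measurable M"
  unfolding cfg_drift_def by measurable

lemma jump_measurable [measurable]: "(\<lambda>\<omega>. jump t j (cfg \<omega>)) \<in> borel_measurable M"
  unfolding jump_def by measurable

lemma jump_bd: "\<bar>jump t j c\<bar> \<le> 1"
  unfolding jump_def by (rule A_diff_le_1)

text \<open>Orthogonality reduces the mean square of the sum to the sum of the mean squares, and the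
  normalization \<open>r\<^sup>2 * card T = 1\<close> turns that into the bound for one
  term.\<close>

lemma fluct_sum_bound:
  assumes fin: "finite T" and card: "r\<^sup>2 * card T = 1"
  shows "expectation (\<lambda>\<omega>. \<bar>r * (\<Sum>t\<in>T. fluct t (\<epsilon> t \<omega>) (cfg \<omega>))\<bar>) \<le> fluct_bound r C"
    and "integrable M (\<lambda>\<omega>. r * (\<Sum>t\<in>T. fluct t (\<epsilon> t \<omega>) (cfg \<omega>)))"
proof -
  let ?X = "\<lambda>t \<omega>. fluct t (\<epsilon> t \<omega>) (cfg \<omega>)" and ?e = "(real p + 1) * q + K1 * r * C * ((real p + 1) * moment)"
  have \<delta>: "expectation (\<lambda>\<omega>. \<bar>A (x + \<zeta> t (cfg \<omega>)) - A x\<bar>) \<le> ?e" for t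
  proof -
    have "expectation (\<lambda>\<omega>. \<bar>A (x + \<zeta> t (cfg \<omega>)) - A x\<bar>)
      \<le> expectation (\<lambda>\<omega>. (\<Sum>j\<le>p. switched (t - int j) (cfg \<omega>)) + K1 * r * C * lead t (cfg \<omega>))"
      using A_perturb_bd A_diff_le_1 integrable_switched lead_first_moment
      by (intro integral_mono integrable_const_bound[of "\<lambda>\<omega>. \<bar>A (x + \<zeta> t (cfg \<omega>)) - A x\<bar>" 1]) auto
    also have "\<dots> = (real p + 1) * q + K1 * r * C * expectation (\<lambda>\<omega>. lead t (cfg \<omega>))"
      using integrable_switched lead_first_moment by (simp add: expectation_switched)
    also have "\<dots> \<le> ?e"
      using K_nonneg r C_nonneg lead_first_moment by (intro add_left_mono mult_left_mono) auto
    finally show ?thesis .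
  qed
  have orth: "expectation (\<lambda>\<omega>. ?X s \<omega> * ?X t \<omega>) = 0" if "s \<noteq> t" for s t
    using fluct_orthogonal[of s t] fluct_orthogonal[of t s] that by (cases "s < t") (auto simp: mult.commute)
  have int2: "integrable M (\<lambda>\<omega>. (r * (\<Sum>t\<in>T. ?X t \<omega>))\<^sup>2)"
  proof (rule integrable_const_bound[of _ "(r * (\<Sum>t\<in>T. 2))\<^sup>2"])
    show "AE \<omega> in M. norm ((r * (\<Sum>t\<in>T. ?X t \<omega>))\<^sup>2) \<le> (r * (\<Sum>t\<in>T. 2))\<^sup>2"
    proof (rule AE_I2)
      fix \<omega>
      have "\<bar>r * (\<Sum>t\<in>T. ?X t \<omega>)\<bar> \<le> r * (\<Sum>t\<in>T. 2)"
        unfolding abs_mult abs_of_nonneg[OF r]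
        by (intro mult_left_mono r order_trans[OF sum_abs] sum_mono fluct_bd)
      from power_mono[OF this abs_ge_zero, of 2] show "norm ((r * (\<Sum>t\<in>T. ?X t \<omega>))\<^sup>2) \<le> (r * (\<Sum>t\<in>T. 2))\<^sup>2"
        by simp
    qed
  qed measurable
  have "expectation (\<lambda>\<omega>. (r * (\<Sum>t\<in>T. ?X t \<omega>))\<^sup>2) = r\<^sup>2 * expectation (\<lambda>\<omega>. (\<Sum>t\<in>T. ?X t \<omega>)\<^sup>2)"
    by (simp add: power_mult_distrib)
  also have "expectation (\<lambda>\<omega>. (\<Sum>t\<in>T. ?X t \<omega>)\<^sup>2) = (\<Sum>t\<in>T. expectation (\<lambda>\<omega>. (?X t \<omega>)\<^sup>2))"
    using fin fluct_bd orth by (intro expectation_sum_orthogonal[of T _ 2]) auto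
  also have "r\<^sup>2 * \<dots> \<le> r\<^sup>2 * (\<Sum>t\<in>T. 4 * ?e)"
    using \<delta> by (intro mult_left_mono sum_mono order_trans[OF fluct_square]) auto
  also have "\<dots> = (r\<^sup>2 * card T) * (4 * ?e)" by simp
  also have "\<dots> = 4 * ?e" unfolding card by simp
  finally have *: "expectation (\<lambda>\<omega>. (r * (\<Sum>t\<in>T. ?X t \<omega>))\<^sup>2) \<le> 4 * ?e" .
  have m: "(\<lambda>\<omega>. r * (\<Sum>t\<in>T. ?X t \<omega>)) \<in> borel_measurable M" by measurable
  show "integrable M (\<lambda>\<omega>. r * (\<Sum>t\<in>T. ?X t \<omega>))"
    by (rule expectation_abs_le_sqrt[OF m int2])
  show "expectation (\<lambda>\<omega>. \<bar>r * (\<Sum>t\<in>T. ?X t \<omega>)\<bar>) \<le> fluct_bound r C"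
    unfolding fluct_bound_def
    by (rule order_trans[OF expectation_abs_le_sqrt(2)[OF m int2]]) (intro real_sqrt_le_mono *)
qed

lemma taylor_term_bound:
  "expectation (\<lambda>\<omega>. \<bar>A (x + r * drift t (cfg \<omega>)) - A x - a x * (r * drift t (cfg \<omega>))\<bar>) \<le> taylor_bound r C"
  "integrable M (\<lambda>\<omega>. A (x + r * drift t (cfg \<omega>)) - A x - a x * (r * drift t (cfg \<omega>)))"
proof -
  let ?Z = "\<lambda>\<omega>. A (x + r * drift t (cfg \<omega>)) - A x - a x * (r * drift t (cfg \<omega>))"
  let ?B = "\<lambda>\<omega>. K2 * r\<^sup>2 * (C\<^sup>2 * (lead t (cfg \<omega>))\<^sup>2)"
  have pt: "\<bar>?Z \<omega>\<bar> \<le> ?B \<omega>" for \<omega>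
  proof -
    have "\<bar>?Z \<omega>\<bar> \<le> K2 * (r * drift t (cfg \<omega>))\<^sup>2" by (rule taylor)
    also have "\<dots> = K2 * r\<^sup>2 * \<bar>drift t (cfg \<omega>)\<bar>\<^sup>2" by (simp add: power_mult_distrib)
    also have "\<dots> \<le> K2 * r\<^sup>2 * (C * lead t (cfg \<omega>))\<^sup>2"
      using K_nonneg by (intro mult_left_mono power_mono drift_bd) auto
    finally show ?thesis by (simp add: power_mult_distrib)
  qed
  have int: "integrable M ?B" using lead_second_moment(1) by simp
  show Z: "integrable M ?Z"
    using pt by (intro Bochner_Integration.integrable_bound[OF int]) (auto intro!: AE_I2 order_trans[OF _ abs_ge_self])
  have "expectation (\<lambda>\<omega>. \<bar>?Z \<omega>\<bar>) \<le> expectation ?B"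
    using Z int pt by (intro integral_mono) auto
  also have "\<dots> = K2 * r\<^sup>2 * (C\<^sup>2 * expectation (\<lambda>\<omega>. (lead t (cfg \<omega>))\<^sup>2))"
    by simp
  also have "\<dots> \<le> taylor_bound r C"
    unfolding taylor_bound_def using K_nonneg lead_second_moment(2) by (intro mult_left_mono) auto
  finally show "expectation (\<lambda>\<omega>. \<bar>?Z \<omega>\<bar>) \<le> taylor_bound r C" .
qed

lemma outlier_term_bound:
  "expectation (\<lambda>\<omega>. \<bar>A (x + \<zeta> t (cfg \<omega>)) - A (x + r * drift t (cfg \<omega>)) - (\<Sum>j\<le>p. jump t j (cfg \<omega>))\<bar>) \<le> outlier_bound r C"
  "integrable M (\<lambda>\<omega>. A (x + \<zeta> t (cfg \<omega>)) - A (x + r * drift t (cfg \<omega>)) - (\<Sum>j\<le>p. jump t j (cfg \<omega>)))"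
proof -
  let ?Z = "\<lambda>\<omega>. A (x + \<zeta> t (cfg \<omega>)) - A (x + r * drift t (cfg \<omega>)) - (\<Sum>j\<le>p. jump t j (cfg \<omega>))"
  let ?k = "K1 * r * C"
  define \<phi> where "\<phi> u = min 1 (?k * \<bar>u\<bar>)" for u
  have k: "0 \<le> ?k" using K_nonneg r C_nonneg by simp
  have \<phi>_meas[measurable]: "\<phi> \<in> borel_measurable borel" unfolding \<phi>_def by measurable
  have \<phi>: "\<bar>\<phi> u\<bar> \<le> 1" "\<phi> 0 = 0" for u
    using mult_nonneg_nonneg[OF k abs_ge_zero, of u] by (auto simp: \<phi>_def min_def)
  let ?B1 = "\<lambda>\<omega>. \<Sum>j\<le>p. 2 * K1 * r * C * (switched (t - int j) (cfg \<omega>) * lead t (cfg \<omega>))"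
  let ?B2 = "\<lambda>\<omega>. \<Sum>j\<le>p. \<phi> (cfg_outlier (t - int j) (cfg \<omega>))"
  let ?B3 = "\<lambda>\<omega>. (real p + 2) * (\<Sum>i\<le>p. \<Sum>j\<in>{..p} - {i}. switched (t - int i) (cfg \<omega>) * switched (t - int j) (cfg \<omega>))"
  have pt: "\<bar>?Z \<omega>\<bar> \<le> ?B1 \<omega> + ?B2 \<omega> + ?B3 \<omega>" for \<omega>
    using A_outlier_bd[of t "cfg \<omega>"] by (simp add: \<phi>_def mult_ac)
  have i1: "integrable M ?B1" using expectation_switched_lead(2) by simp
  have i2': "integrable M (\<lambda>\<omega>. \<phi> (cfg_outlier (t - int j) (cfg \<omega>)))" for j
    using \<phi>(1) by (intro integrable_const_bound[of _ 1]) auto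
  then have i2: "integrable M ?B2" by simp
  have i3': "integrable M (\<lambda>\<omega>. switched (t - int i) (cfg \<omega>) * switched (t - int j) (cfg \<omega>))" if "j \<in> {..p} - {i}" for i j
    using that by (intro expectation_switched_pair(2)) auto
  then have i3: "integrable M ?B3"
    by (intro integrable_mult_right Bochner_Integration.integrable_sum)
  show Z: "integrable M ?Z"
  proof (rule Bochner_Integration.integrable_bound[of _ "\<lambda>\<omega>. ?B1 \<omega> + ?B2 \<omega> + ?B3 \<omega>"])
    show "integrable M (\<lambda>\<omega>. ?B1 \<omega> + ?B2 \<omega> + ?B3 \<omega>)"
      by (intro Bochner_Integration.integrable_add i1 i2 i3)
    show "AE \<omega> in M. norm (?Z \<omega>) \<le> norm (?B1 \<omega> + ?B2 \<omega> + ?B3 \<omega>)"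
      unfolding real_norm_def by (intro AE_I2 order_trans[OF pt abs_ge_self])
  qed measurable
  have "expectation (\<lambda>\<omega>. \<bar>?Z \<omega>\<bar>) \<le> expectation (\<lambda>\<omega>. ?B1 \<omega> + ?B2 \<omega> + ?B3 \<omega>)"
    by (intro integral_mono pt integrable_abs Z Bochner_Integration.integrable_add i1 i2 i3)
  also have "\<dots> = expectation ?B1 + expectation ?B2 + expectation ?B3"
    by (simp only: Bochner_Integration.integral_add[OF Bochner_Integration.integrable_add[OF i1 i2] i3]
        Bochner_Integration.integral_add[OF i1 i2])
  also have "expectation ?B1 \<le> (real p + 1) * (2 * K1 * r * C * (q * ((real p + 1) * moment)))"
  proof -
    have "expectation ?B1 = (\<Sum>j\<le>p. 2 * K1 * r * C * expectation (\<lambda>\<omega>. switched (t - int j) (cfg \<omega>) * lead t (cfg \<omega>)))"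
      using expectation_switched_lead(2) by (subst Bochner_Integration.integral_sum) auto
    also have "\<dots> \<le> (\<Sum>j\<le>p. 2 * K1 * r * C * (q * ((real p + 1) * moment)))"
      using K_nonneg r C_nonneg by (intro sum_mono mult_left_mono expectation_switched_lead) auto
    finally show ?thesis by (simp add: add.commute)
  qed
  also have "expectation ?B2 = (real p + 1) * (q * (\<integral>u. \<phi> u \<partial>Q))"
    using i2' by (subst Bochner_Integration.integral_sum) (auto simp: expectation_outlier[OF \<phi>_meas \<phi>])
  also have "expectation ?B3 = (real p + 2) * ((real p + 1) * (real p * q\<^sup>2))"
  proof -
    have "expectation ?B3 = (real p + 2) * (\<Sum>i\<le>p. \<Sum>j\<in>{..p} - {i}. expectation (\<lambda>\<omega>. switched (t - int i) (cfg \<omega>) * switched (t - int j) (cfg \<omega>)))"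
      using i3' by (subst Bochner_Integration.integral_mult_right_zero, subst Bochner_Integration.integral_sum)
        (auto intro!: sum.cong Bochner_Integration.integral_sum Bochner_Integration.integrable_sum)
    also have "\<dots> = (real p + 2) * (\<Sum>i\<le>p. \<Sum>j\<in>{..p} - {i}. q\<^sup>2)"
      by (intro arg_cong2[where f="(*)"] refl sum.cong expectation_switched_pair(1)) auto
    also have "\<dots> = (real p + 2) * (\<Sum>i\<le>p. real p * q\<^sup>2)"
      by (intro arg_cong2[where f="(*)"] refl sum.cong) (auto simp: card_Diff_subset)
    finally show ?thesis by simp
  qed
  finally show "expectation (\<lambda>\<omega>. \<bar>?Z \<omega>\<bar>) \<le> outlier_bound r C"
    by (simp add: outlier_bound_def \<phi>_def)
qed

text \<open>For a fixed lag the jumps at different times read disjoint coordinates, so after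
  centring they are orthogonal, each with variance at most \<open>q\<close>. Jumps with different
  lags can involve the same outlier, so the lags are separated by the triangle inequality. The
  factor \<open>q / r\<close> of the centring is \<open>r * card T * q\<close>.\<close>

lemma jump_sum_bound:
  assumes fin: "finite T" and card: "r\<^sup>2 * card T = 1"
  shows "expectation (\<lambda>\<omega>. \<bar>r * (\<Sum>t\<in>T. \<Sum>j\<le>p. jump t j (cfg \<omega>))
      - q / r * (\<Sum>j\<le>p. \<integral>u. A (x + ar_coeff \<beta> j * u) - A x \<partial>Q)\<bar>) \<le> (real p + 1) * sqrt q"
proof -
  define \<phi> where "\<phi> j u = A (x + ar_coeff \<beta> j * u) - A x" for j u
  have [measurable]: "\<phi> j \<in> borel_measurable borel" for j unfolding \<phi>_def by measurable
  have \<phi>: "\<bar>\<phi> j u\<bar> \<le> 1" "\<phi> j 0 = 0" for j u unfolding \<phi>_def using A_diff_le_1 by auto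
  define e where "e j = q * (\<integral>u. \<phi> j u \<partial>Q)" for j
  define F where "F j t \<omega> = jump t j (cfg \<omega>) - e j" for j t \<omega>
  have jump_\<phi>: "jump t j c = \<phi> j (cfg_outlier (t - int j) c)" for t j c by (simp add: jump_def \<phi>_def)
  have Ejump: "expectation (\<lambda>\<omega>. jump t j (cfg \<omega>)) = e j" for t j
    unfolding jump_\<phi> e_def using \<phi> by (intro expectation_outlier) auto
  have ijump: "integrable M (\<lambda>\<omega>. jump t j (cfg \<omega>))" for t j
    using jump_bd by (intro integrable_const_bound[of _ 1]) auto
  have e1: "\<bar>e j\<bar> \<le> 1" for j
  proof -
    have "\<bar>e j\<bar> \<le> expectation (\<lambda>\<omega>. \<bar>jump 0 j (cfg \<omega>)\<bar>)"
      unfolding Ejump[of 0 j, symmetric] by (rule integral_abs_bound)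
    also have "\<dots> \<le> expectation (\<lambda>\<omega>. 1)"
      using ijump jump_bd by (intro integral_mono) auto
    finally show ?thesis by (simp add: prob_space)
  qed
  have Fm[measurable]: "F j t \<in> borel_measurable M" for j t unfolding F_def by measurable
  have F2: "\<bar>F j t \<omega>\<bar> \<le> 2" for j t \<omega>
    unfolding F_def using jump_bd[of t j "cfg \<omega>"] e1[of j] by linarith
  have orth: "expectation (\<lambda>\<omega>. F j t \<omega> * F j t' \<omega>) = 0" if "t \<noteq> t'" for j t t'
  proof -
    let ?f = "\<lambda>t c. \<phi> j (cfg_outlier (t - int j) c) - e j" and ?J = "\<lambda>t. {(1::nat, t - int j), (2, t - int j)}"
    have m: "?f t \<in> borel_measurable (PiM (?J t) (\<lambda>_. borel))" for t
    proof -
      have [measurable]: "(\<lambda>c. c (1, t - int j)) \<in> borel_measurable (PiM (?J t) (\<lambda>_. borel))"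
        "(\<lambda>c. c (2, t - int j)) \<in> borel_measurable (PiM (?J t) (\<lambda>_. borel))"
        by (rule measurable_component_singleton; simp)+
      have [measurable]: "(\<lambda>c. cfg_outlier (t - int j) c) \<in> borel_measurable (PiM (?J t) (\<lambda>_. borel))"
        unfolding cfg_outlier_def by measurable
      show ?thesis by measurable
    qed
    have rs: "?f t (restrict c (?J t)) = ?f t c" for t c by (simp add: cfg_outlier_def)
    have i: "integrable M (\<lambda>\<omega>. ?f t (cfg \<omega>))" for t
      using ijump[of t j] by (simp add: jump_\<phi>)
    have "expectation (\<lambda>\<omega>. ?f t (cfg \<omega>) * ?f t' (cfg \<omega>)) = expectation (\<lambda>\<omega>. ?f t (cfg \<omega>)) * expectation (\<lambda>\<omega>. ?f t' (cfg \<omega>))"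
      using that by (intro expectation_disjoint(1)[OF _ _ _ m rs m rs i i]) auto
    also have "expectation (\<lambda>\<omega>. ?f t (cfg \<omega>)) = 0"
      using Ejump[of t j] ijump[of t j] by (simp add: jump_\<phi> prob_space)
    finally show ?thesis by (simp add: F_def jump_\<phi>)
  qed
  have FF: "expectation (\<lambda>\<omega>. (F j t \<omega>)\<^sup>2) \<le> q" for j t
  proof -
    have i2: "integrable M (\<lambda>\<omega>. (jump t j (cfg \<omega>))\<^sup>2)"
      using power_mono[OF jump_bd abs_ge_zero, of _ _ _ 2] by (intro integrable_const_bound[of _ 1]) auto
    have "expectation (\<lambda>\<omega>. (F j t \<omega>)\<^sup>2) = variance (\<lambda>\<omega>. jump t j (cfg \<omega>))"
      by (simp add: F_def Ejump)
    also have "\<dots> = expectation (\<lambda>\<omega>. (jump t j (cfg \<omega>))\<^sup>2) - (expectation (\<lambda>\<omega>. jump t j (cfg \<omega>)))\<^sup>2"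
      using ijump i2 by (rule variance_eq)
    also have "\<dots> \<le> expectation (\<lambda>\<omega>. (jump t j (cfg \<omega>))\<^sup>2)" by simp
    also have "\<dots> \<le> expectation (\<lambda>\<omega>. switched (t - int j) (cfg \<omega>))"
    proof (rule integral_mono[OF i2 integrable_switched])
      fix \<omega>
      show "(jump t j (cfg \<omega>))\<^sup>2 \<le> switched (t - int j) (cfg \<omega>)"
        using power_mono[OF jump_bd abs_ge_zero, of t j "cfg \<omega>" 2]
        by (cases "z (t - int j) \<omega> = 0") (auto simp: jump_\<phi> switched_cfg cfg_outlier_def \<phi>(2))
    qed
    finally show ?thesis by (simp add: expectation_switched)
  qed
  have one: "expectation (\<lambda>\<omega>. \<bar>r * (\<Sum>t\<in>T. F j t \<omega>)\<bar>) \<le> sqrt q" "integrable M (\<lambda>\<omega>. r * (\<Sum>t\<in>T. F j t \<omega>))" for j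
  proof -
    have int2: "integrable M (\<lambda>\<omega>. (r * (\<Sum>t\<in>T. F j t \<omega>))\<^sup>2)"
    proof (rule integrable_const_bound[of _ "(r * (\<Sum>t\<in>T. 2))\<^sup>2"])
      show "AE \<omega> in M. norm ((r * (\<Sum>t\<in>T. F j t \<omega>))\<^sup>2) \<le> (r * (\<Sum>t\<in>T. 2))\<^sup>2"
      proof (rule AE_I2)
        fix \<omega>
        have "\<bar>r * (\<Sum>t\<in>T. F j t \<omega>)\<bar> \<le> r * (\<Sum>t\<in>T. 2)"
          unfolding abs_mult abs_of_nonneg[OF r]
          by (intro mult_left_mono r order_trans[OF sum_abs] sum_mono F2)
        from power_mono[OF this abs_ge_zero, of 2] show "norm ((r * (\<Sum>t\<in>T. F j t \<omega>))\<^sup>2) \<le> (r * (\<Sum>t\<in>T. 2))\<^sup>2"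
          by simp
      qed
    qed measurable
    have "expectation (\<lambda>\<omega>. (r * (\<Sum>t\<in>T. F j t \<omega>))\<^sup>2) = r\<^sup>2 * expectation (\<lambda>\<omega>. (\<Sum>t\<in>T. F j t \<omega>)\<^sup>2)"
      by (simp add: power_mult_distrib)
    also have "expectation (\<lambda>\<omega>. (\<Sum>t\<in>T. F j t \<omega>)\<^sup>2) = (\<Sum>t\<in>T. expectation (\<lambda>\<omega>. (F j t \<omega>)\<^sup>2))"
      using fin F2 orth by (intro expectation_sum_orthogonal[of T _ 2]) auto
    also have "r\<^sup>2 * \<dots> \<le> r\<^sup>2 * (\<Sum>t\<in>T. q)"
      by (intro mult_left_mono sum_mono FF) auto
    also have "\<dots> = (r\<^sup>2 * card T) * q" by simp
    also have "\<dots> = q" unfolding card by simp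
    finally have *: "expectation (\<lambda>\<omega>. (r * (\<Sum>t\<in>T. F j t \<omega>))\<^sup>2) \<le> q" .
    have m: "(\<lambda>\<omega>. r * (\<Sum>t\<in>T. F j t \<omega>)) \<in> borel_measurable M" by measurable
    show "integrable M (\<lambda>\<omega>. r * (\<Sum>t\<in>T. F j t \<omega>))"
      by (rule expectation_abs_le_sqrt[OF m int2])
    show "expectation (\<lambda>\<omega>. \<bar>r * (\<Sum>t\<in>T. F j t \<omega>)\<bar>) \<le> sqrt q"
      by (rule order_trans[OF expectation_abs_le_sqrt(2)[OF m int2]]) (intro real_sqrt_le_mono *)
  qed
  have rne: "r \<noteq> 0" using card by auto
  have eq: "r * (\<Sum>t\<in>T. \<Sum>j\<le>p. jump t j (cfg \<omega>)) - q / r * (\<Sum>j\<le>p. \<integral>u. A (x + ar_coeff \<beta> j * u) - A x \<partial>Q)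
    = (\<Sum>j\<le>p. r * (\<Sum>t\<in>T. F j t \<omega>))" for \<omega>
  proof -
    have n: "real (card T) = 1 / r\<^sup>2" using card rne by (simp add: field_simps)
    have "(\<Sum>j\<le>p. r * (\<Sum>t\<in>T. F j t \<omega>)) = r * (\<Sum>j\<le>p. \<Sum>t\<in>T. jump t j (cfg \<omega>)) - (\<Sum>j\<le>p. r * (card T * e j))"
      by (simp add: F_def sum_subtractf right_diff_distrib sum_distrib_left)
    also have "(\<Sum>j\<le>p. r * (card T * e j)) = q / r * (\<Sum>j\<le>p. \<integral>u. \<phi> j u \<partial>Q)"
      unfolding n e_def sum_distrib_left using rne by (intro sum.cong) (auto simp: power2_eq_square)
    finally show ?thesis by (subst sum.swap) (simp add: \<phi>_def)
  qed
  have "expectation (\<lambda>\<omega>. \<bar>\<Sum>j\<le>p. r * (\<Sum>t\<in>T. F j t \<omega>)\<bar>) \<le> expectation (\<lambda>\<omega>. \<Sum>j\<le>p. \<bar>r * (\<Sum>t\<in>T. F j t \<omega>)\<bar>)"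
    by (intro integral_mono sum_abs integrable_abs Bochner_Integration.integrable_sum one)
  also have "\<dots> = (\<Sum>j\<le>p. expectation (\<lambda>\<omega>. \<bar>r * (\<Sum>t\<in>T. F j t \<omega>)\<bar>))"
    by (intro Bochner_Integration.integral_sum integrable_abs one)
  also have "\<dots> \<le> (\<Sum>j\<le>p. sqrt q)" by (intro sum_mono one)
  finally show ?thesis unfolding eq by (simp add: add.commute)
qed

text \<open>The level increment splits into \<open>fluct\<close>, a Taylor remainder, an outlier
  remainder, the jumps and the linear drift. Only \<open>fluct\<close> and the centred jumps profit
  from cancellation over time. The two remainders are summed in absolute value, whence the division
  by \<open>r\<close>; with \<open>q\<close> of order \<open>r\<close> their one-term bounds are
  still of smaller order than \<open>r\<close>.\<close>

lemma level_sum_expansion: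
  assumes fin: "finite T" and card: "r\<^sup>2 * card T = 1"
  shows "expectation (\<lambda>\<omega>. \<bar>r * (\<Sum>t\<in>T. level (x + \<zeta> t (cfg \<omega>)) (\<epsilon> t \<omega>) - level x (\<epsilon> t \<omega>))
      - a x * (r\<^sup>2 * (\<Sum>t\<in>T. drift t (cfg \<omega>))) - q / r * (\<Sum>j\<le>p. \<integral>u. A (x + ar_coeff \<beta> j * u) - A x \<partial>Q)\<bar>)
      \<le> fluct_bound r C + (taylor_bound r C + outlier_bound r C) / r + (real p + 1) * sqrt q" (is "?E \<le> _")
    and "integrable M (\<lambda>\<omega>. r * (\<Sum>t\<in>T. level (x + \<zeta> t (cfg \<omega>)) (\<epsilon> t \<omega>) - level x (\<epsilon> t \<omega>))
      - a x * (r\<^sup>2 * (\<Sum>t\<in>T. drift t (cfg \<omega>))) - q / r * (\<Sum>j\<le>p. \<integral>u. A (x + ar_coeff \<beta> j * u) - A x \<partial>Q))" (is ?I)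
proof -
  define X where "X t \<omega> = fluct t (\<epsilon> t \<omega>) (cfg \<omega>)" for t \<omega>
  define Y where "Y t \<omega> = A (x + r * drift t (cfg \<omega>)) - A x - a x * (r * drift t (cfg \<omega>))" for t \<omega>
  define Z where "Z t \<omega> = A (x + \<zeta> t (cfg \<omega>)) - A (x + r * drift t (cfg \<omega>)) - (\<Sum>j\<le>p. jump t j (cfg \<omega>))" for t \<omega>
  define W where "W \<omega> = r * (\<Sum>t\<in>T. \<Sum>j\<le>p. jump t j (cfg \<omega>)) - q / r * (\<Sum>j\<le>p. \<integral>u. A (x + ar_coeff \<beta> j * u) - A x \<partial>Q)" for \<omega>
  have rpos: "r > 0" using card r by (cases "r = 0") auto
  have rn: "r * card T = 1 / r" using card rpos by (simp add: field_simps power2_eq_square)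
  have iX: "integrable M (\<lambda>\<omega>. r * (\<Sum>t\<in>T. X t \<omega>))" and X: "expectation (\<lambda>\<omega>. \<bar>r * (\<Sum>t\<in>T. X t \<omega>)\<bar>) \<le> fluct_bound r C"
    unfolding X_def using fluct_sum_bound[OF fin card] by auto
  have iY: "integrable M (Y t)" and Y: "expectation (\<lambda>\<omega>. \<bar>Y t \<omega>\<bar>) \<le> taylor_bound r C" for t
    unfolding Y_def using taylor_term_bound by auto
  have iZ: "integrable M (Z t)" and Z: "expectation (\<lambda>\<omega>. \<bar>Z t \<omega>\<bar>) \<le> outlier_bound r C" for t
    unfolding Z_def using outlier_term_bound by auto
  have iW: "integrable M W" and W: "expectation (\<lambda>\<omega>. \<bar>W \<omega>\<bar>) \<le> (real p + 1) * sqrt q"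
  proof -
    have "integrable M (\<lambda>\<omega>. jump t j (cfg \<omega>))" for t j
      using jump_bd by (intro integrable_const_bound[of _ 1]) auto
    then show "integrable M W" unfolding W_def by simp
    show "expectation (\<lambda>\<omega>. \<bar>W \<omega>\<bar>) \<le> (real p + 1) * sqrt q"
      unfolding W_def by (rule jump_sum_bound[OF fin card])
  qed
  have eq: "r * (\<Sum>t\<in>T. level (x + \<zeta> t (cfg \<omega>)) (\<epsilon> t \<omega>) - level x (\<epsilon> t \<omega>))
      - a x * (r\<^sup>2 * (\<Sum>t\<in>T. drift t (cfg \<omega>))) - q / r * (\<Sum>j\<le>p. \<integral>u. A (x + ar_coeff \<beta> j * u) - A x \<partial>Q)
      = r * (\<Sum>t\<in>T. X t \<omega>) + r * (\<Sum>t\<in>T. Y t \<omega> + Z t \<omega>) + W \<omega>" for \<omega>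
  proof -
    have "level (x + \<zeta> t (cfg \<omega>)) (\<epsilon> t \<omega>) - level x (\<epsilon> t \<omega>)
       = X t \<omega> + (Y t \<omega> + Z t \<omega>) + (\<Sum>j\<le>p. jump t j (cfg \<omega>)) + a x * r * drift t (cfg \<omega>)" for t
      by (simp add: X_def Y_def Z_def fluct_def)
    then have "(\<Sum>t\<in>T. level (x + \<zeta> t (cfg \<omega>)) (\<epsilon> t \<omega>) - level x (\<epsilon> t \<omega>))
      = (\<Sum>t\<in>T. X t \<omega>) + (\<Sum>t\<in>T. Y t \<omega> + Z t \<omega>) + (\<Sum>t\<in>T. \<Sum>j\<le>p. jump t j (cfg \<omega>)) + a x * r * (\<Sum>t\<in>T. drift t (cfg \<omega>))"
      by (simp only: sum.distrib sum_distrib_left)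
    then show ?thesis by (simp add: W_def algebra_simps power2_eq_square)
  qed
  have iYZ: "integrable M (\<lambda>\<omega>. r * (\<Sum>t\<in>T. Y t \<omega> + Z t \<omega>))" using iY iZ by simp
  show ?I unfolding eq by (intro Bochner_Integration.integrable_add iX iYZ iW)
  have "?E \<le> expectation (\<lambda>\<omega>. \<bar>r * (\<Sum>t\<in>T. X t \<omega>)\<bar> + r * (\<Sum>t\<in>T. \<bar>Y t \<omega>\<bar> + \<bar>Z t \<omega>\<bar>) + \<bar>W \<omega>\<bar>)"
    unfolding eq
  proof (rule integral_mono)
    show "integrable M (\<lambda>\<omega>. \<bar>r * (\<Sum>t\<in>T. X t \<omega>) + r * (\<Sum>t\<in>T. Y t \<omega> + Z t \<omega>) + W \<omega>\<bar>)"
      by (intro integrable_abs Bochner_Integration.integrable_add iX iYZ iW)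
    show "integrable M (\<lambda>\<omega>. \<bar>r * (\<Sum>t\<in>T. X t \<omega>)\<bar> + r * (\<Sum>t\<in>T. \<bar>Y t \<omega>\<bar> + \<bar>Z t \<omega>\<bar>) + \<bar>W \<omega>\<bar>)"
      by (intro Bochner_Integration.integrable_add integrable_abs integrable_mult_right Bochner_Integration.integrable_sum iX iW iY iZ)
    fix \<omega>
    have "\<bar>r * (\<Sum>t\<in>T. Y t \<omega> + Z t \<omega>)\<bar> \<le> r * (\<Sum>t\<in>T. \<bar>Y t \<omega>\<bar> + \<bar>Z t \<omega>\<bar>)"
      unfolding abs_mult abs_of_nonneg[OF r]
      by (intro mult_left_mono r order_trans[OF sum_abs] sum_mono abs_triangle_ineq)
    then show "\<bar>r * (\<Sum>t\<in>T. X t \<omega>) + r * (\<Sum>t\<in>T. Y t \<omega> + Z t \<omega>) + W \<omega>\<bar>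
      \<le> \<bar>r * (\<Sum>t\<in>T. X t \<omega>)\<bar> + r * (\<Sum>t\<in>T. \<bar>Y t \<omega>\<bar> + \<bar>Z t \<omega>\<bar>) + \<bar>W \<omega>\<bar>"
      by linarith
  qed
  also have "\<dots> = expectation (\<lambda>\<omega>. \<bar>r * (\<Sum>t\<in>T. X t \<omega>)\<bar>) + r * (\<Sum>t\<in>T. expectation (\<lambda>\<omega>. \<bar>Y t \<omega>\<bar>) + expectation (\<lambda>\<omega>. \<bar>Z t \<omega>\<bar>)) + expectation (\<lambda>\<omega>. \<bar>W \<omega>\<bar>)"
    using iX iY iZ iW by simp
  also have "\<dots> \<le> fluct_bound r C + r * (\<Sum>t\<in>T. taylor_bound r C + outlier_bound r C) + (real p + 1) * sqrt q"
    by (intro add_mono X W mult_left_mono sum_mono Y Z r)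
  also have "r * (\<Sum>t\<in>T. taylor_bound r C + outlier_bound r C) = (r * card T) * (taylor_bound r C + outlier_bound r C)"
    by simp
  finally show "?E \<le> fluct_bound r C + (taylor_bound r C + outlier_bound r C) / r + (real p + 1) * sqrt q"
    unfolding rn by simp
qed

end

end

section \<open>Random coefficients\<close>

text \<open>A change of the coefficients by at most \<open>\<eta>\<close> moves the linear form by
  at most \<open>\<eta>\<close> times the total size of the regressors. One deterministic vector
  with \<open>\<kappa> = - \<eta>\<close> and \<open>\<kappa> = \<eta>\<close> therefore encloses
  the random perturbation at all times simultaneously.\<close>

lemma level_perturb_sandwich:
  assumes r: "0 \<le> r" and close: "\<And>j. j \<le> p \<Longrightarrow> \<bar>s j - s' j\<bar> \<le> \<eta>"
  shows "cfg_perturb p \<beta> r s' (- \<eta>) t c \<le> cfg_perturb p \<beta> r s 0 t c"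
    and "cfg_perturb p \<beta> r s 0 t c \<le> cfg_perturb p \<beta> r s' \<eta> t c"
proof -
  have "\<bar>(\<Sum>j\<le>p. s j * cfg_reg p \<beta> t j c) - (\<Sum>j\<le>p. s' j * cfg_reg p \<beta> t j c)\<bar>
     \<le> (\<Sum>j\<le>p. \<bar>(s j - s' j) * cfg_reg p \<beta> t j c\<bar>)"
    unfolding sum_subtractf[symmetric] left_diff_distrib[symmetric] by (rule sum_abs)
  also have "\<dots> \<le> (\<Sum>j\<le>p. \<eta> * \<bar>cfg_reg p \<beta> t j c\<bar>)"
    unfolding abs_mult using close by (intro sum_mono mult_right_mono) auto
  finally have *: "\<bar>(\<Sum>j\<le>p. s j * cfg_reg p \<beta> t j c) - (\<Sum>j\<le>p. s' j * cfg_reg p \<beta> t j c)\<bar>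
     \<le> \<eta> * (\<Sum>j\<le>p. \<bar>cfg_reg p \<beta> t j c\<bar>)"
    by (simp add: sum_distrib_left)
  show "cfg_perturb p \<beta> r s' (- \<eta>) t c \<le> cfg_perturb p \<beta> r s 0 t c"
    unfolding cfg_perturb_def using * by (intro add_left_mono mult_left_mono r) auto
  show "cfg_perturb p \<beta> r s 0 t c \<le> cfg_perturb p \<beta> r s' \<eta> t c"
    unfolding cfg_perturb_def using * by (intro add_left_mono mult_left_mono r) auto
qed

definition grid :: "nat \<Rightarrow> real \<Rightarrow> int \<Rightarrow> (nat \<Rightarrow> real) set" where
  "grid p \<eta> N = (\<lambda>g j. \<eta> * real_of_int (g j)) ` (PiE {..p} (\<lambda>_. {- N..N}))"

lemma finite_grid: "finite (grid p \<eta> N)"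
  unfolding grid_def by (intro finite_imageI finite_PiE) auto

lemma grid_bound: "s \<in> grid p \<eta> N \<Longrightarrow> j \<le> p \<Longrightarrow> 0 \<le> \<eta> \<Longrightarrow> \<bar>s j\<bar> \<le> \<eta> * real_of_int N"
proof -
  assume "s \<in> grid p \<eta> N" "j \<le> p" "0 \<le> \<eta>"
  then obtain g where g: "s = (\<lambda>j. \<eta> * real_of_int (g j))" "g j \<in> {- N..N}"
    by (auto simp: grid_def PiE_iff)
  then have "\<bar>real_of_int (g j)\<bar> \<le> real_of_int N" by auto
  then show ?thesis using g \<open>0 \<le> \<eta>\<close> by (simp add: abs_mult mult_left_mono)
qed

lemma grid_close:
  assumes \<eta>: "0 < \<eta>" and s: "\<And>j. j \<le> p \<Longrightarrow> \<bar>s j\<bar> \<le> C"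
  shows "\<exists>s'\<in>grid p \<eta> (\<lceil>C / \<eta>\<rceil> + 1). \<forall>j\<le>p. \<bar>s j - s' j\<bar> \<le> \<eta>"
proof -
  define g where "g = (\<lambda>j\<in>{..p}. \<lfloor>s j / \<eta>\<rfloor>)"
  have "g \<in> PiE {..p} (\<lambda>_. {- (\<lceil>C / \<eta>\<rceil> + 1)..\<lceil>C / \<eta>\<rceil> + 1})"
  proof (rule PiE_I)
    fix j assume "j \<in> {..p}"
    then have "\<bar>s j / \<eta>\<bar> \<le> C / \<eta>" using s[of j] \<eta> by (simp add: abs_divide divide_right_mono)
    then have "- (C / \<eta>) \<le> s j / \<eta>" "s j / \<eta> \<le> C / \<eta>" by (simp_all only: abs_le_iff minus_le_iff)
    then show "g j \<in> {- (\<lceil>C / \<eta>\<rceil> + 1)..\<lceil>C / \<eta>\<rceil> + 1}"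
      using \<open>j \<in> {..p}\<close> unfolding g_def by simp linarith
  qed (simp add: g_def)
  moreover have "\<bar>s j - \<eta> * real_of_int (g j)\<bar> \<le> \<eta>" if "j \<le> p" for j
  proof -
    have "\<bar>s j / \<eta> - real_of_int (g j)\<bar> \<le> 1" using that unfolding g_def by simp linarith
    then have "\<eta> * \<bar>s j / \<eta> - real_of_int (g j)\<bar> \<le> \<eta> * 1" using \<eta> by (intro mult_left_mono) auto
    moreover have "\<eta> * \<bar>s j / \<eta> - real_of_int (g j)\<bar> = \<bar>\<eta> * (s j / \<eta> - real_of_int (g j))\<bar>"
      using \<eta> by (simp add: abs_mult)
    moreover have "\<eta> * (s j / \<eta> - real_of_int (g j)) = s j - \<eta> * real_of_int (g j)"
      using \<eta> by (simp add: right_diff_distrib)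
    ultimately show ?thesis by simp
  qed
  ultimately show ?thesis unfolding grid_def by (intro bexI[of _ "\<lambda>j. \<eta> * real_of_int (g j)"]) auto
qed

section \<open>Symmetrized excess with estimated coefficients\<close>

context smooth_contaminated_ar
begin

definition mean_jump :: "real \<Rightarrow> real" where
  "mean_jump x = (\<Sum>j\<le>p. \<integral>u. A (x + ar_coeff \<beta> j * u) - A x \<partial>Q)"

definition level_excess :: "real \<Rightarrow> int set \<Rightarrow> (nat \<Rightarrow> real) \<Rightarrow> real \<Rightarrow> real \<Rightarrow> 'a \<Rightarrow> real" where
  "level_excess r T s \<kappa> x \<omega> = r * (\<Sum>t\<in>T. level (x + cfg_perturb p \<beta> r s \<kappa> t (cfg \<omega>)) (\<epsilon> t \<omega>) - level x (\<epsilon> t \<omega>))"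

definition level_error :: "real \<Rightarrow> int set \<Rightarrow> (nat \<Rightarrow> real) \<Rightarrow> real \<Rightarrow> real \<Rightarrow> 'a \<Rightarrow> real" where
  "level_error r T s \<kappa> x \<omega> = level_excess r T s \<kappa> x \<omega>
     - a x * (r\<^sup>2 * (\<Sum>t\<in>T. cfg_drift p \<beta> s \<kappa> t (cfg \<omega>))) - q / r * mean_jump x"

definition error_bound :: "real \<Rightarrow> real \<Rightarrow> real" where
  "error_bound r C = fluct_bound r C + (taylor_bound r C + outlier_bound r C) / r + (real p + 1) * sqrt q"

lemma level_error_bound:
  fixes r \<kappa> C x :: real and s :: "nat \<Rightarrow> real" and T :: "int set"
  assumes "0 \<le> r" "\<And>j. j \<le> p \<Longrightarrow> \<bar>s j\<bar> + \<bar>\<kappa>\<bar> \<le> C" "finite T" "r\<^sup>2 * card T = 1"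
  shows "expectation (\<lambda>\<omega>. \<bar>level_error r T s \<kappa> x \<omega>\<bar>) \<le> error_bound r C" "integrable M (level_error r T s \<kappa> x)"
  unfolding level_error_def level_excess_def mean_jump_def error_bound_def
  by (rule level_sum_expansion[where s=s and \<kappa>=\<kappa> and C=C]; fact assms)+

lemma markov:
  assumes "integrable M X" "0 < \<delta>"
  shows "prob {\<omega>\<in>space M. \<delta> < \<bar>X \<omega>\<bar>} \<le> expectation (\<lambda>\<omega>. \<bar>X \<omega>\<bar>) / \<delta>"
proof -
  have [measurable]: "X \<in> borel_measurable M" using assms(1) by auto
  have "prob {\<omega>\<in>space M. \<delta> < \<bar>X \<omega>\<bar>} \<le> prob {\<omega>\<in>space M. \<delta> \<le> \<bar>X \<omega>\<bar>}"
    by (intro finite_measure_mono) auto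
  also have "\<dots> \<le> expectation (\<lambda>\<omega>. \<bar>X \<omega>\<bar>) / \<delta>"
    using assms by (intro integral_Markov_inequality_measure[where A="space M"]) auto
  finally show ?thesis .
qed

text \<open>The random coefficients are replaced by a neighbouring grid point, at the price of widening
  the perturbation by \<open>\<plusminus>\<eta>\<close>; the drift then cancels between \<open>x\<close> and \<open>-x\<close> by symmetry of the density.\<close>

lemma symmetric_excess_bound:
  fixes s :: "nat \<Rightarrow> 'a \<Rightarrow> real" and r x \<eta> \<delta> C :: real and T :: "int set"
  assumes r: "0 < r" and fin: "finite T" and card: "r\<^sup>2 * card T = 1"
    and sym: "a (- x) = a x" and \<eta>: "0 < \<eta>" and \<delta>: "0 < \<delta>"
    and s: "\<And>j. j \<le> p \<Longrightarrow> s j \<in> borel_measurable M"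
    and D: "D \<in> borel_measurable M" "AE \<omega> in M. D \<omega> = level_excess r T (\<lambda>j. s j \<omega>) 0 x \<omega> - level_excess r T (\<lambda>j. s j \<omega>) 0 (- x) \<omega>"
  shows "prob {\<omega>\<in>space M. 5 * \<delta> < \<bar>D \<omega> - q / r * (mean_jump x - mean_jump (- x))\<bar>}
     \<le> prob {\<omega>\<in>space M. \<exists>j\<le>p. C < \<bar>s j \<omega>\<bar>}
       + real (card (grid p \<eta> (\<lceil>C / \<eta>\<rceil> + 1))) * (4 * (error_bound r (\<eta> * real_of_int (\<lceil>C / \<eta>\<rceil> + 1) + \<eta>) / \<delta>))
       + 2 * \<eta> * K1 * ((real p + 1) * moment) / \<delta>"
proof -
  let ?N = "\<lceil>C / \<eta>\<rceil> + 1"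
  define S where "S = grid p \<eta> ?N"
  define C' where "C' = \<eta> * real_of_int ?N + \<eta>"
  \<comment> \<open>Lower and upper enclosure at \<open>x\<close> and at \<open>- x\<close>.\<close>
  define J where "J = {(\<eta>, x), (- \<eta>, x), (\<eta>, - x), (- \<eta>, - x)}"
  define Ld where "Ld \<omega> = 2 * \<eta> * a x * (r\<^sup>2 * (\<Sum>t\<in>T. lead t (cfg \<omega>)))" for \<omega>
  have S: "finite S" unfolding S_def by (rule finite_grid)
  have J: "finite J" "card J \<le> 4" unfolding J_def by (auto simp: card_insert_if)
  have err: "expectation (\<lambda>\<omega>. \<bar>level_error r T s' \<kappa> y \<omega>\<bar>) \<le> error_bound r C'" "integrable M (level_error r T s' \<kappa> y)"
    if "s' \<in> S" "(\<kappa>, y) \<in> J" for s' \<kappa> y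
  proof -
    have "\<bar>s' j\<bar> + \<bar>\<kappa>\<bar> \<le> C'" if "j \<le> p" for j
      using grid_bound[OF \<open>s' \<in> S\<close>[unfolded S_def] that] \<eta> \<open>(\<kappa>, y) \<in> J\<close> by (auto simp: J_def C'_def)
    then show "expectation (\<lambda>\<omega>. \<bar>level_error r T s' \<kappa> y \<omega>\<bar>) \<le> error_bound r C'" "integrable M (level_error r T s' \<kappa> y)"
      using r fin card by (intro level_error_bound; simp)+
  qed
  \<comment> \<open>The slope inherits the Lipschitz constant: the Taylor bound is divided by a step
    \<open>h\<close>, chosen so small that the remainder \<open>K2 * h\<close> stays below
    \<open>e\<close>.\<close>
  have a_bd: "\<bar>a x\<bar> \<le> K1"
  proof (rule field_le_epsilon)
    fix e :: real assume e: "e > 0"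
    define h where "h = e / (K2 + 1)"
    have h: "h > 0" using e K_nonneg by (simp add: h_def)
    have "\<bar>a x\<bar> * h \<le> \<bar>A (x + h) - A x\<bar> + K2 * h\<^sup>2"
      using taylor[of x h] h abs_mult[of "a x" h] by simp
    also have "\<dots> \<le> K1 * h + K2 * h\<^sup>2"
      using lipschitz[of "x + h" x] h by simp
    finally have "\<bar>a x\<bar> * h \<le> (K1 + K2 * h) * h" by (simp add: power2_eq_square algebra_simps)
    then have "\<bar>a x\<bar> \<le> K1 + K2 * h" using h by simp
    also have "K2 * h \<le> e" using e K_nonneg unfolding h_def by (simp add: field_simps)
    finally show "\<bar>a x\<bar> \<le> K1 + e" by simp
  qed
  have iLd: "integrable M Ld" unfolding Ld_def using lead_first_moment(1) by simp
  have Ld: "expectation (\<lambda>\<omega>. \<bar>Ld \<omega>\<bar>) \<le> 2 * \<eta> * K1 * ((real p + 1) * moment)"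
  proof -
    have "expectation (\<lambda>\<omega>. \<bar>Ld \<omega>\<bar>) = expectation (\<lambda>\<omega>. 2 * \<eta> * \<bar>a x\<bar> * (r\<^sup>2 * (\<Sum>t\<in>T. lead t (cfg \<omega>))))"
      unfolding Ld_def using \<eta> by (simp add: abs_mult sum_nonneg lead_nonneg)
    also have "\<dots> = 2 * \<eta> * \<bar>a x\<bar> * (r\<^sup>2 * (\<Sum>t\<in>T. expectation (\<lambda>\<omega>. lead t (cfg \<omega>))))"
      using lead_first_moment(1) by simp
    also have "\<dots> \<le> 2 * \<eta> * \<bar>a x\<bar> * (r\<^sup>2 * (\<Sum>t\<in>T. (real p + 1) * moment))"
      using \<eta> by (intro mult_left_mono sum_mono lead_first_moment(2)) auto
    also have "r\<^sup>2 * (\<Sum>t\<in>T. (real p + 1) * moment) = (r\<^sup>2 * card T) * ((real p + 1) * moment)"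
      by simp
    also have "\<dots> = (real p + 1) * moment" unfolding card by simp
    also have "2 * \<eta> * \<bar>a x\<bar> * ((real p + 1) * moment) \<le> 2 * \<eta> * K1 * ((real p + 1) * moment)"
      using \<eta> a_bd moment_ge_1 by (intro mult_right_mono mult_left_mono) auto
    finally show ?thesis .
  qed
  let ?bad = "{\<omega>\<in>space M. 5 * \<delta> < \<bar>D \<omega> - q / r * (mean_jump x - mean_jump (- x))\<bar>}"
  let ?B1 = "{\<omega>\<in>space M. \<exists>j\<le>p. C < \<bar>s j \<omega>\<bar>}"
  let ?B2 = "\<lambda>(s', (\<kappa>, y)). {\<omega>\<in>space M. \<delta> < \<bar>level_error r T s' \<kappa> y \<omega>\<bar>}"
  let ?B3 = "{\<omega>\<in>space M. \<delta> < \<bar>Ld \<omega>\<bar>}"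
  have key: "\<bar>d - q / r * (mean_jump x - mean_jump (- x))\<bar> \<le> 5 * \<delta>"
    if d: "d = level_excess r T (\<lambda>j. s j \<omega>) 0 x \<omega> - level_excess r T (\<lambda>j. s j \<omega>) 0 (- x) \<omega>"
      and C: "\<And>j. j \<le> p \<Longrightarrow> \<bar>s j \<omega>\<bar> \<le> C"
      and small: "\<And>s' \<kappa> y. s' \<in> S \<Longrightarrow> (\<kappa>, y) \<in> J \<Longrightarrow> \<bar>level_error r T s' \<kappa> y \<omega>\<bar> \<le> \<delta>"
      and ld: "\<bar>Ld \<omega>\<bar> \<le> \<delta>" for \<omega> d
  proof -
    obtain s' where s': "s' \<in> S" "\<And>j. j \<le> p \<Longrightarrow> \<bar>s j \<omega> - s' j\<bar> \<le> \<eta>"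
      using grid_close[of \<eta> p "\<lambda>j. s j \<omega>" C] \<eta> C unfolding S_def by blast
    have mono: "level_excess r T s' (- \<eta>) y \<omega> \<le> level_excess r T (\<lambda>j. s j \<omega>) 0 y \<omega>"
      "level_excess r T (\<lambda>j. s j \<omega>) 0 y \<omega> \<le> level_excess r T s' \<eta> y \<omega>" for y
    proof -
      have lm: "level u e \<le> level u' e" if "u \<le> u'" for u u' e
        using that by (auto simp: level_def)
      show "level_excess r T s' (- \<eta>) y \<omega> \<le> level_excess r T (\<lambda>j. s j \<omega>) 0 y \<omega>"
        "level_excess r T (\<lambda>j. s j \<omega>) 0 y \<omega> \<le> level_excess r T s' \<eta> y \<omega>"
        unfolding level_excess_def using r s'(2)
        by (intro mult_left_mono sum_mono diff_right_mono lm add_left_mono level_perturb_sandwich; simp)+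
    qed
    \<comment> \<open>Drift of the grid point itself. It is the same at \<open>x\<close> and
      \<open>- x\<close> because \<open>a\<close> takes equal values there, so it cancels in the
      difference whatever its size.\<close>
    define b where "b = a x * (r\<^sup>2 * (\<Sum>t\<in>T. \<Sum>j\<le>p. s' j * cfg_clean p \<beta> t j (cfg \<omega>)))"
    have drift: "a y * (r\<^sup>2 * (\<Sum>t\<in>T. cfg_drift p \<beta> s' \<kappa> t (cfg \<omega>))) = b + \<kappa> / (2 * \<eta>) * Ld \<omega>"
      if "y = x \<or> y = - x" for y \<kappa>
    proof -
      have "(\<Sum>t\<in>T. cfg_drift p \<beta> s' \<kappa> t (cfg \<omega>))
         = (\<Sum>t\<in>T. \<Sum>j\<le>p. s' j * cfg_clean p \<beta> t j (cfg \<omega>)) + \<kappa> * (\<Sum>t\<in>T. lead t (cfg \<omega>))"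
        by (simp add: cfg_drift_def lead_def sum.distrib sum_distrib_left)
      moreover have "\<kappa> / (2 * \<eta>) * Ld \<omega> = \<kappa> * (a x * (r\<^sup>2 * (\<Sum>t\<in>T. lead t (cfg \<omega>))))"
        using \<eta> by (simp add: Ld_def)
      moreover have "a y = a x" using that sym by auto
      ultimately show ?thesis by (simp add: b_def algebra_simps)
    qed
    have \<eta>1: "\<eta> / (2 * \<eta>) = 1 / 2" "- \<eta> / (2 * \<eta>) = - 1 / 2" using \<eta> by auto
    have E: "level_excess r T s' \<kappa> y \<omega> = level_error r T s' \<kappa> y \<omega> + (b + \<kappa> / (2 * \<eta>) * Ld \<omega>) + q / r * mean_jump y"
      if "y = x \<or> y = - x" for y \<kappa>
      unfolding level_error_def drift[OF that] by simp
    note Es = E[of x \<eta>, unfolded \<eta>1] E[of x "- \<eta>", unfolded \<eta>1] E[of "- x" \<eta>, unfolded \<eta>1] E[of "- x" "- \<eta>", unfolded \<eta>1]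
    have sm: "\<bar>level_error r T s' \<eta> x \<omega>\<bar> \<le> \<delta>" "\<bar>level_error r T s' (- \<eta>) x \<omega>\<bar> \<le> \<delta>"
      "\<bar>level_error r T s' \<eta> (- x) \<omega>\<bar> \<le> \<delta>" "\<bar>level_error r T s' (- \<eta>) (- x) \<omega>\<bar> \<le> \<delta>"
      using small[OF s'(1)] by (auto simp: J_def)
    \<comment> \<open>The upper enclosure at \<open>x\<close> minus the lower one at
      \<open>- x\<close> differs from the target by two level errors and one \<open>Ld\<close>, so
      by at most \<open>3 * \<delta>\<close>; the constant 5 leaves slack.\<close>
    show ?thesis
      using Es mono[of x] mono[of "- x"] sm ld \<delta> unfolding d right_diff_distrib abs_le_iff by auto
  qed
  have meas: "?B1 \<in> events" "?B3 \<in> events" "?bad \<in> events"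
    using s D(1) iLd by (auto intro!: sets.sets_Collect)
  have meas2: "?B2 u \<in> events" if "u \<in> S \<times> J" for u
    using that err(2) by (auto split: prod.split)
  have "prob ?bad \<le> prob (?B1 \<union> (\<Union>u\<in>S \<times> J. ?B2 u) \<union> ?B3)"
  proof (rule finite_measure_mono_AE)
    show "AE \<omega> in M. \<omega> \<in> ?bad \<longrightarrow> \<omega> \<in> ?B1 \<union> (\<Union>u\<in>S \<times> J. ?B2 u) \<union> ?B3"
      using D(2)
    proof eventually_elim
      case (elim \<omega>)
      show ?case
      proof (intro impI, rule ccontr)
        assume bad: "\<omega> \<in> ?bad" and "\<omega> \<notin> ?B1 \<union> (\<Union>u\<in>S \<times> J. ?B2 u) \<union> ?B3"
        then have notin: "\<omega> \<notin> ?B1" "\<And>u. u \<in> S \<times> J \<Longrightarrow> \<omega> \<notin> ?B2 u" "\<omega> \<notin> ?B3" and sp: "\<omega> \<in> space M"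
          by blast+
        have "\<bar>D \<omega> - q / r * (mean_jump x - mean_jump (- x))\<bar> \<le> 5 * \<delta>"
        proof (rule key[OF elim])
          show "\<bar>s j \<omega>\<bar> \<le> C" if "j \<le> p" for j
            using notin(1) sp that by (auto simp: not_less)
          show "\<bar>level_error r T s' \<kappa> y \<omega>\<bar> \<le> \<delta>" if "s' \<in> S" "(\<kappa>, y) \<in> J" for s' \<kappa> y
            using notin(2)[of "(s', (\<kappa>, y))"] sp that by (simp add: not_less)
          show "\<bar>Ld \<omega>\<bar> \<le> \<delta>" using notin(3) sp by (simp add: not_less)
        qed
        with bad show False by simp
      qed
    qed
    show "?B1 \<union> (\<Union>u\<in>S \<times> J. ?B2 u) \<union> ?B3 \<in> events"
      by (intro sets.Un meas sets.finite_UN finite_cartesian_product S J(1) meas2)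
  qed
  also have "\<dots> \<le> prob ?B1 + prob (\<Union>u\<in>S \<times> J. ?B2 u) + prob ?B3"
  proof -
    have u: "(\<Union>u\<in>S \<times> J. ?B2 u) \<in> events"
      by (intro sets.finite_UN finite_cartesian_product S J(1) meas2)
    show ?thesis
      using measure_Un_le[OF sets.Un[OF meas(1) u] meas(2)] measure_Un_le[OF meas(1) u] by linarith
  qed
  also have "prob (\<Union>u\<in>S \<times> J. ?B2 u) \<le> (\<Sum>u\<in>S \<times> J. prob (?B2 u))"
    by (intro measure_UNION_le finite_cartesian_product S J(1) meas2)
  also have "\<dots> \<le> (\<Sum>u\<in>S \<times> J. error_bound r C' / \<delta>)"
  proof (rule sum_mono)
    fix u assume "u \<in> S \<times> J"
    then obtain s' \<kappa> y where u: "u = (s', (\<kappa>, y))" "s' \<in> S" "(\<kappa>, y) \<in> J" by auto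
    have "prob {\<omega>\<in>space M. \<delta> < \<bar>level_error r T s' \<kappa> y \<omega>\<bar>} \<le> expectation (\<lambda>\<omega>. \<bar>level_error r T s' \<kappa> y \<omega>\<bar>) / \<delta>"
      using err(2)[OF u(2,3)] \<delta> by (rule markov)
    also have "\<dots> \<le> error_bound r C' / \<delta>"
      using err(1)[OF u(2,3)] \<delta> by (simp add: divide_right_mono)
    finally show "prob (?B2 u) \<le> error_bound r C' / \<delta>" by (simp add: u)
  qed
  also have "\<dots> = real (card S) * (real (card J) * (error_bound r C' / \<delta>))"
    by (simp add: card_cartesian_product)
  also have "\<dots> \<le> real (card S) * (4 * (error_bound r C' / \<delta>))"
  proof (cases "S = {}")
    case False
    then obtain s' where "s' \<in> S" by auto
    have "0 \<le> expectation (\<lambda>\<omega>. \<bar>level_error r T s' \<eta> x \<omega>\<bar>)" by simp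
    also have "\<dots> \<le> error_bound r C'" using \<open>s' \<in> S\<close> by (intro err) (auto simp: J_def)
    finally have "0 \<le> error_bound r C' / \<delta>" using \<delta> by simp
    then show ?thesis using J(2) by (intro mult_left_mono mult_right_mono) auto
  qed simp
  also have "prob ?B3 \<le> 2 * \<eta> * K1 * ((real p + 1) * moment) / \<delta>"
    using markov[OF iLd \<delta>] Ld \<delta> by (meson divide_right_mono less_imp_le order_trans)
  finally show ?thesis by (simp add: S_def C'_def)
qed

text \<open>Inserting the model into the residual is exact algebra: the error of \<open>mu\<close>
  acts on the constant regressor, the errors of \<open>b\<close> on the lagged contaminated values.
  The quantifiers over \<open>mu\<close> and \<open>b\<close> stand inside the almost sure
  statement, so that data-dependent values may be substituted outcome by outcome.\<close>

lemma AE_residual: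
  fixes n :: nat
  assumes mu: "\<nu> = (1 - (\<Sum>j=1..p. \<beta> j)) * \<mu>" and r: "r > 0"
  shows "AE \<omega> in M. \<forall>mu b. \<forall>t\<in>{1..int n}. residual p mu b (observations p n v z \<xi> \<omega>) t
     = \<epsilon> t \<omega> - cfg_perturb p \<beta> r (\<lambda>j. if j = 0 then (mu - \<mu>) * (1 - (\<Sum>j=1..p. b j)) / r else (b j - \<beta> j) / r) 0 t (cfg \<omega>)"
proof -
  have rec: "AE \<omega> in M. \<forall>t. v t \<omega> = (\<Sum>j=1..p. \<beta> j * v (t - int j) \<omega>) + \<nu> + \<epsilon> t \<omega>"
    using recursion by (intro AE_all_countable[THEN iffD2] allI)
  show ?thesis
    using rec AE_eq_ma[OF stable mu]
  proof eventually_elim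
    case (elim \<omega>)
    show ?case
    proof (intro allI ballI)
      fix mu :: real and b :: "nat \<Rightarrow> real" and t assume t: "t \<in> {1..int n}"
      define Y where "Y t' = ma t' \<omega> + cfg_outlier t' (cfg \<omega>)" for t'
      have obs: "observations p n v z \<xi> \<omega> (t - int j) = \<mu> + Y (t - int j)" if "j \<le> p" for j
        using t that elim(2) by (auto simp: observations_def sample_window_def Y_def cfg_outlier_def)
      have ma_rec: "ma t \<omega> = (\<Sum>j=1..p. \<beta> j * ma (t - int j) \<omega>) + \<epsilon> t \<omega>"
      proof -
        have "\<mu> + ma t \<omega> = (\<Sum>j=1..p. \<beta> j * (\<mu> + ma (t - int j) \<omega>)) + \<nu> + \<epsilon> t \<omega>"
          using elim(1)[rule_format, of t] unfolding elim(2)[rule_format] .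
        then show ?thesis
          by (simp add: mu distrib_left sum.distrib sum_distrib_right left_diff_distrib)
      qed
      have "{..p} = insert 0 {1..p}" by auto
      then have split: "(\<Sum>j\<le>p. f j) = f 0 + (\<Sum>j=1..p. f j)" for f :: "nat \<Rightarrow> real"
        by simp
      have "residual p mu b (observations p n v z \<xi> \<omega>) t = (Y t - (mu - \<mu>)) - (\<Sum>j=1..p. b j * (Y (t - int j) - (mu - \<mu>)))"
        unfolding residual_def using obs obs[of 0] by (simp add: algebra_simps)
      also have "\<dots> = Y t - (\<Sum>j=1..p. \<beta> j * Y (t - int j)) - (\<Sum>j=1..p. (b j - \<beta> j) * Y (t - int j)) - (mu - \<mu>) * (1 - (\<Sum>j=1..p. b j))"
        by (simp add: algebra_simps sum.distrib sum_subtractf sum_distrib_left)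
      also have "Y t - (\<Sum>j=1..p. \<beta> j * Y (t - int j)) = \<epsilon> t \<omega> - cfg_shift p \<beta> t (cfg \<omega>)"
        unfolding cfg_shift_def split Y_def ar_coeff_def
        by (simp add: ma_rec distrib_left sum.distrib) 
      also have "\<epsilon> t \<omega> - cfg_shift p \<beta> t (cfg \<omega>) - (\<Sum>j=1..p. (b j - \<beta> j) * Y (t - int j)) - (mu - \<mu>) * (1 - (\<Sum>j=1..p. b j))
         = \<epsilon> t \<omega> - cfg_perturb p \<beta> r (\<lambda>j. if j = 0 then (mu - \<mu>) * (1 - (\<Sum>j=1..p. b j)) / r else (b j - \<beta> j) / r) 0 t (cfg \<omega>)"
        unfolding cfg_perturb_def split using r
        by (simp add: cfg_reg_def cfg_ma Y_def distrib_left sum_distrib_left mult.assoc)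
      finally show "residual p mu b (observations p n v z \<xi> \<omega>) t
        = \<epsilon> t \<omega> - cfg_perturb p \<beta> r (\<lambda>j. if j = 0 then (mu - \<mu>) * (1 - (\<Sum>j=1..p. b j)) / r else (b j - \<beta> j) / r) 0 t (cfg \<omega>)" .
    qed
  qed
qed

end

section \<open>Smooth symmetric laws and cells\<close>

lemma symmetric_cdf:
  assumes "real_distribution G" and sym: "distr G borel uminus = G" and cont: "\<And>x. isCont (cdf G) x"
  shows "cdf G (- x) = 1 - cdf G x"
proof -
  interpret G: real_distribution G by fact
  have "cdf G (- x) = measure (distr G borel uminus) {..- x}"
    by (simp only: cdf_def sym)
  also have "\<dots> = measure G {x..}"
    by (subst measure_distr) (auto intro!: arg_cong[where f="measure G"])
  also have "{x..} = space G - {..<x}" by auto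
  also have "measure G \<dots> = 1 - measure G {..<x}" by (subst G.prob_compl) auto
  also have "measure G {..<x} = measure G {..x} - measure G {x}"
    by (subst G.finite_measure_Diff[symmetric]) (auto intro!: arg_cong[where f="measure G"])
  also have "measure G {x} = 0" using cont[of x] by (simp add: G.isCont_cdf)
  finally show ?thesis by (simp add: cdf_def)
qed

lemma smooth_symmetric_cdf:
  assumes G: "real_distribution G" and smooth: "twice_diff_bounded (cdf G)" and sym: "distr G borel uminus = G"
  obtains g K1 K2 where "\<And>x y. \<bar>cdf G y - cdf G x\<bar> \<le> K1 * \<bar>y - x\<bar>"
    "\<And>x h. \<bar>cdf G (x + h) - cdf G x - g x * h\<bar> \<le> K2 * h\<^sup>2" "\<And>x. g (- x) = g x"
    "\<And>x. cdf G (- x) = 1 - cdf G x"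
proof -
  interpret G: real_distribution G by fact
  obtain g g' where g: "\<And>x. (cdf G has_real_derivative g x) (at x)"
    "\<And>x. (g has_real_derivative g' x) (at x)" and bd: "bounded (range g')"
    using smooth unfolding twice_diff_bounded_def by blast
  obtain B where B: "\<And>x. \<bar>g' x\<bar> \<le> B" using bd by (auto simp: bounded_iff)
  have B0: "0 \<le> B" using B[of 0] by linarith
  have g_lip: "\<bar>g y - g x\<bar> \<le> B * \<bar>y - x\<bar>" for x y
    using field_differentiable_bound[of UNIV g g' B y x] g(2) B by auto
  have tay: "\<bar>cdf G (x + h) - cdf G x - g x * h\<bar> \<le> B * h\<^sup>2" for x h
  proof -
    define \<phi> where "\<phi> u = cdf G u - g x * u" for u
    have "norm (\<phi> (x + h) - \<phi> x) \<le> (B * \<bar>h\<bar>) * norm (x + h - x)"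
    proof (rule field_differentiable_bound[of "closed_segment x (x + h)"])
      fix u assume u: "u \<in> closed_segment x (x + h)"
      show "(\<phi> has_real_derivative g u - g x) (at u within closed_segment x (x + h))"
        unfolding \<phi>_def by (rule derivative_eq_intros has_field_derivative_at_within[OF g(1)] refl)+ simp
      have "\<bar>u - x\<bar> \<le> \<bar>h\<bar>" using u by (auto simp: closed_segment_eq_real_ivl split: if_splits)
      then have "B * \<bar>u - x\<bar> \<le> B * \<bar>h\<bar>" using B0 by (rule mult_left_mono)
      then show "norm (g u - g x) \<le> B * \<bar>h\<bar>" using g_lip[of u x] by simp
    qed auto
    then show ?thesis by (simp add: \<phi>_def algebra_simps power2_eq_square abs_mult_self_eq)
  qed
  \<comment> \<open>A distribution function varies by at most 1 over a unit step, so the Taylor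
    bound with \<open>h = 1\<close> bounds the density by \<open>1 + B\<close>.\<close>
  have g_bd: "\<bar>g x\<bar> \<le> 1 + B" for x
    using tay[of x 1] G.cdf_nonneg[of x] G.cdf_bounded_prob[of x] G.cdf_nonneg[of "x + 1"] G.cdf_bounded_prob[of "x + 1"]
    by simp
  have lip: "\<bar>cdf G y - cdf G x\<bar> \<le> (1 + B) * \<bar>y - x\<bar>" for x y
    using field_differentiable_bound[of UNIV "cdf G" g "1 + B" y x] g(1) g_bd by auto
  have cdf_sym: "cdf G (- x) = 1 - cdf G x" for x
    using DERIV_isCont[OF g(1)] by (rule symmetric_cdf[OF G sym])
  have "g (- x) = g x" for x
  proof -
    have "((\<lambda>x. cdf G (- x)) has_real_derivative g (- x) * (- 1)) (at x)"
      by (rule DERIV_chain2[OF g(1)]) (auto intro!: derivative_eq_intros)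
    moreover have "((\<lambda>x. cdf G (- x)) has_real_derivative 0 - g x) (at x)"
      unfolding cdf_sym by (intro derivative_intros g)
    ultimately show ?thesis using DERIV_unique by fastforce
  qed
  then show ?thesis using that lip tay cdf_sym by blast
qed

text \<open>Only the distribution function of \<open>D\<close> is known to be a mixture. A two-stage
  measure, a Bernoulli choice followed by \<open>G\<close> or \<open>H\<close>, has the same
  distribution function, hence equals \<open>D\<close>, and its second moment can be computed. The
  bound is free of the weight \<open>w\<close>.\<close>

lemma mixture_second_moment:
  assumes D: "real_distribution D" and G: "real_distribution G" and H: "real_distribution H"
    and w: "0 \<le> w" "w \<le> 1" and cdf: "cdf D = (\<lambda>u. (1 - w) * cdf G u + w * cdf H u)"
    and sq: "integrable G (\<lambda>u. u\<^sup>2)" "integrable H (\<lambda>u. u\<^sup>2)"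
  shows "(\<integral>u. u\<^sup>2 \<partial>D) \<le> (\<integral>u. u\<^sup>2 \<partial>G) + (\<integral>u. u\<^sup>2 \<partial>H)"
proof -
  interpret D: real_distribution D by fact
  interpret G: real_distribution G by fact
  interpret H: real_distribution H by fact
  define K where "K b = (if b then H else G)" for b
  define N where "N = measure_pmf (bernoulli_pmf w) \<bind> K"
  have K: "K b \<in> space (prob_algebra borel)" for b
    by (auto simp: K_def space_prob_algebra G.prob_space_axioms H.prob_space_axioms)
  have K_meas: "K \<in> measurable (measure_pmf (bernoulli_pmf w)) (prob_algebra borel)"
    using K by (simp add: measurable_def)
  have K_sub: "K \<in> measurable (measure_pmf (bernoulli_pmf w)) (subprob_algebra borel)"
    using K_meas by (rule measurable_prob_algebraD)
  have em: "emeasure N X = emeasure H X * w + emeasure G X * (1 - w)" if "X \<in> sets borel" for X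
    unfolding N_def using w that by (subst emeasure_bind[OF _ K_sub]) (auto simp: K_def)
  have "prob_space N"
    unfolding N_def using K by (intro measure_pmf.prob_space_bind[OF _ K_sub]) (simp add: space_prob_algebra)
  moreover have "sets N = sets borel"
    unfolding N_def by (rule sets_bind[OF sets_kernel[OF K_sub]]) auto
  ultimately have N: "real_distribution N"
    by (simp add: real_distribution_def real_distribution_axioms_def)
  interpret N: real_distribution N by fact
  have "cdf N = cdf D"
  proof
    fix u
    have "ennreal (measure N {..u}) = ennreal (measure H {..u} * w + measure G {..u} * (1 - w))"
      using em[of "{..u}"] w by (simp add: N.emeasure_eq_measure G.emeasure_eq_measure H.emeasure_eq_measure
          ennreal_mult ennreal_plus)
    then have "measure N {..u} = measure H {..u} * w + measure G {..u} * (1 - w)"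
      using w by (subst (asm) ennreal_inj) auto
    then show "cdf N u = cdf D u"
      unfolding cdf by (simp add: cdf_def mult.commute add.commute)
  qed
  then have ND: "N = D" by (intro cdf_unique N D)
  have "(\<integral>\<^sup>+u. ennreal (u\<^sup>2) \<partial>D) = (\<integral>\<^sup>+u. ennreal (u\<^sup>2) \<partial>H) * w + (\<integral>\<^sup>+u. ennreal (u\<^sup>2) \<partial>G) * (1 - w)"
    unfolding ND[symmetric] N_def using w by (subst nn_integral_bind[OF _ K_sub]) (auto simp: K_def)
  also have "\<dots> = ennreal ((\<integral>u. u\<^sup>2 \<partial>H) * w + (\<integral>u. u\<^sup>2 \<partial>G) * (1 - w))"
    using w sq by (simp add: nn_integral_eq_integral ennreal_mult ennreal_plus)
  finally have *: "(\<integral>\<^sup>+u. ennreal (u\<^sup>2) \<partial>D) = ennreal ((\<integral>u. u\<^sup>2 \<partial>H) * w + (\<integral>u. u\<^sup>2 \<partial>G) * (1 - w))" .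
  have nn: "0 \<le> (\<integral>u. u\<^sup>2 \<partial>H) * w + (\<integral>u. u\<^sup>2 \<partial>G) * (1 - w)"
    using w by (intro add_nonneg_nonneg mult_nonneg_nonneg) auto
  have "(\<integral>u. u\<^sup>2 \<partial>D) = enn2real (\<integral>\<^sup>+u. ennreal (u\<^sup>2) \<partial>D)"
    by (rule integral_eq_nn_integral) auto
  also have "\<dots> = (\<integral>u. u\<^sup>2 \<partial>H) * w + (\<integral>u. u\<^sup>2 \<partial>G) * (1 - w)"
    by (simp only: * enn2real_ennreal[OF nn])
  also have "\<dots> \<le> (\<integral>u. u\<^sup>2 \<partial>H) * 1 + (\<integral>u. u\<^sup>2 \<partial>G) * 1"
    using w by (intro add_mono mult_left_mono) auto
  finally show ?thesis by simp
qed

text \<open>With \<open>u = sqrt t * \<bar>s\<bar>\<close> the derivative has modulus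
  \<open>sqrt t * u * exp (- u\<^sup>2 / 2)\<close>, and \<open>u \<le> exp (u\<^sup>2 / 2)\<close>.
  Applied to Euclidean norms, this makes the exponential of a quadratic form Lipschitz in the
  underlying vector.\<close>

lemma exp_square_lipschitz:
  fixes t :: real
  assumes t: "0 \<le> t"
  shows "\<bar>exp (- (t / 2) * y\<^sup>2) - exp (- (t / 2) * x\<^sup>2)\<bar> \<le> sqrt t * \<bar>y - x\<bar>"
proof -
  have "norm (exp (- (t / 2) * y\<^sup>2) - exp (- (t / 2) * x\<^sup>2)) \<le> sqrt t * norm (y - x)"
  proof (rule field_differentiable_bound[of UNIV "\<lambda>s. exp (- (t / 2) * s\<^sup>2)" "\<lambda>s. - t * s * exp (- (t / 2) * s\<^sup>2)"])
    fix s :: real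
    show "((\<lambda>s. exp (- (t / 2) * s\<^sup>2)) has_real_derivative - t * s * exp (- (t / 2) * s\<^sup>2)) (at s within UNIV)"
      by (auto intro!: derivative_eq_intros)
    define u where "u = sqrt t * \<bar>s\<bar>"
    have u: "0 \<le> u" "u\<^sup>2 = t * s\<^sup>2" using t by (auto simp: u_def power_mult_distrib)
    have "0 \<le> (u - 1)\<^sup>2" by simp
    then have "u \<le> 1 + u\<^sup>2 / 2" by (simp add: power2_diff)
    also have "\<dots> \<le> exp (u\<^sup>2 / 2)" by (rule exp_ge_add_one_self)
    finally have "u * exp (- (u\<^sup>2 / 2)) \<le> 1" by (simp add: exp_minus field_simps)
    then have "sqrt t * (u * exp (- (u\<^sup>2 / 2))) \<le> sqrt t * 1" using t by (intro mult_left_mono) auto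
    moreover have "norm (- t * s * exp (- (t / 2) * s\<^sup>2)) = sqrt t * (u * exp (- (u\<^sup>2 / 2)))"
    proof -
      have "sqrt t * u = t * \<bar>s\<bar>" unfolding u_def mult.assoc[symmetric] using t by simp
      then show ?thesis using t by (simp add: u(2) abs_mult mult.assoc[symmetric])
    qed
    ultimately show "norm (- t * s * exp (- (t / 2) * s\<^sup>2)) \<le> sqrt t" by simp
  qed auto
  then show ?thesis by simp
qed

section \<open>Negligible perturbations of Laplace transforms\<close>

lemma L2_set_diff_le:
  "\<bar>L2_set f I - L2_set g I\<bar> \<le> L2_set (\<lambda>i. f i - g i) I"
proof -
  have "L2_set f I \<le> L2_set (\<lambda>i. f i - g i) I + L2_set g I"
    using L2_set_triangle_ineq[of "\<lambda>i. f i - g i" g I] by simp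
  moreover have "L2_set g I \<le> L2_set (\<lambda>i. g i - f i) I + L2_set f I"
    using L2_set_triangle_ineq[of "\<lambda>i. g i - f i" f I] by simp
  moreover have "L2_set (\<lambda>i. g i - f i) I = L2_set (\<lambda>i. f i - g i) I"
    by (simp add: L2_set_def power2_commute)
  ultimately show ?thesis by linarith
qed

text \<open>Convergence to zero in probability, with a probability space that changes along the
  sequence.\<close>

definition conv_prob0 :: "(nat \<Rightarrow> 'a measure) \<Rightarrow> (nat \<Rightarrow> 'a \<Rightarrow> real) \<Rightarrow> bool" where
  "conv_prob0 M X \<longleftrightarrow> (\<forall>\<delta>>0. (\<lambda>k. measure (M k) {\<omega> \<in> space (M k). \<delta> < \<bar>X k \<omega>\<bar>}) \<longlonglongrightarrow> 0)"

lemma conv_prob0_diff: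
  assumes M: "\<And>k. prob_space (M k)" and X: "conv_prob0 M X" "\<And>k. X k \<in> borel_measurable (M k)"
    and Y: "conv_prob0 M Y" "\<And>k. Y k \<in> borel_measurable (M k)"
  shows "conv_prob0 M (\<lambda>k \<omega>. X k \<omega> - Y k \<omega>)"
  unfolding conv_prob0_def
proof (intro allI impI)
  fix \<delta> :: real assume \<delta>: "\<delta> > 0"
  let ?P = "\<lambda>Z k. measure (M k) {\<omega> \<in> space (M k). \<delta> / 2 < \<bar>Z k \<omega>\<bar>}"
  have lim: "(\<lambda>k. ?P X k + ?P Y k) \<longlonglongrightarrow> 0 + 0"
    by (intro tendsto_add X(1)[unfolded conv_prob0_def, rule_format] Y(1)[unfolded conv_prob0_def, rule_format])
      (use \<delta> in simp_all)
  have bd: "measure (M k) {\<omega> \<in> space (M k). \<delta> < \<bar>X k \<omega> - Y k \<omega>\<bar>} \<le> ?P X k + ?P Y k" for k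
  proof -
    interpret prob_space "M k" by (rule M)
    note [measurable] = X(2) Y(2)
    have "prob {\<omega> \<in> space (M k). \<delta> < \<bar>X k \<omega> - Y k \<omega>\<bar>}
      \<le> prob ({\<omega> \<in> space (M k). \<delta> / 2 < \<bar>X k \<omega>\<bar>} \<union> {\<omega> \<in> space (M k). \<delta> / 2 < \<bar>Y k \<omega>\<bar>})"
      by (intro finite_measure_mono) auto
    also have "\<dots> \<le> ?P X k + ?P Y k" by (intro measure_Un_le) auto
    finally show ?thesis .
  qed
  show "(\<lambda>k. measure (M k) {\<omega> \<in> space (M k). \<delta> < \<bar>X k \<omega> - Y k \<omega>\<bar>}) \<longlonglongrightarrow> 0"
  proof (rule Lim_null_comparison)
    show "(\<lambda>k. ?P X k + ?P Y k) \<longlonglongrightarrow> 0" using lim by (simp only: add_0)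
    show "\<forall>\<^sub>F k in sequentially. norm (measure (M k) {\<omega> \<in> space (M k). \<delta> < \<bar>X k \<omega> - Y k \<omega>\<bar>}) \<le> ?P X k + ?P Y k"
      unfolding real_norm_def abs_of_nonneg[OF measure_nonneg] by (intro always_eventually allI bd)
  qed
qed

text \<open>A form of Slutsky's lemma: the exponential of the quadratic form is bounded by 1 and
  globally Lipschitz, so a perturbation below \<open>\<delta>\<close> changes the integral little
  and the exceptional set costs at most its probability.\<close>

lemma laplace_perturb:
  fixes y e :: "nat \<Rightarrow> 'i \<Rightarrow> 'a \<Rightarrow> real"
  assumes M: "\<And>k. prob_space (M k)" and fin: "finite I" and t: "0 \<le> t"
    and y: "\<And>k i. i \<in> I \<Longrightarrow> y k i \<in> borel_measurable (M k)"
    and e: "\<And>k i. i \<in> I \<Longrightarrow> e k i \<in> borel_measurable (M k)" "\<And>i. i \<in> I \<Longrightarrow> conv_prob0 M (\<lambda>k. e k i)"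
    and w: "\<And>i. i \<in> I \<Longrightarrow> 0 < w i"
    and lim: "(\<lambda>k. \<integral>\<omega>. exp (- (t / 2) * (\<Sum>i\<in>I. (y k i \<omega>)\<^sup>2 / w i)) \<partial>M k) \<longlonglongrightarrow> L"
  shows "(\<lambda>k. \<integral>\<omega>. exp (- (t / 2) * (\<Sum>i\<in>I. (y k i \<omega> + e k i \<omega>)\<^sup>2 / w i)) \<partial>M k) \<longlonglongrightarrow> L"
proof -
  define F where "F k \<omega> = exp (- (t / 2) * (\<Sum>i\<in>I. (y k i \<omega>)\<^sup>2 / w i))" for k \<omega>
  define F' where "F' k \<omega> = exp (- (t / 2) * (\<Sum>i\<in>I. (y k i \<omega> + e k i \<omega>)\<^sup>2 / w i))" for k \<omega>
  note [measurable] = y e(1)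
  have F_meas[measurable]: "F k \<in> borel_measurable (M k)" "F' k \<in> borel_measurable (M k)" for k
    unfolding F_def F'_def by measurable
  have F01: "0 \<le> F k \<omega>" "F k \<omega> \<le> 1" "0 \<le> F' k \<omega>" "F' k \<omega> \<le> 1" for k \<omega>
    using t w unfolding F_def F'_def by (auto intro!: mult_nonneg_nonneg sum_nonneg divide_nonneg_pos)
  have Fi: "integrable (M k) (F k)" "integrable (M k) (F' k)" for k
  proof -
    interpret prob_space "M k" by (rule M)
    show "integrable (M k) (F k)" "integrable (M k) (F' k)"
      using F01 by (intro integrable_const_bound[of _ 1]; simp)+
  qed
  have close: "\<bar>F' k \<omega> - F k \<omega>\<bar> \<le> sqrt t * (\<Sum>i\<in>I. \<bar>e k i \<omega>\<bar> / sqrt (w i))" for k \<omega>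
  proof -
    let ?f = "\<lambda>i. (y k i \<omega> + e k i \<omega>) / sqrt (w i)" and ?g = "\<lambda>i. y k i \<omega> / sqrt (w i)"
    have sq: "(L2_set (\<lambda>i. h i / sqrt (w i)) I)\<^sup>2 = (\<Sum>i\<in>I. (h i)\<^sup>2 / w i)" for h
      using w by (auto simp: L2_set_def real_sqrt_pow2 sum_nonneg power_divide less_imp_le intro!: sum.cong)
    have "\<bar>F' k \<omega> - F k \<omega>\<bar> \<le> sqrt t * \<bar>L2_set ?f I - L2_set ?g I\<bar>"
      unfolding F_def F'_def sq[symmetric] by (rule exp_square_lipschitz[OF t])
    also have "\<dots> \<le> sqrt t * L2_set (\<lambda>i. ?f i - ?g i) I"
      using t by (intro mult_left_mono L2_set_diff_le) auto
    also have "L2_set (\<lambda>i. ?f i - ?g i) I \<le> (\<Sum>i\<in>I. \<bar>?f i - ?g i\<bar>)" by (rule L2_set_le_sum_abs)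
    also have "\<dots> = (\<Sum>i\<in>I. \<bar>e k i \<omega>\<bar> / sqrt (w i))"
      using w by (intro sum.cong refl) (auto simp: diff_divide_distrib[symmetric] abs_divide less_imp_le)
    finally show ?thesis using t by (simp add: mult_left_mono)
  qed
  have "(\<lambda>k. integral\<^sup>L (M k) (F' k) - integral\<^sup>L (M k) (F k)) \<longlonglongrightarrow> 0"
  proof (rule LIMSEQ_I)
    fix \<epsilon> :: real assume \<epsilon>: "\<epsilon> > 0"
    define c where "c = sqrt t * (\<Sum>i\<in>I. 1 / sqrt (w i))"
    have c: "0 \<le> c" using t w unfolding c_def by (intro mult_nonneg_nonneg sum_nonneg) (auto simp: less_imp_le)
    define \<delta> where "\<delta> = \<epsilon> / (2 * (c + 1))"
    have \<delta>: "\<delta> > 0" using \<epsilon> c by (simp add: \<delta>_def)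
    have c\<delta>: "c * \<delta> < \<epsilon> / 2"
    proof -
      have "c * \<delta> < (c + 1) * \<delta>" using \<delta> by (intro mult_strict_right_mono) auto
      also have "\<dots> = \<epsilon> / 2" using c by (simp add: \<delta>_def field_simps)
      finally show ?thesis .
    qed
    define B where "B k = {\<omega> \<in> space (M k). \<exists>i\<in>I. \<delta> < \<bar>e k i \<omega>\<bar>}" for k
    have B_meas: "B k \<in> sets (M k)" for k
      unfolding B_def using fin e(1) by (intro sets.sets_Collect_finite_Ex) auto
    have "(\<lambda>k. \<Sum>i\<in>I. measure (M k) {\<omega> \<in> space (M k). \<delta> < \<bar>e k i \<omega>\<bar>}) \<longlonglongrightarrow> (\<Sum>i\<in>I. 0)"
      using e(2) \<delta> unfolding conv_prob0_def by (intro tendsto_sum) auto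
    then have "\<forall>\<^sub>F k in sequentially. (\<Sum>i\<in>I. measure (M k) {\<omega> \<in> space (M k). \<delta> < \<bar>e k i \<omega>\<bar>}) < \<epsilon> / 2"
      using \<epsilon> by (intro order_tendstoD(2)) auto
    then obtain k0 where k0: "\<And>k. k \<ge> k0 \<Longrightarrow> (\<Sum>i\<in>I. measure (M k) {\<omega> \<in> space (M k). \<delta> < \<bar>e k i \<omega>\<bar>}) < \<epsilon> / 2"
      unfolding eventually_sequentially by blast
    show "\<exists>k0. \<forall>k\<ge>k0. norm (integral\<^sup>L (M k) (F' k) - integral\<^sup>L (M k) (F k) - 0) < \<epsilon>"
    proof (intro exI[of _ k0] allI impI)
      fix k assume "k \<ge> k0"
      interpret prob_space "M k" by (rule M)
      have "B k = (\<Union>i\<in>I. {\<omega> \<in> space (M k). \<delta> < \<bar>e k i \<omega>\<bar>})" by (auto simp: B_def)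
      then have "prob (B k) \<le> (\<Sum>i\<in>I. prob {\<omega> \<in> space (M k). \<delta> < \<bar>e k i \<omega>\<bar>})"
        using fin e(1) by (simp only:) (intro measure_UNION_le; auto)
      then have PB: "prob (B k) < \<epsilon> / 2" using k0[OF \<open>k \<ge> k0\<close>] by linarith
      have "\<bar>expectation (F' k) - expectation (F k)\<bar> = \<bar>expectation (\<lambda>\<omega>. F' k \<omega> - F k \<omega>)\<bar>"
        using Fi by simp
      also have "\<dots> \<le> expectation (\<lambda>\<omega>. \<bar>F' k \<omega> - F k \<omega>\<bar>)" by (rule integral_abs_bound)
      also have "\<dots> \<le> expectation (\<lambda>\<omega>. indicator (B k) \<omega> + c * \<delta>)"
      proof (rule integral_mono)
        show "integrable (M k) (\<lambda>\<omega>. \<bar>F' k \<omega> - F k \<omega>\<bar>)" using Fi by auto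
        show "integrable (M k) (\<lambda>\<omega>. indicator (B k) \<omega> + c * \<delta>)" using B_meas by (auto simp: emeasure_eq_measure)
        fix \<omega> assume \<omega>: "\<omega> \<in> space (M k)"
        show "\<bar>F' k \<omega> - F k \<omega>\<bar> \<le> indicator (B k) \<omega> + c * \<delta>"
        proof (cases "\<omega> \<in> B k")
          case True
          have "\<bar>F' k \<omega> - F k \<omega>\<bar> \<le> 1" using F01[of k \<omega>] by linarith
          moreover have "0 \<le> c * \<delta>" using c \<delta> by simp
          ultimately show ?thesis using True by simp
        next
          case False
          then have small: "\<bar>e k i \<omega>\<bar> \<le> \<delta>" if "i \<in> I" for i using that \<omega> by (auto simp: B_def not_less)
          have "\<bar>F' k \<omega> - F k \<omega>\<bar> \<le> sqrt t * (\<Sum>i\<in>I. \<bar>e k i \<omega>\<bar> / sqrt (w i))" by (rule close)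
          also have "\<dots> \<le> sqrt t * (\<Sum>i\<in>I. \<delta> / sqrt (w i))"
            using t w small by (intro mult_left_mono sum_mono divide_right_mono) (auto simp: less_imp_le)
          also have "\<dots> = c * \<delta>" by (simp add: c_def sum_distrib_left sum_distrib_right)
          finally show ?thesis using False by simp
        qed
      qed
      also have "\<dots> = prob (B k) + c * \<delta>" using B_meas by (simp add: emeasure_eq_measure prob_space)
      also have "\<dots> < \<epsilon>" using PB c\<delta> by linarith
      finally show "norm (expectation (F' k) - expectation (F k) - 0) < \<epsilon>" by simp
    qed
  qed
  from tendsto_add[OF this lim[folded F_def]] have "(\<lambda>k. integral\<^sup>L (M k) (F' k)) \<longlonglongrightarrow> L" by simp
  then show ?thesis unfolding F'_def .
qed

text \<open>For \<open>X \<ge> 0\<close> the indicator of \<open>(- X, X]\<close>, written through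
  the levels at \<open>X\<close> and \<open>- X\<close>. Symmetric cells are differences of
  consecutive ones, and the values at 0 and \<infinity> are constant, so that sums over cells
  telescope.\<close>

definition sym_level :: "ereal \<Rightarrow> real \<Rightarrow> real" where
  "sym_level X u = of_bool (ereal u \<le> X) - of_bool (ereal u \<le> - X)"

lemma sym_level_infinity: "sym_level \<infinity> u = 1"
  by (simp add: sym_level_def)

lemma sym_level_measurable [measurable]: "sym_level X \<in> borel_measurable borel"
proof -
  have [measurable]: "{u. ereal u \<le> X} \<in> sets borel" for X
    by (cases X) (simp_all add: atMost_def[symmetric])
  have "sym_level X = (\<lambda>u. indicator {u. ereal u \<le> X} u - indicator {u. ereal u \<le> - X} u)"
    by (auto simp: fun_eq_iff sym_level_def indicator_def)
  then show ?thesis by simp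
qed

lemma indicator_sym_cell:
  assumes "0 \<le> x (j - 1)" "x (j - 1) < x j"
  shows "indicator (sym_cell x j) u = sym_level (x j) u - sym_level (x (j - 1)) u"
proof -
  have le1: "- x j \<le> - x (j - 1)" and le2: "- x (j - 1) \<le> x (j - 1)" and le3: "x (j - 1) \<le> x j"
  proof -
    show "- x (j - 1) \<le> x (j - 1)"
      by (rule order_trans[where y=0]) (use assms(1) in simp_all)
  qed (use assms(2) in \<open>simp_all add: less_imp_le\<close>)
  note imp = order_trans[OF _ le1, of "ereal u"] order_trans[OF _ le2, of "ereal u"] order_trans[OF _ le3, of "ereal u"]
  have cell: "u \<in> sym_cell x j \<longleftrightarrow>
      (\<not> ereal u \<le> x (j - 1) \<and> ereal u \<le> x j) \<or> (\<not> ereal u \<le> - x j \<and> ereal u \<le> - x (j - 1))"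
    by (simp add: sym_cell_def not_le)
  show ?thesis
    unfolding sym_level_def indicator_def of_bool_def cell
    using imp by (cases "ereal u \<le> - x j"; cases "ereal u \<le> - x (j - 1)"; cases "ereal u \<le> x (j - 1)"; cases "ereal u \<le> x j") simp_all
qed

section \<open>The test along a sequence of models\<close>

text \<open>The setting of the theorem, with smoothness and symmetry replaced by their consequences:
  expansions with constants shared by both laws, even slopes and reflected distribution
  functions.\<close>

locale pearson_test =
  fixes p m :: nat
    and \<beta> :: "nat \<Rightarrow> real" and \<nu> \<mu> :: real
    and G H Q :: "real measure"
    and x :: "nat \<Rightarrow> ereal"
    and M :: "nat \<Rightarrow> real \<Rightarrow> real \<Rightarrow> 'a measure"
    and \<epsilon> z \<xi> v :: "nat \<Rightarrow> real \<Rightarrow> real \<Rightarrow> int \<Rightarrow> 'a \<Rightarrow> real"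
    and mu_hat :: "nat \<Rightarrow> (int \<Rightarrow> real) \<Rightarrow> real"
    and beta_hat :: "nat \<Rightarrow> (int \<Rightarrow> real) \<Rightarrow> nat \<Rightarrow> real"
    and Y :: "nat \<Rightarrow> real \<Rightarrow> real \<Rightarrow> 'a \<Rightarrow> int \<Rightarrow> real"
    and g h :: "real \<Rightarrow> real" and K1 K2 :: real
  assumes stable: "ar_stable p \<beta>"
    and mu: "\<nu> = (1 - (\<Sum>j=1..p. \<beta> j)) * \<mu>"
    and laws: "real_distribution G" "real_distribution H" "real_distribution Q"
    and variances: "integrable G (\<lambda>u. u\<^sup>2)" "integrable H (\<lambda>u. u\<^sup>2)"
    and lipschitz: "\<And>u w. \<bar>cdf G w - cdf G u\<bar> \<le> K1 * \<bar>w - u\<bar>" "\<And>u w. \<bar>cdf H w - cdf H u\<bar> \<le> K1 * \<bar>w - u\<bar>"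
    and taylor: "\<And>u w. \<bar>cdf G (u + w) - cdf G u - g u * w\<bar> \<le> K2 * w\<^sup>2"
      "\<And>u w. \<bar>cdf H (u + w) - cdf H u - h u * w\<bar> \<le> K2 * w\<^sup>2"
    and density_sym: "\<And>u. g (- u) = g u" "\<And>u. h (- u) = h u"
    and cdf_sym: "\<And>u. cdf G (- u) = 1 - cdf G u" "\<And>u. cdf H (- u) = 1 - cdf H u"
    and m: "m > 1"
    and cells: "x 0 = 0" "x m = \<infinity>" "\<And>j. j < m \<Longrightarrow> x j < x (Suc j)"
    and cells_pos: "\<And>j. 1 \<le> j \<Longrightarrow> j \<le> m \<Longrightarrow>
        extend_at_infty 1 (cdf G) (x j) - extend_at_infty 1 (cdf G) (x (j - 1)) > 0"
    and model: "\<And>n \<gamma> \<rho>. n \<ge> 1 \<Longrightarrow> \<gamma> \<ge> 0 \<Longrightarrow> \<rho> \<ge> 0 \<Longrightarrow>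
        contaminated_ar (M n \<gamma> \<rho>) p \<beta> \<nu>
          (\<lambda>u. (1 - min 1 (\<rho> / sqrt (real n))) * cdf G u + min 1 (\<rho> / sqrt (real n)) * cdf H u)
          (min 1 (\<gamma> / sqrt (real n))) Q (\<epsilon> n \<gamma> \<rho>) (z n \<gamma> \<rho>) (\<xi> n \<gamma> \<rho>) (v n \<gamma> \<rho>)"
    and Y: "\<And>n \<gamma> \<rho>. Y n \<gamma> \<rho> = observations p n (v n \<gamma> \<rho>) (z n \<gamma> \<rho>) (\<xi> n \<gamma> \<rho>)"
    and mu_hat_measurable: "\<And>n. n \<ge> 1 \<Longrightarrow>
        mu_hat n \<in> borel_measurable (PiM (sample_window p n) (\<lambda>_. borel))"
    and beta_hat_measurable: "\<And>n j. n \<ge> 1 \<Longrightarrow> 1 \<le> j \<Longrightarrow> j \<le> p \<Longrightarrow>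
        (\<lambda>y. beta_hat n y j) \<in> borel_measurable (PiM (sample_window p n) (\<lambda>_. borel))"
    and mu_hat_root_n: "\<And>\<Gamma> R. \<Gamma> \<ge> 0 \<Longrightarrow> R \<ge> 0 \<Longrightarrow>
        unif_bounded_in_prob M (\<lambda>n \<gamma> \<rho> \<omega>. sqrt (real n) * (mu_hat n (Y n \<gamma> \<rho> \<omega>) - \<mu>)) \<Gamma> R"
    and beta_hat_root_n: "\<And>\<Gamma> R. \<Gamma> \<ge> 0 \<Longrightarrow> R \<ge> 0 \<Longrightarrow>
        unif_bounded_in_prob M
          (\<lambda>n \<gamma> \<rho> \<omega>. L2_set (\<lambda>j. sqrt (real n) * (beta_hat n (Y n \<gamma> \<rho> \<omega>) j - \<beta> j)) {1..p}) \<Gamma> R"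
begin

abbreviation "\<pi> j \<equiv> sym_cell_prob (cdf G) x j"

lemma x_nonneg: "j \<le> m \<Longrightarrow> 0 \<le> x j"
proof (induction j)
  case (Suc j)
  then show ?case using cells(3)[of j] by (auto intro: order_trans less_imp_le)
qed (simp add: cells)

lemma x_cases:
  assumes "j \<le> m"
  obtains "x j = \<infinity>" | y where "x j = ereal y"
  using x_nonneg[OF assms] by (cases "x j") auto

lemma indicator_cell:
  assumes "j \<in> {1..m}"
  shows "indicator (sym_cell x j) u = sym_level (x j) u - sym_level (x (j - 1)) u"
proof (rule indicator_sym_cell)
  show "0 \<le> x (j - 1)" using assms by (intro x_nonneg) auto
  show "x (j - 1) < x j" using cells(3)[of "j - 1"] assms by auto
qed

lemma telescope_cells:
  fixes f :: "ereal \<Rightarrow> real"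
  shows "(\<Sum>j=1..m. f (x j) - f (x (j - 1))) = f \<infinity> - f 0"
proof -
  have "(\<Sum>j=1..k. f (x j) - f (x (j - 1))) = f (x k) - f (x 0)" for k
    by (induction k) auto
  then show ?thesis by (simp add: cells)
qed

text \<open>The symmetric levels telescope from 0 to \<infinity>. A total of 1 at every point yields
  both that the cells cover the line and that they are disjoint.\<close>

lemma sum_indicator_cells: "(\<Sum>j=1..m. indicator (sym_cell x j) u) = (1::real)"
proof -
  have "(\<Sum>j=1..m. indicator (sym_cell x j) u) = (\<Sum>j=1..m. sym_level (x j) u - sym_level (x (j - 1)) u)"
    by (intro sum.cong refl indicator_cell)
  also have "\<dots> = sym_level \<infinity> u - sym_level 0 u"
    by (rule telescope_cells[of "\<lambda>X. sym_level X u"])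
  finally show ?thesis by (simp add: sym_level_def)
qed

lemma cells_cover: "(\<Union>j\<in>{1..m}. sym_cell x j) = UNIV"
proof (rule ccontr)
  assume "(\<Union>j\<in>{1..m}. sym_cell x j) \<noteq> UNIV"
  then obtain u where "u \<notin> (\<Union>j\<in>{1..m}. sym_cell x j)" by blast
  then have "(\<Sum>j=1..m. indicator (sym_cell x j) u) = (0::real)" by (intro sum.neutral) auto
  then show False using sum_indicator_cells[of u] by simp
qed

lemma cells_disjoint: "disjoint_family_on (sym_cell x) {1..m}"
  unfolding disjoint_family_on_def
proof (intro ballI impI, rule ccontr)
  fix i j assume ij: "i \<in> {1..m}" "j \<in> {1..m}" "i \<noteq> j" and "sym_cell x i \<inter> sym_cell x j \<noteq> {}"
  then obtain u where u: "u \<in> sym_cell x i" "u \<in> sym_cell x j" by auto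
  have "(\<Sum>k\<in>{i, j}. indicator (sym_cell x k) u) \<le> (\<Sum>k=1..m. indicator (sym_cell x k) u :: real)"
    using ij by (intro sum_mono2) auto
  then show False using ij u sum_indicator_cells[of u] by simp
qed

lemma cell_borel: "j \<in> {1..m} \<Longrightarrow> sym_cell x j \<in> sets borel"
proof -
  assume j: "j \<in> {1..m}"
  have "sym_cell x j = {u. sym_level (x j) u - sym_level (x (j - 1)) u = 1}"
    unfolding indicator_cell[OF j, symmetric] by (auto simp: indicator_def)
  also have "\<dots> \<in> sets borel" by measurable
  finally show ?thesis .
qed

lemma \<pi>_pos: "j \<in> {1..m} \<Longrightarrow> 0 < \<pi> j"
  using cells_pos[of j] by (simp add: sym_cell_prob_def)

lemma \<pi>_sum: "(\<Sum>j=1..m. \<pi> j) = 1"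
proof -
  have "(\<Sum>j=1..m. \<pi> j) = 2 * (\<Sum>j=1..m. extend_at_infty 1 (cdf G) (x j) - extend_at_infty 1 (cdf G) (x (j - 1)))"
    by (simp add: sym_cell_prob_def sum_distrib_left)
  also have "\<dots> = 2 * (1 - cdf G 0)"
    by (subst telescope_cells) (simp add: extend_at_infty_def)
  finally show ?thesis using cdf_sym(1)[of 0] by simp
qed

text \<open>The innovation distribution function is a convex combination of those of
  \<open>G\<close> and \<open>H\<close> and inherits both inequalities with unchanged constants,
  whatever the sample size and \<open>\<rho>\<close>.\<close>

lemma smooth_model:
  assumes "n \<ge> 1" "\<gamma> \<ge> 0" "\<rho> \<ge> 0"
  shows "smooth_contaminated_ar (M n \<gamma> \<rho>) p \<beta> \<nu>
          (\<lambda>u. (1 - min 1 (\<rho> / sqrt (real n))) * cdf G u + min 1 (\<rho> / sqrt (real n)) * cdf H u)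
          (min 1 (\<gamma> / sqrt (real n))) Q (\<epsilon> n \<gamma> \<rho>) (z n \<gamma> \<rho>) (\<xi> n \<gamma> \<rho>) (v n \<gamma> \<rho>)
          (\<lambda>u. (1 - min 1 (\<rho> / sqrt (real n))) * g u + min 1 (\<rho> / sqrt (real n)) * h u) K1 K2"
proof (rule smooth_contaminated_ar.intro[OF model[OF assms]], unfold_locales)
  define w where "w = min 1 (\<rho> / sqrt (real n))"
  have w: "0 \<le> w" "w \<le> 1" using assms by (auto simp: w_def)
  have convex: "\<bar>(1 - w) * a + w * b\<bar> \<le> c" if "\<bar>a\<bar> \<le> c" "\<bar>b\<bar> \<le> c" for a b c :: real
  proof -
    have "\<bar>(1 - w) * a + w * b\<bar> \<le> (1 - w) * \<bar>a\<bar> + w * \<bar>b\<bar>"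
      using abs_triangle_ineq[of "(1 - w) * a" "w * b"] w by (simp add: abs_mult)
    also have "\<dots> \<le> (1 - w) * c + w * c" using that w by (intro add_mono mult_left_mono) auto
    finally show ?thesis by (simp add: algebra_simps)
  qed
  show "ar_stable p \<beta>" by (rule stable)
  fix y u k :: real
  show "\<bar>((1 - min 1 (\<rho> / sqrt (real n))) * cdf G y + min 1 (\<rho> / sqrt (real n)) * cdf H y)
      - ((1 - min 1 (\<rho> / sqrt (real n))) * cdf G u + min 1 (\<rho> / sqrt (real n)) * cdf H u)\<bar> \<le> K1 * \<bar>y - u\<bar>"
    using convex[OF lipschitz(1)[of y u] lipschitz(2)[of y u]] unfolding w_def[symmetric]
    by (simp add: algebra_simps)
  show "\<bar>((1 - min 1 (\<rho> / sqrt (real n))) * cdf G (u + k) + min 1 (\<rho> / sqrt (real n)) * cdf H (u + k))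
      - ((1 - min 1 (\<rho> / sqrt (real n))) * cdf G u + min 1 (\<rho> / sqrt (real n)) * cdf H u)
      - ((1 - min 1 (\<rho> / sqrt (real n))) * g u + min 1 (\<rho> / sqrt (real n)) * h u) * k\<bar> \<le> K2 * k\<^sup>2"
    using convex[OF taylor(1)[of u k] taylor(2)[of u k]] unfolding w_def[symmetric]
    by (simp add: algebra_simps)
qed

end

locale pearson_sequence = pearson_test +
  fixes N :: "nat \<Rightarrow> nat" and \<gamma>s \<rho>s :: "nat \<Rightarrow> real" and \<gamma> \<rho> \<Gamma> R :: real
  assumes N: "strict_mono N" "\<And>k. 1 \<le> N k"
    and \<gamma>s: "\<And>k. 0 \<le> \<gamma>s k" "\<And>k. \<gamma>s k \<le> \<Gamma>" "\<gamma>s \<longlonglongrightarrow> \<gamma>"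
    and \<rho>s: "\<And>k. 0 \<le> \<rho>s k" "\<And>k. \<rho>s k \<le> R" "\<rho>s \<longlonglongrightarrow> \<rho>"
begin

abbreviation "Mk k \<equiv> M (N k) (\<gamma>s k) (\<rho>s k)"
abbreviation "mix k \<equiv> min 1 (\<rho>s k / sqrt (real (N k)))"
abbreviation "sw k \<equiv> min 1 (\<gamma>s k / sqrt (real (N k)))"
abbreviation "Ak k \<equiv> (\<lambda>u. (1 - mix k) * cdf G u + mix k * cdf H u)"
abbreviation "ak k \<equiv> (\<lambda>u. (1 - mix k) * g u + mix k * h u)"
abbreviation "eps k \<equiv> \<epsilon> (N k) (\<gamma>s k) (\<rho>s k)"

sublocale S: smooth_contaminated_ar "Mk k" p \<beta> \<nu> "Ak k" "sw k" Q "eps k"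
    "z (N k) (\<gamma>s k) (\<rho>s k)" "\<xi> (N k) (\<gamma>s k) (\<rho>s k)" "v (N k) (\<gamma>s k) (\<rho>s k)" "ak k" K1 K2 for k
  using N(2) \<gamma>s(1) \<rho>s(1) by (rule smooth_model)

section \<open>Rates and vanishing error bounds along the sequence\<close>

definition rate :: "nat \<Rightarrow> real" where "rate k = 1 / sqrt (real (N k))"
definition times :: "nat \<Rightarrow> int set" where "times k = {1..int (N k)}"

lemma rate: "0 < rate k" "rate k \<le> 1" "(rate k)\<^sup>2 * card (times k) = 1" "finite (times k)" "card (times k) = N k"
  using N(2)[of k] by (auto simp: rate_def times_def power_divide)

lemma N_at_top: "filterlim N at_top sequentially"
  using N(1) by (rule filterlim_subseq)

lemma sqrt_N_at_top: "filterlim (\<lambda>k. sqrt (real (N k))) at_top sequentially"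
  by (intro filterlim_compose[OF sqrt_at_top] filterlim_compose[OF filterlim_real_sequentially N_at_top])

lemma rate_tendsto: "rate \<longlonglongrightarrow> 0"
  unfolding rate_def by (rule real_tendsto_divide_at_top[OF tendsto_const sqrt_N_at_top])

text \<open>The quotient tends to zero, so the cap at 1 is inactive from some index on.\<close>

lemma capped_tendsto:
  assumes "c \<longlonglongrightarrow> C"
  shows "(\<lambda>k. min 1 (c k / sqrt (real (N k))) * sqrt (real (N k))) \<longlonglongrightarrow> C"
    and "(\<lambda>k. min 1 (c k / sqrt (real (N k)))) \<longlonglongrightarrow> 0"
proof -
  have l: "(\<lambda>k. c k / sqrt (real (N k))) \<longlonglongrightarrow> 0"
    by (rule real_tendsto_divide_at_top[OF assms sqrt_N_at_top])
  then have ev: "\<forall>\<^sub>F k in sequentially. c k / sqrt (real (N k)) < 1"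
    by (rule order_tendstoD) simp
  have "\<forall>\<^sub>F k in sequentially. c k = min 1 (c k / sqrt (real (N k))) * sqrt (real (N k))"
    using ev
  proof eventually_elim
    case (elim k)
    then show ?case using N(2)[of k] by (simp add: min_def)
  qed
  with assms show "(\<lambda>k. min 1 (c k / sqrt (real (N k))) * sqrt (real (N k))) \<longlonglongrightarrow> C"
    by (rule Lim_transform_eventually)
  show "(\<lambda>k. min 1 (c k / sqrt (real (N k)))) \<longlonglongrightarrow> 0"
    using tendsto_min[OF tendsto_const l, of 1] by simp
qed

lemma sw_tendsto: "sw \<longlonglongrightarrow> 0" "(\<lambda>k. sw k / rate k) \<longlonglongrightarrow> \<gamma>"
  using capped_tendsto[OF \<gamma>s(3)] by (simp_all add: rate_def)

lemma mix_tendsto: "mix \<longlonglongrightarrow> 0" "(\<lambda>k. mix k * sqrt (real (N k))) \<longlonglongrightarrow> \<rho>"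
  using capped_tendsto[OF \<rho>s(3)] by simp_all

definition mom :: real where
  "mom = 1 + (\<Sum>k. \<bar>impulse p \<beta> k\<bar>)\<^sup>2 * ((\<integral>u. u\<^sup>2 \<partial>G) + (\<integral>u. u\<^sup>2 \<partial>H))"

lemma moment_le: "S.moment k \<le> mom"
proof -
  have w: "0 \<le> mix k" "mix k \<le> 1" using \<rho>s(1)[of k] by auto
  have "(\<integral>u. u\<^sup>2 \<partial>distr (Mk k) borel (eps k 0)) \<le> (\<integral>u. u\<^sup>2 \<partial>G) + (\<integral>u. u\<^sup>2 \<partial>H)"
    by (rule mixture_second_moment[OF S.real_distribution_innov laws(1,2) w S.innov_cdf variances])
  then show ?thesis unfolding S.moment_def mom_def by (intro add_left_mono mult_left_mono) auto
qed

text \<open>After division by \<open>rate k\<close> the quotient \<open>sw k / rate k\<close>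
  converges to \<open>\<gamma>\<close>, and every summand retains a vanishing factor:
  \<open>rate k\<close>, \<open>sw k\<close>, a root of these, or the truncated integral
  \<open>?I k\<close>. The truncation supplies the dominating constant 1 for an arbitrary outlier
  law.\<close>

lemma error_bound_tendsto:
  assumes C: "0 \<le> C"
  shows "(\<lambda>k. S.error_bound k (rate k) C) \<longlonglongrightarrow> 0"
proof (rule tendsto_sandwich[OF _ _ tendsto_const])
  show "\<forall>\<^sub>F k in sequentially. 0 \<le> S.error_bound k (rate k) C"
  proof (intro always_eventually allI)
    fix k
    have "0 \<le> S.expectation k (\<lambda>\<omega>. \<bar>S.level_error k (rate k) (times k) (\<lambda>_. 0) 0 0 \<omega>\<bar>)" by simp
    also have "\<dots> \<le> S.error_bound k (rate k) C"
      using rate[of k] C by (intro S.level_error_bound) auto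
    finally show "0 \<le> S.error_bound k (rate k) C" .
  qed
  let ?I = "\<lambda>k. \<integral>u. min 1 (K1 * rate k * C * \<bar>u\<bar>) \<partial>Q" and ?P = "real p + 1"
  let ?U = "\<lambda>k. sqrt (4 * (?P * sw k + K1 * rate k * C * (?P * mom)))
     + (K2 * rate k * (C\<^sup>2 * (?P\<^sup>2 * mom)) + (?P * (2 * K1 * C * (sw k * (?P * mom)))
        + ?P * (sw k / rate k * ?I k) + (real p + 2) * (?P * (real p * (sw k * (sw k / rate k))))))
     + ?P * sqrt (sw k)"
  show "\<forall>\<^sub>F k in sequentially. S.error_bound k (rate k) C \<le> ?U k"
  proof (intro always_eventually allI)
    fix k
    note r = rate(1)[of k]
    have K: "0 \<le> K1" "0 \<le> K2" using S.K_nonneg by auto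
    have sw0: "0 \<le> sw k" using \<gamma>s(1)[of k] by auto
    have 1: "S.fluct_bound k (rate k) C \<le> sqrt (4 * (?P * sw k + K1 * rate k * C * (?P * mom)))"
      unfolding S.fluct_bound_def using K r C moment_le
      by (intro real_sqrt_le_mono mult_left_mono add_left_mono) auto
    have "S.taylor_bound k (rate k) C \<le> K2 * (rate k)\<^sup>2 * (C\<^sup>2 * (?P\<^sup>2 * mom))"
      unfolding S.taylor_bound_def using K moment_le by (intro mult_left_mono) auto
    also have "\<dots> = K2 * rate k * (C\<^sup>2 * (?P\<^sup>2 * mom)) * rate k" by (simp add: power2_eq_square)
    finally have 2: "S.taylor_bound k (rate k) C / rate k \<le> K2 * rate k * (C\<^sup>2 * (?P\<^sup>2 * mom))"
      using r by (simp add: pos_divide_le_eq)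
    have "S.outlier_bound k (rate k) C \<le> ?P * (2 * K1 * rate k * C * (sw k * (?P * mom)))
       + ?P * (sw k * ?I k) + (real p + 2) * (?P * (real p * (sw k)\<^sup>2))"
      unfolding S.outlier_bound_def using K C r sw0 moment_le by (intro add_right_mono mult_left_mono) auto
    also have "\<dots> = (?P * (2 * K1 * C * (sw k * (?P * mom))) + ?P * (sw k / rate k * ?I k)
        + (real p + 2) * (?P * (real p * (sw k * (sw k / rate k))))) * rate k"
    proof -
      have gen: "a * (2 * K1 * r * C * (s * b)) + a * (s * I) + c * (a * (d * s\<^sup>2))
        = (a * (2 * K1 * C * (s * b)) + a * (s / r * I) + c * (a * (d * (s * (s / r))))) * r" if "r \<noteq> 0"
        for a b c d r s I :: real
        using that by (simp add: field_simps power2_eq_square)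
      show ?thesis by (rule gen) (use r in simp)
    qed
    finally have 3: "S.outlier_bound k (rate k) C / rate k \<le> ?P * (2 * K1 * C * (sw k * (?P * mom)))
        + ?P * (sw k / rate k * ?I k) + (real p + 2) * (?P * (real p * (sw k * (sw k / rate k))))"
      using r by (simp only: pos_divide_le_eq)
    show "S.error_bound k (rate k) C \<le> ?U k"
      unfolding S.error_bound_def add_divide_distrib using 1 2 3 by linarith
  qed
  interpret Q: real_distribution Q by (rule laws)
  have "?I \<longlonglongrightarrow> (\<integral>u. 0 \<partial>Q)"
  proof (rule integral_dominated_convergence[where w="\<lambda>_. 1"])
    show "integrable Q (\<lambda>_. 1::real)" by simp
    show "AE u in Q. (\<lambda>k. min 1 (K1 * rate k * C * \<bar>u\<bar>)) \<longlonglongrightarrow> 0"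
    proof (rule AE_I2)
      fix u :: real
      have "(\<lambda>k. min 1 (K1 * rate k * C * \<bar>u\<bar>)) \<longlonglongrightarrow> min 1 (K1 * 0 * C * \<bar>u\<bar>)"
        by (intro tendsto_intros rate_tendsto)
      then show "(\<lambda>k. min 1 (K1 * rate k * C * \<bar>u\<bar>)) \<longlonglongrightarrow> 0" by simp
    qed
    show "AE u in Q. norm (min 1 (K1 * rate k * C * \<bar>u\<bar>)) \<le> 1" for k
    proof (rule AE_I2)
      fix u :: real
      have "0 \<le> K1 * rate k * C * \<bar>u\<bar>"
        using S.K_nonneg(1) rate(1)[of k] C by simp
      then show "norm (min 1 (K1 * rate k * C * \<bar>u\<bar>)) \<le> 1" by (simp add: min_def)
    qed
  qed measurable
  then have I0: "?I \<longlonglongrightarrow> 0" by simp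
  have "?U \<longlonglongrightarrow> sqrt (4 * (?P * 0 + K1 * 0 * C * (?P * mom)))
     + (K2 * 0 * (C\<^sup>2 * (?P\<^sup>2 * mom)) + (?P * (2 * K1 * C * (0 * (?P * mom)))
        + ?P * (\<gamma> * 0) + (real p + 2) * (?P * (real p * (0 * \<gamma>)))))
     + ?P * sqrt 0"
    by (intro tendsto_add tendsto_mult tendsto_real_sqrt tendsto_const rate_tendsto sw_tendsto I0)
  then show "?U \<longlonglongrightarrow> 0" by simp
qed

text \<open>\<open>S.mean_jump\<close> is linear in the innovation distribution function and the
  weight of \<open>H\<close> tends to zero, so the alternative and the outliers do not interact in
  the limit.\<close>

lemma mean_jump_tendsto: "(\<lambda>k. S.mean_jump k y) \<longlonglongrightarrow> outlier_shift (cdf G) p \<beta> Q y"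
proof -
  interpret Q: real_distribution Q by (rule laws)
  define o' where "o' F = (\<Sum>j\<le>p. \<integral>u. F (y + ar_coeff \<beta> j * u) - F y \<partial>Q)" for F :: "real \<Rightarrow> real"
  have int: "integrable Q (\<lambda>u. cdf D (y + c * u))" if "real_distribution D" for D c
  proof -
    interpret D: real_distribution D by fact
    have [measurable]: "cdf D \<in> borel_measurable borel"
      by (rule borel_measurable_mono) (simp add: D.cdf_nondecreasing monoI)
    show ?thesis
      by (intro Q.integrable_const_bound[of _ 1]) (auto simp: D.cdf_nonneg D.cdf_bounded_prob)
  qed
  have int': "integrable Q (\<lambda>u. cdf D (y + c * u) - cdf D y)" if "real_distribution D" for D c
    using int[OF that] by simp
  have "S.mean_jump k y = (1 - mix k) * o' (cdf G) + mix k * o' (cdf H)" for k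
  proof -
    have "(\<integral>u. Ak k (y + c * u) - Ak k y \<partial>Q)
      = (1 - mix k) * (\<integral>u. cdf G (y + c * u) - cdf G y \<partial>Q) + mix k * (\<integral>u. cdf H (y + c * u) - cdf H y \<partial>Q)" for c
    proof -
      have "(\<integral>u. Ak k (y + c * u) - Ak k y \<partial>Q)
        = (\<integral>u. (1 - mix k) * (cdf G (y + c * u) - cdf G y) + mix k * (cdf H (y + c * u) - cdf H y) \<partial>Q)"
        by (intro Bochner_Integration.integral_cong refl) (simp add: algebra_simps)
      also have "\<dots> = (\<integral>u. (1 - mix k) * (cdf G (y + c * u) - cdf G y) \<partial>Q) + (\<integral>u. mix k * (cdf H (y + c * u) - cdf H y) \<partial>Q)"
        by (intro Bochner_Integration.integral_add integrable_mult_right int' laws)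
      finally show ?thesis by (simp only: Bochner_Integration.integral_mult_right_zero)
    qed
    then show ?thesis
      unfolding S.mean_jump_def o'_def by (simp only: sum.distrib sum_distrib_left)
  qed
  moreover have "(\<lambda>k. (1 - mix k) * o' (cdf G) + mix k * o' (cdf H)) \<longlonglongrightarrow> (1 - 0) * o' (cdf G) + 0 * o' (cdf H)"
    by (intro tendsto_add tendsto_mult tendsto_diff tendsto_const mix_tendsto)
  moreover have "o' (cdf G) = outlier_shift (cdf G) p \<beta> Q y"
    unfolding o'_def outlier_shift_def ar_coeff_def atLeast0AtMost
    using int[OF laws(1)] by (intro sum.cong refl) (simp add: Q.prob_space[simplified])
  ultimately show ?thesis by simp
qed

lemma unif_bounded_seq:
  assumes X: "unif_bounded_in_prob M X \<Gamma> R" and e: "0 < e"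
  shows "\<exists>C. \<forall>\<^sub>F k in sequentially. measure (Mk k) {\<omega> \<in> space (Mk k). C < \<bar>X (N k) (\<gamma>s k) (\<rho>s k) \<omega>\<bar>} < e"
proof -
  let ?S = "\<lambda>C n. SUP (\<gamma>, \<rho>) \<in> {0..\<Gamma>} \<times> {0..R}. ereal (measure (M n \<gamma> \<rho>) {\<omega> \<in> space (M n \<gamma> \<rho>). C < \<bar>X n \<gamma> \<rho> \<omega>\<bar>})"
  have "\<forall>\<^sub>F C in at_top. limsup (?S C) < ereal e"
    using X e unfolding unif_bounded_in_prob_def by (intro order_tendstoD) auto
  then obtain C where "limsup (?S C) < ereal e"
    by (auto simp: eventually_at_top_linorder)
  then have "\<forall>\<^sub>F n in sequentially. ?S C n < ereal e" by (rule Limsup_lessD)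
  then have "\<forall>\<^sub>F k in sequentially. ?S C (N k) < ereal e"
    using N_at_top by (rule eventually_compose_filterlim)
  then have "\<forall>\<^sub>F k in sequentially. measure (Mk k) {\<omega> \<in> space (Mk k). C < \<bar>X (N k) (\<gamma>s k) (\<rho>s k) \<omega>\<bar>} < e"
  proof eventually_elim
    case (elim k)
    have "ereal (measure (Mk k) {\<omega> \<in> space (Mk k). C < \<bar>X (N k) (\<gamma>s k) (\<rho>s k) \<omega>\<bar>}) \<le> ?S C (N k)"
      using \<gamma>s(1,2)[of k] \<rho>s(1,2)[of k] by (intro SUP_upper2[of "(\<gamma>s k, \<rho>s k)"]) auto
    from le_less_trans[OF this elim] show ?case by simp
  qed
  then show ?thesis by blast
qed

section \<open>Estimators along the sequence and tightness of their scaled errors\<close>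

definition yobs :: "nat \<Rightarrow> 'a \<Rightarrow> int \<Rightarrow> real" where "yobs k = Y (N k) (\<gamma>s k) (\<rho>s k)"
definition muk :: "nat \<Rightarrow> 'a \<Rightarrow> real" where "muk k \<omega> = mu_hat (N k) (yobs k \<omega>)"
definition betak :: "nat \<Rightarrow> 'a \<Rightarrow> nat \<Rightarrow> real" where "betak k \<omega> = beta_hat (N k) (yobs k \<omega>)"
definition res :: "nat \<Rightarrow> int \<Rightarrow> 'a \<Rightarrow> real" where "res k t \<omega> = residual p (muk k \<omega>) (betak k \<omega>) (yobs k \<omega>) t"

definition coef :: "nat \<Rightarrow> nat \<Rightarrow> 'a \<Rightarrow> real" where
  "coef k j \<omega> = (if j = 0 then (muk k \<omega> - \<mu>) * (1 - (\<Sum>j=1..p. betak k \<omega> j)) / rate k else (betak k \<omega> j - \<beta> j) / rate k)"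

lemma yobs_measurable: "yobs k \<in> measurable (Mk k) (PiM (sample_window p (N k)) (\<lambda>_. borel))"
  unfolding yobs_def Y observations_def by measurable

lemma muk_measurable [measurable]: "muk k \<in> borel_measurable (Mk k)"
  unfolding muk_def using N(2) by (intro measurable_compose[OF yobs_measurable mu_hat_measurable])

lemma betak_measurable: "1 \<le> j \<Longrightarrow> j \<le> p \<Longrightarrow> (\<lambda>\<omega>. betak k \<omega> j) \<in> borel_measurable (Mk k)"
  unfolding betak_def using N(2) by (intro measurable_compose[OF yobs_measurable beta_hat_measurable])

lemma yobs_component [measurable]: "(\<lambda>\<omega>. yobs k \<omega> t) \<in> borel_measurable (Mk k)"
  unfolding yobs_def Y observations_def by (cases "t \<in> sample_window p (N k)") auto

lemma res_measurable [measurable]: "res k t \<in> borel_measurable (Mk k)"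
  unfolding res_def residual_def
  by (intro borel_measurable_diff borel_measurable_sum borel_measurable_times betak_measurable yobs_component muk_measurable) auto

lemma coef_measurable: "j \<le> p \<Longrightarrow> coef k j \<in> borel_measurable (Mk k)"
proof -
  assume j: "j \<le> p"
  have [measurable]: "(\<lambda>\<omega>. \<Sum>j=1..p. betak k \<omega> j) \<in> borel_measurable (Mk k)"
    by (intro borel_measurable_sum betak_measurable) auto
  show ?thesis
  proof (cases "j = 0")
    case True
    then have "coef k j = (\<lambda>\<omega>. (muk k \<omega> - \<mu>) * (1 - (\<Sum>j=1..p. betak k \<omega> j)) / rate k)"
      by (simp add: fun_eq_iff coef_def)
    also have "\<dots> \<in> borel_measurable (Mk k)" by measurable
    finally show ?thesis .
  next
    case False
    then have [measurable]: "(\<lambda>\<omega>. betak k \<omega> j) \<in> borel_measurable (Mk k)" using j by (intro betak_measurable) auto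
    show ?thesis using False unfolding coef_def by simp
  qed
qed

lemma coef_tight:
  assumes e: "0 < e"
  shows "\<exists>C\<ge>0. \<forall>\<^sub>F k in sequentially. measure (Mk k) {\<omega> \<in> space (Mk k). \<exists>j\<le>p. C < \<bar>coef k j \<omega>\<bar>} < e"
proof -
  have G0: "0 \<le> \<Gamma>" "0 \<le> R" using \<gamma>s(1,2)[of 0] \<rho>s(1,2)[of 0] by auto
  define U where "U k \<omega> = sqrt (real (N k)) * (muk k \<omega> - \<mu>)" for k \<omega>
  define V where "V k \<omega> = L2_set (\<lambda>j. sqrt (real (N k)) * (betak k \<omega> j - \<beta> j)) {1..p}" for k \<omega>
  obtain C1' where C1': "\<forall>\<^sub>F k in sequentially. measure (Mk k) {\<omega> \<in> space (Mk k). C1' < \<bar>U k \<omega>\<bar>} < e / 2"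
    using unif_bounded_seq[OF mu_hat_root_n[OF G0], of "e / 2"] e unfolding U_def muk_def yobs_def by auto
  obtain C2' where C2': "\<forall>\<^sub>F k in sequentially. measure (Mk k) {\<omega> \<in> space (Mk k). C2' < \<bar>V k \<omega>\<bar>} < e / 2"
    using unif_bounded_seq[OF beta_hat_root_n[OF G0], of "e / 2"] e unfolding V_def betak_def yobs_def by auto
  define C1 where "C1 = max 0 C1'"
  define C2 where "C2 = max 0 C2'"
  have C0: "0 \<le> C1" "0 \<le> C2" "C1' \<le> C1" "C2' \<le> C2" by (auto simp: C1_def C2_def)
  \<comment> \<open>The summand \<open>C2\<close> covers the slopes. Coefficient 0 is the scaled
    error of the mean, at most \<open>C1\<close>, times one minus the sum of the estimated slopes;
    that sum deviates from its true value by at most \<open>p * C2\<close> because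
    \<open>rate k \<le> 1\<close>.\<close>
  define C where "C = C2 + C1 * (\<bar>1 - (\<Sum>j=1..p. \<beta> j)\<bar> + real p * C2)"
  have "C \<ge> 0" using C0 unfolding C_def by simp
  have bound: "\<bar>coef k j \<omega>\<bar> \<le> C" if U: "\<bar>U k \<omega>\<bar> \<le> C1" and V: "\<bar>V k \<omega>\<bar> \<le> C2" and j: "j \<le> p" for k j \<omega>
  proof -
    have bj: "\<bar>(betak k \<omega> i - \<beta> i) / rate k\<bar> \<le> C2" if "i \<in> {1..p}" for i
    proof -
      have "\<bar>(betak k \<omega> i - \<beta> i) / rate k\<bar> = \<bar>sqrt (real (N k)) * (betak k \<omega> i - \<beta> i)\<bar>"
        by (simp add: rate_def mult.commute)
      also have "\<dots> \<le> L2_set (\<lambda>i. \<bar>sqrt (real (N k)) * (betak k \<omega> i - \<beta> i)\<bar>) {1..p}"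
        using that by (intro member_le_L2_set) auto
      also have "\<dots> = V k \<omega>" by (simp add: V_def L2_set_def)
      finally show ?thesis using V by linarith
    qed
    show ?thesis
    proof (cases "j = 0")
      case False
      then have "\<bar>coef k j \<omega>\<bar> \<le> C2" using bj[of j] j by (simp add: coef_def)
      also have "\<dots> \<le> C" unfolding C_def using C0 by simp
      finally show ?thesis .
    next
      case True
      have "\<bar>\<Sum>i=1..p. betak k \<omega> i - \<beta> i\<bar> \<le> (\<Sum>i=1..p. C2)"
      proof (intro order_trans[OF sum_abs] sum_mono)
        fix i assume i: "i \<in> {1..p}"
        have "\<bar>betak k \<omega> i - \<beta> i\<bar> = \<bar>(betak k \<omega> i - \<beta> i) / rate k\<bar> * rate k"
          using rate(1)[of k] by (simp add: abs_divide)
        also have "\<dots> \<le> C2 * 1" using bj[OF i] rate(1,2)[of k] C0 by (intro mult_mono) auto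
        finally show "\<bar>betak k \<omega> i - \<beta> i\<bar> \<le> C2" by simp
      qed
      then have B: "\<bar>1 - (\<Sum>i=1..p. betak k \<omega> i)\<bar> \<le> \<bar>1 - (\<Sum>j=1..p. \<beta> j)\<bar> + real p * C2"
        by (simp add: sum_subtractf)
      have "coef k j \<omega> = U k \<omega> * (1 - (\<Sum>i=1..p. betak k \<omega> i))"
        using True by (simp add: coef_def U_def rate_def)
      then have "\<bar>coef k j \<omega>\<bar> \<le> C1 * (\<bar>1 - (\<Sum>j=1..p. \<beta> j)\<bar> + real p * C2)"
        unfolding abs_mult using U B C0 by (simp only: abs_mult) (intro mult_mono; simp)
      also have "\<dots> \<le> C" unfolding C_def using C0 by simp
      finally show ?thesis .
    qed
  qed
  have U_meas: "U k \<in> borel_measurable (Mk k)" for k unfolding U_def by measurable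
  have V_meas: "V k \<in> borel_measurable (Mk k)" for k
  proof -
    have [measurable]: "(\<lambda>\<omega>. \<Sum>j=1..p. (sqrt (real (N k)) * (betak k \<omega> j - \<beta> j))\<^sup>2) \<in> borel_measurable (Mk k)"
      by (intro borel_measurable_sum borel_measurable_power borel_measurable_times borel_measurable_diff
        betak_measurable borel_measurable_const) auto
    show ?thesis unfolding V_def L2_set_def by measurable
  qed
  have "\<forall>\<^sub>F k in sequentially. measure (Mk k) {\<omega> \<in> space (Mk k). \<exists>j\<le>p. C < \<bar>coef k j \<omega>\<bar>} < e"
    using C1' C2'
  proof eventually_elim
    case (elim k)
    note [measurable] = U_meas V_meas
    have "measure (Mk k) {\<omega> \<in> space (Mk k). \<exists>j\<le>p. C < \<bar>coef k j \<omega>\<bar>}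
      \<le> measure (Mk k) ({\<omega> \<in> space (Mk k). C1' < \<bar>U k \<omega>\<bar>} \<union> {\<omega> \<in> space (Mk k). C2' < \<bar>V k \<omega>\<bar>})"
    proof (rule S.finite_measure_mono)
      show "{\<omega> \<in> space (Mk k). \<exists>j\<le>p. C < \<bar>coef k j \<omega>\<bar>}
        \<subseteq> {\<omega> \<in> space (Mk k). C1' < \<bar>U k \<omega>\<bar>} \<union> {\<omega> \<in> space (Mk k). C2' < \<bar>V k \<omega>\<bar>}"
      proof
        fix \<omega> assume "\<omega> \<in> {\<omega> \<in> space (Mk k). \<exists>j\<le>p. C < \<bar>coef k j \<omega>\<bar>}"
        then obtain j where j: "\<omega> \<in> space (Mk k)" "j \<le> p" "C < \<bar>coef k j \<omega>\<bar>" by auto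
        then have "\<not> (\<bar>U k \<omega>\<bar> \<le> C1 \<and> \<bar>V k \<omega>\<bar> \<le> C2)" using bound[of k \<omega> j] by auto
        then show "\<omega> \<in> {\<omega> \<in> space (Mk k). C1' < \<bar>U k \<omega>\<bar>} \<union> {\<omega> \<in> space (Mk k). C2' < \<bar>V k \<omega>\<bar>}"
          using j(1) C0 by auto
      qed
    qed measurable
    also have "\<dots> \<le> measure (Mk k) {\<omega> \<in> space (Mk k). C1' < \<bar>U k \<omega>\<bar>} + measure (Mk k) {\<omega> \<in> space (Mk k). C2' < \<bar>V k \<omega>\<bar>}"
      by (intro measure_Un_le) measurable
    finally show ?case using elim by linarith
  qed
  then show ?thesis using \<open>C \<ge> 0\<close> by blast
qed

end

section \<open>Symmetrized residual empirical process\<close>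

context pearson_sequence
begin

definition tail_excess :: "nat \<Rightarrow> ereal \<Rightarrow> 'a \<Rightarrow> real" where
  "tail_excess k X \<omega> = rate k * (\<Sum>t\<in>times k. sym_level X (res k t \<omega>) - sym_level X (eps k t \<omega>))"

text \<open>Deterministic centring of \<open>tail_excess\<close>. It is zero at infinity, where
  \<open>sym_level\<close> is constant and takes the same value at residuals and
  innovations.\<close>

definition tail_shift :: "nat \<Rightarrow> ereal \<Rightarrow> real" where
  "tail_shift k X = (if X = \<infinity> then 0 else sw k / rate k * (S.mean_jump k (real_of_ereal X) - S.mean_jump k (- real_of_ereal X)))"

lemma tail_excess_measurable [measurable]: "tail_excess k X \<in> borel_measurable (Mk k)"
  unfolding tail_excess_def by measurable

lemma AE_tail_excess:
  "AE \<omega> in Mk k. tail_excess k (ereal y) \<omega> = S.level_excess k (rate k) (times k) (\<lambda>j. coef k j \<omega>) 0 y \<omega>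
     - S.level_excess k (rate k) (times k) (\<lambda>j. coef k j \<omega>) 0 (- y) \<omega>"
  using S.AE_residual[OF mu rate(1)[of k], where n="N k"]
proof eventually_elim
  case (elim \<omega>)
  have r: "res k t \<omega> = eps k t \<omega> - cfg_perturb p \<beta> (rate k) (\<lambda>j. coef k j \<omega>) 0 t (S.cfg k \<omega>)" if "t \<in> times k" for t
    using elim that unfolding res_def coef_def times_def yobs_def Y by simp
  have lev: "sym_level (ereal y) u = level y u - level (- y) u" for u
    by (simp add: sym_level_def level_def)
  have shift: "level y' (e - c) = level (y' + c) e" for y' e c
    by (simp add: level_def le_diff_eq diff_le_eq)
  have "tail_excess k (ereal y) \<omega> = rate k * (\<Sum>t\<in>times k.
      (level (y + cfg_perturb p \<beta> (rate k) (\<lambda>j. coef k j \<omega>) 0 t (S.cfg k \<omega>)) (eps k t \<omega>) - level y (eps k t \<omega>))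
      - (level (- y + cfg_perturb p \<beta> (rate k) (\<lambda>j. coef k j \<omega>) 0 t (S.cfg k \<omega>)) (eps k t \<omega>) - level (- y) (eps k t \<omega>)))"
    unfolding tail_excess_def by (intro arg_cong2[where f="(*)"] refl sum.cong) (simp add: r lev shift)
  then show ?case
    unfolding S.level_excess_def sum_subtractf right_diff_distrib .
qed

text \<open>The order of choice matters: \<open>C\<close> from tightness of the coefficients, then
  the mesh \<open>\<eta>\<close> so that the enclosure cost, at most \<open>\<eta> * B\<close>,
  stays below \<open>e / 3\<close>. Both are fixed, hence so is the grid, when
  \<open>error_bound_tendsto\<close> removes the remaining term.\<close>

lemma tail_excess_conv: "conv_prob0 Mk (\<lambda>k \<omega>. tail_excess k (ereal y) \<omega> - tail_shift k (ereal y))"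
  unfolding conv_prob0_def
proof (intro allI impI LIMSEQ_I)
  fix \<delta>' e :: real assume \<delta>': "0 < \<delta>'" and e: "0 < e"
  define \<delta> where "\<delta> = \<delta>' / 5"
  have \<delta>: "0 < \<delta>" using \<delta>' by (simp add: \<delta>_def)
  obtain C where C0: "C \<ge> 0" and C: "\<forall>\<^sub>F k in sequentially. measure (Mk k) {\<omega> \<in> space (Mk k). \<exists>j\<le>p. C < \<bar>coef k j \<omega>\<bar>} < e / 3"
    using coef_tight[of "e / 3"] e by auto
  define B where "B = 2 * K1 * ((real p + 1) * mom) / \<delta>"
  have K1: "0 \<le> K1" using S.K_nonneg(1) .
  have mom0: "0 \<le> mom" using S.moment_ge_1[of 0] moment_le[of 0] by linarith
  have B0: "0 \<le> B" using K1 mom0 \<delta> by (simp add: B_def)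
  define \<eta> where "\<eta> = e / (3 * (B + 1))"
  have \<eta>: "0 < \<eta>" using e B0 by (simp add: \<eta>_def)
  have \<eta>B: "\<eta> * B < e / 3"
  proof -
    have "\<eta> * B < \<eta> * (B + 1)" using \<eta> by simp
    also have "\<dots> = e / 3" using B0 by (simp add: \<eta>_def field_simps)
    finally show ?thesis .
  qed
  let ?C' = "\<eta> * real_of_int (\<lceil>C / \<eta>\<rceil> + 1) + \<eta>"
  let ?g = "real (card (grid p \<eta> (\<lceil>C / \<eta>\<rceil> + 1)))"
  have C'0: "0 \<le> ?C'"
  proof -
    have "0 \<le> \<lceil>C / \<eta>\<rceil>" using C0 \<eta> by (simp add: less_le_trans[of _ 0])
    then show ?thesis using \<eta> by (intro add_nonneg_nonneg mult_nonneg_nonneg) auto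
  qed
  have "(\<lambda>k. ?g * (4 * (S.error_bound k (rate k) ?C' / \<delta>))) \<longlonglongrightarrow> ?g * (4 * (0 / \<delta>))"
    using \<delta> by (intro tendsto_mult tendsto_divide tendsto_const error_bound_tendsto C'0) auto
  then have mid: "\<forall>\<^sub>F k in sequentially. ?g * (4 * (S.error_bound k (rate k) ?C' / \<delta>)) < e / 3"
    using e by (intro order_tendstoD(2)) auto
  have "\<forall>\<^sub>F k in sequentially. measure (Mk k) {\<omega> \<in> space (Mk k). \<delta>' < \<bar>tail_excess k (ereal y) \<omega> - tail_shift k (ereal y)\<bar>} < e"
    using C mid
  proof eventually_elim
    case (elim k)
    have "measure (Mk k) {\<omega> \<in> space (Mk k). 5 * \<delta> < \<bar>tail_excess k (ereal y) \<omega> - sw k / rate k * (S.mean_jump k y - S.mean_jump k (- y))\<bar>}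
      \<le> measure (Mk k) {\<omega> \<in> space (Mk k). \<exists>j\<le>p. C < \<bar>coef k j \<omega>\<bar>} + ?g * (4 * (S.error_bound k (rate k) ?C' / \<delta>))
        + 2 * \<eta> * K1 * ((real p + 1) * S.moment k) / \<delta>"
      by (rule S.symmetric_excess_bound[OF rate(1,4,3) _ \<eta> \<delta> coef_measurable tail_excess_measurable AE_tail_excess])
        (simp_all add: density_sym)
    moreover have "2 * \<eta> * K1 * ((real p + 1) * S.moment k) / \<delta> \<le> \<eta> * B"
      unfolding B_def using moment_le[of k] \<eta> K1 \<delta>
      by (simp add: divide_right_mono mult_left_mono mult.assoc mult.left_commute)
    ultimately show ?case using elim \<eta>B by (simp add: tail_shift_def \<delta>_def)
  qed
  then show "\<exists>k0. \<forall>k\<ge>k0. norm (measure (Mk k) {\<omega> \<in> space (Mk k). \<delta>' < \<bar>tail_excess k (ereal y) \<omega> - tail_shift k (ereal y)\<bar>} - 0) < e"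
    by (simp add: eventually_sequentially)
qed

lemma tail_excess_conv_cells:
  assumes "j \<le> m"
  shows "conv_prob0 Mk (\<lambda>k \<omega>. tail_excess k (x j) \<omega> - tail_shift k (x j))"
  using assms
proof (cases rule: x_cases)
  case 1
  then have "tail_excess k (x j) \<omega> - tail_shift k (x j) = 0" for k \<omega>
    by (simp add: tail_excess_def tail_shift_def sym_level_infinity)
  then show ?thesis by (simp add: conv_prob0_def)
next
  case (2 y)
  then show ?thesis using tail_excess_conv[of y] by simp
qed

text \<open>With the factor 2, differences over a cell are the entries of
  \<open>outlier_delta\<close>.\<close>

definition limit_shift :: "ereal \<Rightarrow> real" where
  "limit_shift X = 2 * extend_at_infty 0 (outlier_shift_sym (cdf G) p \<beta> Q) X"

lemma tail_shift_tendsto: "(\<lambda>k. tail_shift k X) \<longlonglongrightarrow> \<gamma> * limit_shift X"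
proof (cases "X = \<infinity>")
  case True
  then show ?thesis by (simp add: tail_shift_def limit_shift_def extend_at_infty_def)
next
  case False
  have "(\<lambda>k. sw k / rate k * (S.mean_jump k (real_of_ereal X) - S.mean_jump k (- real_of_ereal X)))
    \<longlonglongrightarrow> \<gamma> * (outlier_shift (cdf G) p \<beta> Q (real_of_ereal X) - outlier_shift (cdf G) p \<beta> Q (- real_of_ereal X))"
    by (intro tendsto_mult tendsto_diff sw_tendsto mean_jump_tendsto)
  moreover have "limit_shift X = outlier_shift (cdf G) p \<beta> Q (real_of_ereal X) - outlier_shift (cdf G) p \<beta> Q (- real_of_ereal X)"
    using False by (simp add: limit_shift_def extend_at_infty_def outlier_shift_sym_def)
  ultimately show ?thesis
    by (simp only: tail_shift_def False if_False)
qed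

section \<open>Cell counts and the limit law of the statistic\<close>

definition count :: "nat \<Rightarrow> nat \<Rightarrow> (int \<Rightarrow> real) \<Rightarrow> real" where
  "count k j e = (\<Sum>t\<in>times k. indicator (sym_cell x j) (e t))"

definition shift :: "nat \<Rightarrow> nat \<Rightarrow> real" where
  "shift k j = tail_shift k (x j) - tail_shift k (x (j - 1))"

definition statistic :: "nat \<Rightarrow> 'a \<Rightarrow> real" where
  "statistic k \<omega> = sym_pearson (cdf G) m x (N k) (\<lambda>t. res k t \<omega>)"

lemma count_measurable:
  assumes "j \<in> {1..m}" "\<And>t. f t \<in> borel_measurable (Mk k)"
  shows "(\<lambda>\<omega>. count k j (\<lambda>t. f t \<omega>)) \<in> borel_measurable (Mk k)"
proof -
  note [measurable] = cell_borel[OF assms(1)] assms(2)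
  show ?thesis unfolding count_def by measurable
qed

lemma statistic_eq:
  "statistic k \<omega> = (\<Sum>j\<in>{1..m}. ((count k j (\<lambda>t. res k t \<omega>) - card (times k) * \<pi> j) / sqrt (card (times k)))\<^sup>2 / \<pi> j)"
proof -
  have c: "real (card {t \<in> {1..int (N k)}. res k t \<omega> \<in> sym_cell x j}) = count k j (\<lambda>t. res k t \<omega>)" for j
    unfolding count_def times_def by (simp add: indicator_def of_bool_def sum.If_cases Int_def)
  show ?thesis
    unfolding statistic_def sym_pearson_def c using N(2)[of k]
    by (intro sum.cong refl) (simp add: rate(5) power_divide)
qed

text \<open>Cell indicators are increments of \<open>sym_level\<close>, so residual and innovation
  counts differ by an increment of \<open>tail_excess\<close>. Its deterministic centring joins the
  main term as \<open>shift\<close>; the rest is negligible by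
  \<open>remainder_conv\<close>.\<close>

lemma count_decomposition:
  assumes j: "j \<in> {1..m}"
  shows "(count k j (\<lambda>t. res k t \<omega>) - card (times k) * \<pi> j) / sqrt (card (times k))
    = ((count k j (\<lambda>t. eps k t \<omega>) - card (times k) * \<pi> j) / sqrt (card (times k)) + shift k j)
      + ((tail_excess k (x j) \<omega> - tail_shift k (x j)) - (tail_excess k (x (j - 1)) \<omega> - tail_shift k (x (j - 1))))"
proof -
  have "rate k * (count k j (\<lambda>t. res k t \<omega>) - count k j (\<lambda>t. eps k t \<omega>)) = tail_excess k (x j) \<omega> - tail_excess k (x (j - 1)) \<omega>"
    unfolding count_def tail_excess_def indicator_cell[OF j] right_diff_distrib[symmetric] sum_subtractf[symmetric]
    by (intro arg_cong2[where f="(*)"] refl sum.cong) simp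
  then show ?thesis
    unfolding rate(5) shift_def rate_def by (simp add: diff_divide_distrib algebra_simps)
qed

lemma remainder_conv:
  assumes "j \<in> {1..m}"
  shows "conv_prob0 Mk (\<lambda>k \<omega>. (tail_excess k (x j) \<omega> - tail_shift k (x j)) - (tail_excess k (x (j - 1)) \<omega> - tail_shift k (x (j - 1))))"
  using assms by (intro conv_prob0_diff S.prob_space_axioms tail_excess_conv_cells) auto

definition cell_drift :: "nat \<Rightarrow> nat \<Rightarrow> real" where
  "cell_drift k j = mix k * sqrt (real (N k)) * (sym_cell_prob (cdf H) x j - \<pi> j)"

lemma cell_prob:
  assumes j: "j \<in> {1..m}"
  shows "measure (Mk k) {\<omega> \<in> space (Mk k). eps k t \<omega> \<in> sym_cell x j} = \<pi> j + cell_drift k j / sqrt (card (times k))"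
proof -
  \<comment> \<open>By symmetry of the innovation law the mass between \<open>- X\<close> and
    \<open>X\<close> is twice the distribution function minus 1; at infinity the value 1 fits the
    same formula.\<close>
  have E: "S.expectation k (\<lambda>\<omega>. sym_level X (eps k t \<omega>)) = 2 * extend_at_infty 1 (Ak k) X - 1" if "0 \<le> X" for X
  proof (cases X)
    case (real y)
    have i: "S.expectation k (\<lambda>\<omega>. level y (eps k t \<omega>)) = Ak k y" for y
    proof -
      have "S.expectation k (\<lambda>\<omega>. level y (eps k t \<omega>)) = (\<integral>e. level y e \<partial>distr (Mk k) borel (eps k t))"
        by (subst integral_distr) auto
      also have "distr (Mk k) borel (eps k t) = distr (Mk k) borel (eps k 0)"
        by (rule S.innov_law)
      also have "(\<integral>e. level y e \<partial>distr (Mk k) borel (eps k 0)) = Ak k y"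
        by (rule S.integral_level)
      finally show ?thesis .
    qed
    have "S.expectation k (\<lambda>\<omega>. sym_level X (eps k t \<omega>)) = S.expectation k (\<lambda>\<omega>. level y (eps k t \<omega>) - level (- y) (eps k t \<omega>))"
      by (simp add: real sym_level_def level_def)
    also have "\<dots> = Ak k y - Ak k (- y)"
      by (subst Bochner_Integration.integral_diff) (auto simp: i level_bd intro!: S.integrable_const_bound[of _ 1])
    also have "\<dots> = 2 * Ak k y - 1" by (simp add: cdf_sym algebra_simps)
    finally show ?thesis by (simp add: real extend_at_infty_def)
  qed (use that in \<open>auto simp: sym_level_infinity extend_at_infty_def S.prob_space\<close>)
  have int: "integrable (Mk k) (\<lambda>\<omega>. sym_level X (eps k t \<omega>))" for X
    by (intro S.integrable_const_bound[of _ 1]) (auto simp: sym_level_def)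
  note [measurable] = cell_borel[OF j]
  have x: "0 \<le> x j" "0 \<le> x (j - 1)" using j by (auto intro!: x_nonneg)
  have "measure (Mk k) {\<omega> \<in> space (Mk k). eps k t \<omega> \<in> sym_cell x j}
    = S.expectation k (indicator {\<omega> \<in> space (Mk k). eps k t \<omega> \<in> sym_cell x j})"
    by (simp add: Int_absorb2)
  also have "\<dots> = S.expectation k (\<lambda>\<omega>. indicator (sym_cell x j) (eps k t \<omega>))"
    by (intro Bochner_Integration.integral_cong) (auto simp: indicator_def)
  also have "\<dots> = S.expectation k (\<lambda>\<omega>. sym_level (x j) (eps k t \<omega>) - sym_level (x (j - 1)) (eps k t \<omega>))"
    by (simp only: indicator_cell[OF j])
  also have "\<dots> = 2 * extend_at_infty 1 (Ak k) (x j) - 2 * extend_at_infty 1 (Ak k) (x (j - 1))"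
    using Bochner_Integration.integral_diff[OF int int, of "x j" "x (j - 1)"] E[OF x(1)] E[OF x(2)] by linarith
  also have "\<dots> = \<pi> j + mix k * (sym_cell_prob (cdf H) x j - \<pi> j)"
    by (simp add: sym_cell_prob_def extend_at_infty_def algebra_simps)
  also have "mix k * (sym_cell_prob (cdf H) x j - \<pi> j) = cell_drift k j / sqrt (card (times k))"
    using N(2)[of k] by (simp add: cell_drift_def rate(5))
  finally show ?thesis .
qed

lemma noncentrality_eq:
  "noncentrality (cdf G) (cdf H) m x p \<beta> Q \<rho>' \<gamma>'
    = (\<Sum>j=1..m. (\<rho>' * (sym_cell_prob (cdf H) x j - \<pi> j) + \<gamma>' * outlier_delta (cdf G) p \<beta> Q x j)\<^sup>2 / \<pi> j)"
  using \<pi>_pos unfolding noncentrality_def L2_set_def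
  by (subst real_sqrt_pow2) (auto intro!: sum_nonneg sum.cong simp: power_divide less_imp_le)

lemma noncentrality_nonneg: "0 \<le> noncentrality (cdf G) (cdf H) m x p \<beta> Q \<rho>' \<gamma>'"
  unfolding noncentrality_def by simp

text \<open>The innovation counts with their deterministic shift fall under
  \<open>multinomial_laplace_tendsto\<close>, where \<open>cell_drift\<close> carries the
  alternative and \<open>shift\<close> the outliers, so that both limits add up in the
  noncentrality; \<open>laplace_perturb\<close> then passes to the residual counts.\<close>

lemma statistic_laplace_tendsto:
  assumes t: "0 \<le> t"
  shows "(\<lambda>k. S.expectation k (\<lambda>\<omega>. exp (- (t / 2) * statistic k \<omega>)))
    \<longlonglongrightarrow> exp (- t * noncentrality (cdf G) (cdf H) m x p \<beta> Q \<rho> \<gamma> / (2 * (1 + t))) / sqrt (1 + t) ^ (m - 1)"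
proof -
  have "(\<lambda>k. S.expectation k (\<lambda>\<omega>. exp (- (t / 2) * (\<Sum>j\<in>{1..m}. ((count k j (\<lambda>t. eps k t \<omega>) - card (times k) * \<pi> j) / sqrt (card (times k)) + shift k j)\<^sup>2 / \<pi> j))))
    \<longlonglongrightarrow> exp (- t * (\<Sum>j\<in>{1..m}. (\<rho> * (sym_cell_prob (cdf H) x j - \<pi> j) + \<gamma> * outlier_delta (cdf G) p \<beta> Q x j)\<^sup>2 / \<pi> j) / (2 * (1 + t))) / sqrt (1 + t) ^ (card {1..m} - 1)"
    unfolding count_def
  proof (rule multinomial_laplace_tendsto[where d=cell_drift])
    show "filterlim (\<lambda>k. card (times k)) at_top sequentially" by (simp add: rate(5) N_at_top)
    show "card (times k) > 0" for k using N(2)[of k] by (simp add: rate(5))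
    show "prob_space.indep_vars (Mk k) (\<lambda>_. borel) (eps k) (times k)" for k
      using S.indep_vars_subset[OF S.innov_indep] by blast
    show "measure (Mk k) {\<omega> \<in> space (Mk k). eps k t \<omega> \<in> sym_cell x i} = \<pi> i + cell_drift k i / sqrt (card (times k))"
      if "i \<in> {1..m}" for k i t using that by (rule cell_prob)
    show "(\<lambda>k. cell_drift k i) \<longlonglongrightarrow> \<rho> * (sym_cell_prob (cdf H) x i - \<pi> i)" for i
      unfolding cell_drift_def by (intro tendsto_mult tendsto_const mix_tendsto(2))
    show "(\<lambda>k. shift k i) \<longlonglongrightarrow> \<gamma> * outlier_delta (cdf G) p \<beta> Q x i" for i
    proof -
      have "(\<lambda>k. shift k i) \<longlonglongrightarrow> \<gamma> * limit_shift (x i) - \<gamma> * limit_shift (x (i - 1))"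
        unfolding shift_def by (intro tendsto_diff tail_shift_tendsto)
      then show ?thesis by (simp add: limit_shift_def outlier_delta_def right_diff_distrib)
    qed
    \<comment> \<open>Telescopes to the values of \<open>tail_shift\<close> at infinity and at 0:
      the former is zero by definition, the latter because the two mean jumps are taken at the same
      point.\<close>
    show "(\<Sum>i\<in>{1..m}. shift k i) = 0" for k
      unfolding shift_def by (subst telescope_cells) (simp add: tail_shift_def)
  qed (use S.prob_space_axioms rate(4) cell_borel cells_disjoint cells_cover \<pi>_pos \<pi>_sum t in auto)
  then have L: "(\<lambda>k. S.expectation k (\<lambda>\<omega>. exp (- (t / 2) * (\<Sum>j\<in>{1..m}. ((count k j (\<lambda>t. eps k t \<omega>) - card (times k) * \<pi> j) / sqrt (card (times k)) + shift k j)\<^sup>2 / \<pi> j))))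
    \<longlonglongrightarrow> exp (- t * noncentrality (cdf G) (cdf H) m x p \<beta> Q \<rho> \<gamma> / (2 * (1 + t))) / sqrt (1 + t) ^ (m - 1)"
    unfolding noncentrality_eq by simp
  have "(\<lambda>k. S.expectation k (\<lambda>\<omega>. exp (- (t / 2) * (\<Sum>j\<in>{1..m}. (((count k j (\<lambda>t. eps k t \<omega>) - card (times k) * \<pi> j) / sqrt (card (times k)) + shift k j)
      + ((tail_excess k (x j) \<omega> - tail_shift k (x j)) - (tail_excess k (x (j - 1)) \<omega> - tail_shift k (x (j - 1)))))\<^sup>2 / \<pi> j))))
    \<longlonglongrightarrow> exp (- t * noncentrality (cdf G) (cdf H) m x p \<beta> Q \<rho> \<gamma> / (2 * (1 + t))) / sqrt (1 + t) ^ (m - 1)"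
  proof (rule laplace_perturb[OF S.prob_space_axioms _ t _ _ _ _ L])
    show "(\<lambda>\<omega>. (count k j (\<lambda>t. eps k t \<omega>) - card (times k) * \<pi> j) / sqrt (card (times k)) + shift k j) \<in> borel_measurable (Mk k)"
      if "j \<in> {1..m}" for k j
    proof -
      note [measurable] = count_measurable[OF that, of "eps k", OF S.eps_measurable]
      show ?thesis by measurable
    qed
  qed (use \<pi>_pos remainder_conv in auto)
  moreover have "statistic k \<omega> = (\<Sum>j\<in>{1..m}. (((count k j (\<lambda>t. eps k t \<omega>) - card (times k) * \<pi> j) / sqrt (card (times k)) + shift k j)
      + ((tail_excess k (x j) \<omega> - tail_shift k (x j)) - (tail_excess k (x (j - 1)) \<omega> - tail_shift k (x (j - 1)))))\<^sup>2 / \<pi> j)" for k \<omega>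
    unfolding statistic_eq by (intro sum.cong refl) (simp only: count_decomposition)
  ultimately show ?thesis by simp
qed

lemma statistic_measurable [measurable]: "statistic k \<in> borel_measurable (Mk k)"
proof -
  have "(\<lambda>\<omega>. \<Sum>j\<in>{1..m}. ((count k j (\<lambda>t. res k t \<omega>) - card (times k) * \<pi> j) / sqrt (card (times k)))\<^sup>2 / \<pi> j) \<in> borel_measurable (Mk k)"
    by (intro borel_measurable_sum borel_measurable_divide borel_measurable_power borel_measurable_diff borel_measurable_const
        count_measurable res_measurable)
  moreover have "statistic k = (\<lambda>\<omega>. \<Sum>j\<in>{1..m}. ((count k j (\<lambda>t. res k t \<omega>) - card (times k) * \<pi> j) / sqrt (card (times k)))\<^sup>2 / \<pi> j)"
    by (rule ext) (rule statistic_eq)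
  ultimately show ?thesis by simp
qed

lemma statistic_nonneg: "0 \<le> statistic k \<omega>"
  unfolding statistic_eq using \<pi>_pos by (intro sum_nonneg divide_nonneg_pos) auto

text \<open>The comparison law moves with \<open>k\<close> through its noncentrality. The law of the
  statistic and the comparison law both converge weakly to the law at the limit parameters, whose
  distribution function is continuous, and each comes within \<open>e / 2\<close> of it.\<close>

lemma statistic_uniform:
  assumes e: "0 < e"
  shows "\<forall>\<^sub>F k in sequentially. \<forall>u. \<bar>measure (Mk k) {\<omega> \<in> space (Mk k). statistic k \<omega> \<le> u}
     - cdf (noncentral_chi_square (m - 1) (noncentrality (cdf G) (cdf H) m x p \<beta> Q (\<rho>s k) (\<gamma>s k))) u\<bar> < e"
proof -
  let ?nc = "\<lambda>\<rho> \<gamma>. noncentrality (cdf G) (cdf H) m x p \<beta> Q \<rho> \<gamma>"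
  let ?L = "noncentral_chi_square (m - 1) (?nc \<rho> \<gamma>)"
  let ?\<mu> = "\<lambda>k. distr (Mk k) borel (statistic k)" and ?\<mu>' = "\<lambda>k. noncentral_chi_square (m - 1) (?nc (\<rho>s k) (\<gamma>s k))"
  have m1: "1 \<le> m - 1" using m by simp
  have rd: "real_distribution (?\<mu> k)" for k by (rule S.real_distribution_distr) measurable
  have nc: "real_distribution (noncentral_chi_square (m - 1) (?nc \<rho>' \<gamma>'))" "AE w in noncentral_chi_square (m - 1) (?nc \<rho>' \<gamma>'). 0 \<le> w" for \<rho>' \<gamma>'
    using real_distribution_noncentral_chi_square[OF m1 noncentrality_nonneg]
      noncentral_chi_square_nonneg[OF m1 noncentrality_nonneg] by auto
  have lap: "(\<integral>w. exp (- (real j / 2) * w) \<partial>noncentral_chi_square (m - 1) (?nc \<rho>' \<gamma>'))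
     = exp (- real j * ?nc \<rho>' \<gamma>' / (2 * (1 + real j))) / sqrt (1 + real j) ^ (m - 1)" for j \<rho>' \<gamma>'
    by (intro noncentral_chi_square_laplace m1 noncentrality_nonneg) simp
  have w1: "weak_conv_m ?\<mu> ?L"
  proof (rule laplace_conv_imp_weak_conv[OF rd nc(1) _ nc(2)])
    show "AE w in ?\<mu> k. 0 \<le> w" for k
      by (subst AE_distr_iff) (auto simp: statistic_nonneg)
    fix j :: nat
    have "(\<integral>w. exp (- (real j / 2) * w) \<partial>?\<mu> k) = S.expectation k (\<lambda>\<omega>. exp (- (real j / 2) * statistic k \<omega>))" for k
      by (subst integral_distr) auto
    then show "(\<lambda>k. \<integral>w. exp (- (real j / 2) * w) \<partial>?\<mu> k) \<longlonglongrightarrow> (\<integral>w. exp (- (real j / 2) * w) \<partial>?L)"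
      unfolding lap using statistic_laplace_tendsto[of "real j"] by simp
  qed
  have nc_lim: "(\<lambda>k. ?nc (\<rho>s k) (\<gamma>s k)) \<longlonglongrightarrow> ?nc \<rho> \<gamma>"
    unfolding noncentrality_eq
    by (intro tendsto_sum tendsto_divide tendsto_power tendsto_add tendsto_mult tendsto_const \<rho>s(3) \<gamma>s(3))
      (use \<pi>_pos in force)
  have w2: "weak_conv_m ?\<mu>' ?L"
  proof (rule laplace_conv_imp_weak_conv[OF nc(1) nc(1) nc(2) nc(2)])
    fix j :: nat
    show "(\<lambda>k. \<integral>w. exp (- (real j / 2) * w) \<partial>?\<mu>' k) \<longlonglongrightarrow> (\<integral>w. exp (- (real j / 2) * w) \<partial>?L)"
      unfolding lap by (intro tendsto_divide tendsto_exp tendsto_mult tendsto_const nc_lim) (auto simp: add_nonneg_eq_0_iff)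
  qed
  have cont: "isCont (cdf ?L) u" for u
    by (rule noncentral_chi_square_no_atoms[OF m1 noncentrality_nonneg])
  have e2: "0 < e / 2" using e by simp
  show ?thesis
    using weak_conv_uniform[OF rd nc(1) cont w1 e2] weak_conv_uniform[OF nc(1) nc(1) cont w2 e2]
  proof eventually_elim
    case (elim k)
    show ?case
    proof
      fix u
      have "cdf (?\<mu> k) u = measure (Mk k) {\<omega> \<in> space (Mk k). statistic k \<omega> \<le> u}"
        unfolding cdf_def by (subst measure_distr) (auto intro!: arg_cong[where f="measure (Mk k)"])
      moreover have "\<bar>cdf (?\<mu> k) u - cdf ?L u\<bar> < e / 2" "\<bar>cdf (?\<mu>' k) u - cdf ?L u\<bar> < e / 2"
        using elim by auto
      ultimately show "\<bar>measure (Mk k) {\<omega> \<in> space (Mk k). statistic k \<omega> \<le> u} - cdf (?\<mu>' k) u\<bar> < e"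
        by linarith
    qed
  qed
qed

end

section \<open>Uniformity over the parameter rectangle\<close>

lemma (in pearson_test) uniform_convergence:
  assumes \<Gamma>R: "0 \<le> \<Gamma>" "0 \<le> R"
  shows "(\<lambda>n. SUP (u, \<gamma>, \<rho>) \<in> UNIV \<times> {0..\<Gamma>} \<times> {0..R}.
       ereal \<bar>measure (M n \<gamma> \<rho>)
                {\<omega> \<in> space (M n \<gamma> \<rho>).
                   sym_pearson (cdf G) m x n
                     (residual p (mu_hat n (Y n \<gamma> \<rho> \<omega>)) (beta_hat n (Y n \<gamma> \<rho> \<omega>)) (Y n \<gamma> \<rho> \<omega>)) \<le> u}
              - cdf (noncentral_chi_square (m - 1) (noncentrality (cdf G) (cdf H) m x p \<beta> Q \<rho> \<gamma>)) u\<bar>)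
    \<longlonglongrightarrow> 0"
proof -
  define d where "d n u \<gamma> \<rho> = \<bar>measure (M n \<gamma> \<rho>)
                {\<omega> \<in> space (M n \<gamma> \<rho>).
                   sym_pearson (cdf G) m x n
                     (residual p (mu_hat n (Y n \<gamma> \<rho> \<omega>)) (beta_hat n (Y n \<gamma> \<rho> \<omega>)) (Y n \<gamma> \<rho> \<omega>)) \<le> u}
              - cdf (noncentral_chi_square (m - 1) (noncentrality (cdf G) (cdf H) m x p \<beta> Q \<rho> \<gamma>)) u\<bar>" for n u \<gamma> \<rho>
  define F where "F n = (SUP (u, \<gamma>, \<rho>) \<in> UNIV \<times> {0..\<Gamma>} \<times> {0..R}. ereal (d n u \<gamma> \<rho>))" for n
  have F0: "0 \<le> F n" for n
    unfolding F_def using \<Gamma>R by (intro SUP_upper2[of "(0, 0, 0)"]) (auto simp: d_def)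
  have small: "\<forall>\<^sub>F n in sequentially. F n < a" if a: "0 < a" for a
  proof (rule ccontr)
    assume contr: "\<not> (\<forall>\<^sub>F n in sequentially. F n < a)"
    obtain e where e: "0 < ereal e" "ereal e < a" using ereal_dense2[OF a] by blast
    \<comment> \<open>The condition \<open>1 \<le> n\<close> keeps to the sample sizes for which a
      model is given; it excludes a single index, which cannot affect a limit.\<close>
    have inf: "infinite {n. 1 \<le> n \<and> ereal e < F n}"
    proof
      assume "finite {n. 1 \<le> n \<and> ereal e < F n}"
      then obtain b where b: "\<And>n. 1 \<le> n \<Longrightarrow> ereal e < F n \<Longrightarrow> n \<le> b"
        unfolding finite_nat_set_iff_bounded_le by auto
      have "\<forall>\<^sub>F n in sequentially. F n < a"
        using eventually_gt_at_top[of "max 1 b"]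
      proof eventually_elim
        case (elim n)
        then have "\<not> ereal e < F n" using b[of n] by auto
        then show ?case using e(2) by (simp add: not_less le_less_trans)
      qed
      then show False using contr by simp
    qed
    obtain r :: "nat \<Rightarrow> nat" where r: "strict_mono r" "\<And>k. r k \<in> {n. 1 \<le> n \<and> ereal e < F n}"
      using infinite_enumerate[OF inf] by blast
    have "\<exists>u \<gamma> \<rho>. (\<gamma>, \<rho>) \<in> {0..\<Gamma>} \<times> {0..R} \<and> e < d (r k) u \<gamma> \<rho>" for k
    proof -
      have "ereal e < F (r k)" using r(2)[of k] by simp
      then show ?thesis unfolding F_def by (auto simp: less_SUP_iff) blast
    qed
    then obtain u \<gamma>' \<rho>' where bad: "\<And>k. (\<gamma>' k, \<rho>' k) \<in> {0..\<Gamma>} \<times> {0..R}" "\<And>k. e < d (r k) (u k) (\<gamma>' k) (\<rho>' k)"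
      by metis
    \<comment> \<open>Compactness of the closed rectangle yields convergent parameters along a
      further subsequence; the composed sample sizes \<open>r (s k)\<close> still increase
      strictly.\<close>
    have "seq_compact ({0..\<Gamma>} \<times> {0..R})"
      by (intro compact_imp_seq_compact compact_Times compact_Icc)
    then obtain l s where s: "strict_mono s" "((\<lambda>k. (\<gamma>' k, \<rho>' k)) \<circ> s) \<longlonglongrightarrow> l"
      using bad(1) by (elim seq_compactE) auto
    have lims: "(\<lambda>k. \<gamma>' (s k)) \<longlonglongrightarrow> fst l" "(\<lambda>k. \<rho>' (s k)) \<longlonglongrightarrow> snd l"
      using tendsto_fst[OF s(2)] tendsto_snd[OF s(2)] by (simp_all add: comp_def)
    interpret seq: pearson_sequence p m \<beta> \<nu> \<mu> G H Q x M \<epsilon> z \<xi> v mu_hat beta_hat Y g h K1 K2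
      "\<lambda>k. r (s k)" "\<lambda>k. \<gamma>' (s k)" "\<lambda>k. \<rho>' (s k)" "fst l" "snd l" \<Gamma> R
    proof unfold_locales
      show "strict_mono (\<lambda>k. r (s k))" using strict_mono_o[OF r(1) s(1)] by (simp add: comp_def)
      show "1 \<le> r (s k)" for k using r(2)[of "s k"] by simp
    qed (use bad(1) lims in auto)
    have "0 < e" using e(1) by simp
    from seq.statistic_uniform[OF this] obtain k where
      k: "\<And>u. \<bar>measure (seq.Mk k) {\<omega> \<in> space (seq.Mk k). seq.statistic k \<omega> \<le> u}
        - cdf (noncentral_chi_square (m - 1) (noncentrality (cdf G) (cdf H) m x p \<beta> Q (\<rho>' (s k)) (\<gamma>' (s k)))) u\<bar> < e"
      unfolding eventually_sequentially by blast
    have "d (r (s k)) (u (s k)) (\<gamma>' (s k)) (\<rho>' (s k)) < e"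
      using k[of "u (s k)"]
      unfolding d_def seq.statistic_def seq.res_def seq.muk_def seq.betak_def seq.yobs_def .
    then show False using bad(2)[of "s k"] by simp
  qed
  have "F \<longlonglongrightarrow> 0"
  proof (rule order_tendstoI)
    fix a :: ereal assume "a < 0"
    then show "\<forall>\<^sub>F n in sequentially. a < F n" using F0 by (intro always_eventually allI) (rule less_le_trans)
  qed (rule small)
  then show ?thesis unfolding F_def d_def .
qed

theorem theorem2p2:
  fixes p m :: nat
    and \<beta> :: "nat \<Rightarrow> real" and \<nu> \<mu> :: real
    and G H Q :: "real measure"
    and x :: "nat \<Rightarrow> ereal"
    and M :: "nat \<Rightarrow> real \<Rightarrow> real \<Rightarrow> 'a measure"
    and \<epsilon> z \<xi> v :: "nat \<Rightarrow> real \<Rightarrow> real \<Rightarrow> int \<Rightarrow> 'a \<Rightarrow> real"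
    and mu_hat :: "nat \<Rightarrow> (int \<Rightarrow> real) \<Rightarrow> real"
    and beta_hat :: "nat \<Rightarrow> (int \<Rightarrow> real) \<Rightarrow> nat \<Rightarrow> real"
    and Y :: "nat \<Rightarrow> real \<Rightarrow> real \<Rightarrow> 'a \<Rightarrow> int \<Rightarrow> real"
  assumes p: "p \<ge> 1"
    and stable: "ar_stable p \<beta>"
    and mu: "\<nu> = (1 - (\<Sum>j=1..p. \<beta> j)) * \<mu>"
    and laws: "real_distribution G" "real_distribution H" "real_distribution Q"
    and means: "(\<integral>u. u \<partial>G) = 0" "(\<integral>u. u \<partial>H) = 0"
    and variances: "integrable G (\<lambda>u. u\<^sup>2)" "integrable H (\<lambda>u. u\<^sup>2)"
    and smooth: "twice_diff_bounded (cdf G)" "twice_diff_bounded (cdf H)"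
    and symmetric: "distr G borel uminus = G" "distr H borel uminus = H"
    and m: "m > 1"
    and cells: "x 0 = 0" "x m = \<infinity>" "\<And>j. j < m \<Longrightarrow> x j < x (Suc j)"
    and cells_pos: "\<And>j. 1 \<le> j \<Longrightarrow> j \<le> m \<Longrightarrow>
        extend_at_infty 1 (cdf G) (x j) - extend_at_infty 1 (cdf G) (x (j - 1)) > 0"
    and model: "\<And>n \<gamma> \<rho>. n \<ge> 1 \<Longrightarrow> \<gamma> \<ge> 0 \<Longrightarrow> \<rho> \<ge> 0 \<Longrightarrow>
        contaminated_ar (M n \<gamma> \<rho>) p \<beta> \<nu>
          (\<lambda>u. (1 - min 1 (\<rho> / sqrt (real n))) * cdf G u + min 1 (\<rho> / sqrt (real n)) * cdf H u)
          (min 1 (\<gamma> / sqrt (real n))) Q (\<epsilon> n \<gamma> \<rho>) (z n \<gamma> \<rho>) (\<xi> n \<gamma> \<rho>) (v n \<gamma> \<rho>)"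
    and Y: "\<And>n \<gamma> \<rho>. Y n \<gamma> \<rho> = observations p n (v n \<gamma> \<rho>) (z n \<gamma> \<rho>) (\<xi> n \<gamma> \<rho>)"
    and mu_hat_measurable: "\<And>n. n \<ge> 1 \<Longrightarrow>
        mu_hat n \<in> borel_measurable (PiM (sample_window p n) (\<lambda>_. borel))"
    and beta_hat_measurable: "\<And>n j. n \<ge> 1 \<Longrightarrow> 1 \<le> j \<Longrightarrow> j \<le> p \<Longrightarrow>
        (\<lambda>y. beta_hat n y j) \<in> borel_measurable (PiM (sample_window p n) (\<lambda>_. borel))"
    and mu_hat_root_n: "\<And>\<Gamma> R. \<Gamma> \<ge> 0 \<Longrightarrow> R \<ge> 0 \<Longrightarrow>
        unif_bounded_in_prob M (\<lambda>n \<gamma> \<rho> \<omega>. sqrt (real n) * (mu_hat n (Y n \<gamma> \<rho> \<omega>) - \<mu>)) \<Gamma> R"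
    and beta_hat_root_n: "\<And>\<Gamma> R. \<Gamma> \<ge> 0 \<Longrightarrow> R \<ge> 0 \<Longrightarrow>
        unif_bounded_in_prob M
          (\<lambda>n \<gamma> \<rho> \<omega>. L2_set (\<lambda>j. sqrt (real n) * (beta_hat n (Y n \<gamma> \<rho> \<omega>) j - \<beta> j)) {1..p}) \<Gamma> R"
  shows "\<forall>\<Gamma>\<ge>0. \<forall>R\<ge>0.
    (\<lambda>n. SUP (u, \<gamma>, \<rho>) \<in> UNIV \<times> {0..\<Gamma>} \<times> {0..R}.
       ereal \<bar>measure (M n \<gamma> \<rho>)
                {\<omega> \<in> space (M n \<gamma> \<rho>).
                   sym_pearson (cdf G) m x n
                     (residual p (mu_hat n (Y n \<gamma> \<rho> \<omega>)) (beta_hat n (Y n \<gamma> \<rho> \<omega>)) (Y n \<gamma> \<rho> \<omega>)) \<le> u}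
              - cdf (noncentral_chi_square (m - 1) (noncentrality (cdf G) (cdf H) m x p \<beta> Q \<rho> \<gamma>)) u\<bar>)
    \<longlonglongrightarrow> 0"
proof -
  obtain g K1 K2 where g: "\<And>u w. \<bar>cdf G w - cdf G u\<bar> \<le> K1 * \<bar>w - u\<bar>"
    "\<And>u w. \<bar>cdf G (u + w) - cdf G u - g u * w\<bar> \<le> K2 * w\<^sup>2" "\<And>u. g (- u) = g u" "\<And>u. cdf G (- u) = 1 - cdf G u"
    by (rule smooth_symmetric_cdf[OF laws(1) smooth(1) symmetric(1)]) (rule that)
  obtain h L1 L2 where h: "\<And>u w. \<bar>cdf H w - cdf H u\<bar> \<le> L1 * \<bar>w - u\<bar>"
    "\<And>u w. \<bar>cdf H (u + w) - cdf H u - h u * w\<bar> \<le> L2 * w\<^sup>2" "\<And>u. h (- u) = h u" "\<And>u. cdf H (- u) = 1 - cdf H u"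
    by (rule smooth_symmetric_cdf[OF laws(2) smooth(2) symmetric(2)]) (rule that)
  \<comment> \<open>The two laws come with separate constants; the maxima serve both.\<close>
  have weaken: "b \<le> max c c' * d" if "b \<le> c * d \<or> b \<le> c' * d" "0 \<le> d" for b c c' d :: real
    using that mult_right_mono[of c "max c c'" d] mult_right_mono[of c' "max c c'" d] by auto
  interpret pearson_test p m \<beta> \<nu> \<mu> G H Q x M \<epsilon> z \<xi> v mu_hat beta_hat Y g h "max K1 L1" "max K2 L2"
  proof (rule pearson_test.intro)
    show "\<bar>cdf G w - cdf G u\<bar> \<le> max K1 L1 * \<bar>w - u\<bar>" "\<bar>cdf H w - cdf H u\<bar> \<le> max K1 L1 * \<bar>w - u\<bar>" for u w
      using g(1) h(1) by (intro weaken; simp)+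
    show "\<bar>cdf G (u + w) - cdf G u - g u * w\<bar> \<le> max K2 L2 * w\<^sup>2" "\<bar>cdf H (u + w) - cdf H u - h u * w\<bar> \<le> max K2 L2 * w\<^sup>2" for u w
      using g(2) h(2) by (intro weaken; simp)+
  qed (fact g h stable mu laws variances m cells cells_pos model Y mu_hat_measurable beta_hat_measurable
      mu_hat_root_n beta_hat_root_n)+
  show ?thesis
    by (intro allI impI uniform_convergence)
qed

end
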